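(* Suppose that $t_0, X > 0$ and $0 < y_0 \leq 1$ satisfy: (i) there are no zeroes $\zeta(\sigma+iT)=0$ of the Riemann zeta function with $\frac{1+y_0}{2} \leq \sigma \leq 1$ and $0 \leq T \leq \frac{X}{2}$; (ii) there are no zeroes $H_{t_0}(x+iy)=0$ with $x \geq X + \sqrt{1-y_0^2}$ and $y_0 \leq y \leq \sqrt{1-2t_0}$; (iii) there are no zeroes $H_t(x+iy)=0$ with $X \leq x \leq X+\sqrt{1-y_0^2}$, $\sqrt{y_0^2 + 2(t_0-t)} \leq y \leq \sqrt{1-2t}$, and $0 \leq t \leq t_0$. Then $\Lambda \leq t_0 + \frac{1}{2}y_0^2$.
   Context: Let $\Phi(u) = \sum_{n=1}^\infty (2\pi^2 n^4 e^{9u} - 3\pi n^2 e^{5u})\exp(-\pi n^2 e^{4u})$ and, for $t\in\mathbb{R}$, $z \in \mathbb{C}$, $H_t(z) = \int_0^\infty e^{tu^2}\Phi(u)\cos(zu)\,du$. The de Bruijn–Newman constant $\Lambda$ is the real number such that $H_t$ has only real zeroes if and only if $t\geq \Lambda$. Throughout, $x,y$ denote real numbers. *)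

theory Defs
  imports "HOL-Complex_Analysis.Complex_Analysis"
begin

definition Phi :: "real \<Rightarrow> real" where
  "Phi u = (\<Sum>k. let n = real (Suc k) in
     (2 * pi\<^sup>2 * n ^ 4 * exp (9 * u) - 3 * pi * n\<^sup>2 * exp (5 * u))
       * exp (- pi * n\<^sup>2 * exp (4 * u)))"

definition H :: "real \<Rightarrow> complex \<Rightarrow> complex" where
  "H t z = (LBINT u:{0..}. of_real (exp (t * u\<^sup>2) * Phi u) * cos (z * of_real u))"

definition has_only_real_zeros :: "(complex \<Rightarrow> complex) \<Rightarrow> bool" where
  "has_only_real_zeros f \<longleftrightarrow> (\<forall>z. f z = 0 \<longrightarrow> z \<in> \<real>)"

(* That such a real number exists is due to de Bruijn and Newman; the property
   determines it uniquely, see de_Bruijn_Newman_constant_unique. *)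
definition is_de_Bruijn_Newman_constant :: "real \<Rightarrow> bool" where
  "is_de_Bruijn_Newman_constant L \<longleftrightarrow> (\<forall>t. has_only_real_zeros (H t) \<longleftrightarrow> t \<ge> L)"

lemma de_Bruijn_Newman_constant_unique:
  assumes "is_de_Bruijn_Newman_constant L" "is_de_Bruijn_Newman_constant L'"
  shows "L = L'"
  using assms unfolding is_de_Bruijn_Newman_constant_def
  by (meson order_antisym order_refl)

definition is_zeta_continuation :: "(complex \<Rightarrow> complex) \<Rightarrow> bool" where
  "is_zeta_continuation f \<longleftrightarrow> f holomorphic_on (- {1}) \<and>
     (\<forall>s. Re s > 1 \<longrightarrow> (\<lambda>k. 1 / of_nat (Suc k) powr s) sums f s)"

(* The value at the pole s = 1 is unspecified, so statements about zeros of zeta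
   have to exclude s = 1. *)
definition zeta :: "complex \<Rightarrow> complex" where
  "zeta = (SOME f. is_zeta_continuation f)"

lemma zeta_continuation_unique:
  assumes f: "is_zeta_continuation f" and g: "is_zeta_continuation g" and "s \<noteq> 1"
  shows "f s = g s"
proof (rule analytic_continuation_open[where f = f and g = g])
  show "open {s. Re s > 1}"
    by (rule open_halfspace_Re_gt)
  have "(2::complex) \<in> {s. Re s > 1}"
    by simp
  then show "{s. Re s > 1} \<noteq> {}"
    by blast
  have "connected (UNIV - {1::complex})"
    by (intro connected_open_delete) auto
  then show "connected (- {1::complex})"
    by (simp add: Compl_eq_Diff_UNIV)
  show "f z = g z" if "z \<in> {s. Re s > 1}" for z
    using f g that unfolding is_zeta_continuation_def by (blast intro: sums_unique2)
qed (use assms in \<open>auto simp: is_zeta_continuation_def\<close>)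

end

theory Submission
  imports Defs "HOL-Probability.Characteristic_Functions" "HOL-Real_Asymp.Real_Asymp"
begin

text \<open>
  Instead of following the zeros of \<open>H t\<close> by their differential equations, the heat flow is
  discretised. Multiplying the kernel by \<open>cosh (l u)\<close> turns the transform \<open>F\<close> into
  \<open>(F (z + \<i>l) + F (z - \<i>l)) / 2\<close>, and \<open>N\<close> such steps with \<open>l\<^sup>2 = 2 t / N\<close> approximate the factor
  \<open>exp (t u\<^sup>2)\<close>. By the Hadamard product, a zero \<open>x + \<i>y\<close> with \<open>y > 0\<close> after a step forces a zero
  \<open>a + \<i>b\<close> before it with \<open>(x - a)\<^sup>2 + y\<^sup>2 + l\<^sup>2 \<le> b\<^sup>2\<close>. Hence, over a time
  \<open>t\<close>, the squared half-width of a strip containing all zeros drops by \<open>2 t\<close>. Zeros with \<open>|x| \<le> X\<close> obey the same law: they start low by (i),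
  by (iii) and compactness the approximants have no high zeros above the barrier, and a zero beyond
  the barrier, which has \<open>b\<^sup>2 \<le> 1\<close>, is too far away to matter, the barrier having width
  \<open>\<surd>(1 - y\<^sub>0\<^sup>2)\<close>. Hurwitz' theorem and (ii) bound all zeros of \<open>H t\<^sub>0\<close> by \<open>y\<^sub>0\<close>, and after a further
  time \<open>y\<^sub>0\<^sup>2 / 2\<close> they are real.

  The zeros of \<open>H 0\<close> are those of \<open>\<zeta>\<close> because \<open>\<Phi>\<close> is even, by the transformation formula of the
  theta function; the Mellin transform of \<open>\<Phi>\<close> then exhibits a continuation of the Dirichlet series.
\<close>

section \<open>Hadamard products of order less than one\<close>

text \<open>Along the true flow zeros may collide, and their velocities are sums over all other
  zeros. A discrete step needs neither simplicity nor velocities, only a comparison of two values of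
  a product. That product is harmless because every transform here is even: it has the form
  \<open>g (z\<^sup>2)\<close> with \<open>g\<close> of order at most 3/4, so \<open>g\<close> is
  determined by its zeros up to a constant, and finite partial products suffice. The constants fit
  as follows. With B = y0^2 + 2 t0, the floor in (iii) at time t is sqrt (B - 2 t), the height that
  a zero starting below sqrt B cannot exceed after time t. A zero beyond the barrier has b^2 <= 1 -
  2 t, and its distance costs at least 1 - y0^2, which leaves at most y0^2 - 2 t, below B - 2 t. The
  strip bound 1 at time 0 is the nonvanishing of zeta for Re s > 1. Since \<open>zeta\<close> is a
  choice among continuations, this fact and the use of (i) require that one be constructed.\<close>

lemma entire_factor_zero:
  assumes g: "g holomorphic_on UNIV" and "g a = 0" and "g b \<noteq> 0"
  obtains n :: nat and h where "n > 0" "h holomorphic_on UNIV" "h a \<noteq> 0"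
    "\<And>w. g w = (w - a) ^ n * h w"
proof -
  have nc: "\<not> g constant_on UNIV"
    using assms unfolding constant_on_def by (metis UNIV_I)
  obtain k r n where k: "0 < n" "0 < r" "k holomorphic_on ball a r"
      "\<And>w. w \<in> ball a r \<Longrightarrow> g w = (w - a) ^ n * k w" "\<And>w. w \<in> ball a r \<Longrightarrow> k w \<noteq> 0"
    using holomorphic_factor_zero_nonconstant[OF g open_UNIV connected_UNIV UNIV_I \<open>g a = 0\<close> nc]
    by metis
  define h where "h = (\<lambda>w. if w = a then k a else g w / (w - a) ^ n)"
  have hk: "h w = k w" if "w \<in> ball a r" for w
    using k(4)[OF that] by (auto simp: h_def)
  have "h holomorphic_on ball a r"
    using k(3) by (rule holomorphic_transform) (simp add: hk)
  moreover have "(\<lambda>w. g w / (w - a) ^ n) holomorphic_on - {a}"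
    by (intro holomorphic_intros holomorphic_on_subset[OF g]) auto
  then have "h holomorphic_on - {a}"
    by (rule holomorphic_transform) (auto simp: h_def)
  ultimately have "h holomorphic_on (ball a r \<union> - {a})"
    by (intro holomorphic_on_Un) auto
  moreover have "ball a r \<union> - {a} = UNIV"
    using k(2) by auto
  ultimately have "h holomorphic_on UNIV" by simp
  moreover have "g w = (w - a) ^ n * h w" for w
    using \<open>0 < n\<close> \<open>g a = 0\<close> by (auto simp: h_def)
  ultimately show thesis
    using that[OF k(1)] k(2,5) hk by (metis centre_in_ball)
qed

lemma entire_factor_finite_zeros:
  assumes "finite Z" "g holomorphic_on UNIV" "\<And>a. a \<in> Z \<Longrightarrow> g a = 0" "g b \<noteq> 0"
  shows "\<exists>m h. h holomorphic_on UNIV \<and> (\<forall>a\<in>Z. m a > (0::nat) \<and> h a \<noteq> 0) \<and>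
           (\<forall>w. g w = (\<Prod>a\<in>Z. (w - a) ^ m a) * h w)"
  using assms
proof (induction Z)
  case empty
  then show ?case by auto
next
  case (insert c Z)
  then obtain m h where h: "h holomorphic_on UNIV" "\<forall>a\<in>Z. m a > (0::nat) \<and> h a \<noteq> 0"
      "\<forall>w. g w = (\<Prod>a\<in>Z. (w - a) ^ m a) * h w"
    by auto
  have "(\<Prod>a\<in>Z. (c - a) ^ m a) \<noteq> 0"
    using insert.hyps by auto
  with h(3) insert.prems(2)[of c] have "h c = 0" by auto
  moreover have "h b \<noteq> 0"
    using h(3) insert.prems(3) by auto
  ultimately obtain n k where k: "n > 0" "k holomorphic_on UNIV" "k c \<noteq> 0"
      "\<And>w. h w = (w - c) ^ n * k w"
    using entire_factor_zero[OF h(1)] by metis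
  define m' where "m' = m(c := n)"
  have "(\<Prod>a\<in>Z. (w - a) ^ m' a) = (\<Prod>a\<in>Z. (w - a) ^ m a)" for w
    using insert.hyps by (intro prod.cong) (auto simp: m'_def)
  then have "g w = (\<Prod>a\<in>insert c Z. (w - a) ^ m' a) * k w" for w
    using insert.hyps h(3) k(4) by (simp add: m'_def)
  moreover have "\<forall>a\<in>insert c Z. m' a > 0 \<and> k a \<noteq> 0"
    using h(2) k insert.hyps by (auto simp: m'_def)
  ultimately show ?case
    using k(2) by blast
qed

text \<open>The map w / (2 A - w) sends the half-plane Re w < A into the unit disc and fixes 0.
  Composed with \<open>q\<close>, rescaled to the unit disc, it falls under the Schwarz lemma, and
  solving back for \<open>q\<close> gives the bound.\<close>

lemma Borel_Caratheodory:
  assumes q: "q holomorphic_on ball 0 R" and "q 0 = 0" and "A > 0"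
    and re: "\<And>z. z \<in> ball 0 R \<Longrightarrow> Re (q z) < A" and z: "cmod z < R"
  shows "cmod (q z) \<le> 2 * A * cmod z / (R - cmod z)"
proof -
  have R: "R > 0" using z norm_ge_zero[of z] by linarith
  define p where "p = (\<lambda>\<zeta>. q (of_real R * \<zeta>))"
  have inb: "of_real R * \<zeta> \<in> ball 0 R" if "cmod \<zeta> < 1" for \<zeta> :: complex
    using that R by (simp add: norm_mult)
  have p: "p holomorphic_on ball 0 1"
    unfolding p_def
    by (rule holomorphic_on_compose_gen[OF _ q, unfolded o_def])
       (auto intro!: holomorphic_intros inb simp: norm_mult R)
  define \<phi> where "\<phi> = (\<lambda>\<zeta>. p \<zeta> / (of_real (2 * A) - p \<zeta>))"
  have Rep: "Re (p \<zeta>) < A" if "cmod \<zeta> < 1" for \<zeta>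
    using re[OF inb[OF that]] by (simp add: p_def)
  have nz: "of_real (2 * A) - p \<zeta> \<noteq> 0" if "cmod \<zeta> < 1" for \<zeta>
    using Rep[OF that] \<open>A > 0\<close> by (auto simp: complex_eq_iff)
  have lt: "cmod (\<phi> \<zeta>) < 1" if "cmod \<zeta> < 1" for \<zeta>
  proof -
    have "(cmod (of_real (2 * A) - p \<zeta>))\<^sup>2 - (cmod (p \<zeta>))\<^sup>2 = 4 * A * (A - Re (p \<zeta>))"
      unfolding cmod_power2 by (simp add: power2_eq_square algebra_simps)
    moreover have "4 * A * (A - Re (p \<zeta>)) > 0"
      using Rep[OF that] \<open>A > 0\<close> by simp
    ultimately have "(cmod (p \<zeta>))\<^sup>2 < (cmod (of_real (2 * A) - p \<zeta>))\<^sup>2" by linarith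
    then have "cmod (p \<zeta>) < cmod (of_real (2 * A) - p \<zeta>)"
      using norm_ge_zero power_less_imp_less_base by blast
    then show ?thesis
      unfolding \<phi>_def norm_divide using nz[OF that] by (simp add: divide_less_eq)
  qed
  have hol: "\<phi> holomorphic_on ball 0 1"
    unfolding \<phi>_def by (intro holomorphic_intros p) (use nz in auto)
  have "\<phi> 0 = 0"
    by (simp add: \<phi>_def p_def \<open>q 0 = 0\<close>)
  define \<zeta> where "\<zeta> = z / of_real R"
  have c\<zeta>: "cmod \<zeta> = cmod z / R" and "cmod \<zeta> < 1"
    using z R by (simp_all add: \<zeta>_def norm_divide)
  have qz: "q z = p \<zeta>"
    using R by (simp add: p_def \<zeta>_def)
  have le: "cmod (\<phi> \<zeta>) \<le> cmod \<zeta>"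
    by (rule Schwarz_Lemma(1)[OF hol \<open>\<phi> 0 = 0\<close> lt \<open>cmod \<zeta> < 1\<close>])
  \<comment> \<open>The inversion is done for moduli only: |p| <= |\<zeta>| (2 A + |p|) is solved
    for |p|.\<close>
  have "\<phi> \<zeta> * (of_real (2 * A) - p \<zeta>) = p \<zeta>"
    using nz[OF \<open>cmod \<zeta> < 1\<close>] by (simp add: \<phi>_def)
  then have "cmod (p \<zeta>) = cmod (\<phi> \<zeta>) * cmod (of_real (2 * A) - p \<zeta>)"
    by (metis norm_mult)
  also have "\<dots> \<le> cmod \<zeta> * (2 * A + cmod (p \<zeta>))"
    using norm_triangle_ineq4[of "of_real (2 * A)" "p \<zeta>"] \<open>A > 0\<close>
    by (intro mult_mono le) (auto simp: norm_mult)
  finally have "cmod (p \<zeta>) * (1 - cmod \<zeta>) \<le> 2 * A * cmod \<zeta>"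
    by (simp add: algebra_simps)
  then have "cmod (p \<zeta>) \<le> 2 * A * cmod \<zeta> / (1 - cmod \<zeta>)"
    using \<open>cmod \<zeta> < 1\<close> by (simp add: pos_le_divide_eq)
  also have "1 - cmod \<zeta> = (R - cmod z) / R"
    using R by (simp add: c\<zeta> diff_divide_distrib)
  also have "2 * A * cmod \<zeta> / \<dots> = 2 * A * cmod z / (R - cmod z)"
    using R by (simp add: c\<zeta>)
  finally show ?thesis by (simp add: qz)
qed

text \<open>Hadamard's factorisation with finite products, in which \<open>m\<close> and
  \<open>h\<close> are chosen anew for each \<open>R\<close>. Each removed factor has modulus at
  least 1 on |w| = 2 R, so \<open>h\<close> inherits the growth bound of \<open>g\<close> there. A
  logarithm of \<open>h w / g 0\<close> then has real part O(R^\<rho>) on |w| < R, and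
  Borel-Caratheodory makes it O(R^(\<rho> - 1)) on |w| <= r, which tends to 0.\<close>

theorem Hadamard_order_less_one:
  assumes g: "g holomorphic_on UNIV" and g0: "g 0 \<noteq> 0"
    and C: "C > 0" and \<rho>: "\<rho> < 1" and gr: "\<And>w. cmod (g w) \<le> C * exp (cmod w powr \<rho>)"
    and \<epsilon>: "\<epsilon> > 0"
  shows "\<exists>R0. \<forall>R\<ge>R0. finite {a. g a = 0 \<and> cmod a \<le> R} \<and> (\<exists>m h. (\<forall>a. g a = 0 \<and> cmod a \<le> R \<longrightarrow> m a > (0::nat)) \<and>
     (\<forall>w. g w = (\<Prod>a | g a = 0 \<and> cmod a \<le> R. (1 - w / a) ^ m a) * h w) \<and>
     (\<forall>w. cmod w \<le> r \<longrightarrow> cmod (h w / g 0 - 1) \<le> \<epsilon>))"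
proof -
  have "isCont exp (0::complex)" by simp
  then obtain \<delta> where \<delta>: "\<delta> > 0" "\<And>x::complex. cmod x < \<delta> \<Longrightarrow> cmod (exp x - 1) < \<epsilon>"
    using \<epsilon> by (auto simp: continuous_at_eps_delta dist_norm)
  \<comment> \<open>Upper bound for the real part of the logarithm on |w| < R. The radius 2 R is
    that of the circle where \<open>h\<close> is estimated; the summand 1 makes \<open>L R\<close>
    positive and the bound strict. For R >= 2 r the Borel-Caratheodory bound becomes 4 L(R) r /
    R.\<close>
  define L where "L = (\<lambda>R. 1 + \<bar>ln (C / cmod (g 0))\<bar> + (2 * R) powr \<rho>)"
  define K where "K = 1 + \<bar>ln (C / cmod (g 0))\<bar>"
  have "((\<lambda>R. K / R) \<longlongrightarrow> 0) at_top"
    by (intro tendsto_divide_0[OF tendsto_const] filterlim_at_top_imp_at_infinity filterlim_ident)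
  moreover have "((\<lambda>R. 2 powr \<rho> * R powr (\<rho> - 1)) \<longlongrightarrow> 0) at_top"
    using \<rho> by (intro tendsto_mult_right_zero tendsto_neg_powr filterlim_ident) auto
  then have "((\<lambda>R. (2 * R) powr \<rho> / R) \<longlongrightarrow> 0) at_top"
    by (rule Lim_transform_eventually)
       (use eventually_gt_at_top[of 0] in \<open>eventually_elim, simp add: powr_mult powr_diff\<close>)
  ultimately have "((\<lambda>R. (K + (2 * R) powr \<rho>) / R) \<longlongrightarrow> 0) at_top"
    using tendsto_add[of "\<lambda>R. K / R" 0 at_top "\<lambda>R. (2 * R) powr \<rho> / R" 0]
    by (simp add: add_divide_distrib)
  from tendsto_mult_left[OF this, of "4 * r"]
  have "((\<lambda>R. 4 * L R * r / R) \<longlongrightarrow> 0) at_top"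
    unfolding L_def K_def[symmetric] by (simp add: mult_ac)
  then have "eventually (\<lambda>R. 4 * L R * r / R < \<delta>) at_top"
    using \<delta>(1) by (intro order_tendstoD)
  then obtain R1 where R1: "\<And>R. R \<ge> R1 \<Longrightarrow> 4 * L R * r / R < \<delta>"
    by (auto simp: eventually_at_top_linorder)
  have "finite {a. g a = 0 \<and> cmod a \<le> R} \<and> (\<exists>m h. (\<forall>a. g a = 0 \<and> cmod a \<le> R \<longrightarrow> m a > (0::nat)) \<and>
     (\<forall>w. g w = (\<Prod>a | g a = 0 \<and> cmod a \<le> R. (1 - w / a) ^ m a) * h w) \<and>
     (\<forall>w. cmod w \<le> r \<longrightarrow> cmod (h w / g 0 - 1) \<le> \<epsilon>))" if R: "R \<ge> Max {R1, 2 * r, 1}" for R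
  proof -
    have Rge: "R \<ge> R1" "R \<ge> 2 * r" "R \<ge> 1" using R by auto
    define Z where "Z = {a. g a = 0 \<and> cmod a \<le> R}"
    have fin: "finite Z"
    proof (cases "g constant_on UNIV")
      case True
      then have "Z = {}" using g0 by (auto simp: Z_def constant_on_def)
      then show ?thesis by simp
    next
      case False
      then have "finite {a \<in> cball 0 R. g a = 0}"
        by (rule holomorphic_compact_finite_zeros[OF g open_UNIV connected_UNIV compact_cball subset_UNIV])
      then show ?thesis
        by (rule rev_finite_subset) (auto simp: Z_def)
    qed
    have nz: "a \<noteq> 0" if "a \<in> Z" for a
      using that g0 by (auto simp: Z_def)
    have gz: "g a = 0" if "a \<in> Z" for a
      using that by (simp add: Z_def)
    obtain m k where k: "k holomorphic_on UNIV" "\<forall>a\<in>Z. m a > (0::nat) \<and> k a \<noteq> 0"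
        "\<forall>w. g w = (\<Prod>a\<in>Z. (w - a) ^ m a) * k w"
      using entire_factor_finite_zeros[OF fin g gz g0] by blast
    define c where "c = (\<Prod>a\<in>Z. (- a) ^ m a)"
    define P where "P = (\<lambda>w. \<Prod>a\<in>Z. (1 - w / a) ^ m a)"
    define h where "h = (\<lambda>w. c * k w)"
    have fac: "(w - a) ^ n = (- a) ^ n * (1 - w / a) ^ n" if "a \<in> Z" for a w n
    proof -
      have "w - a = (- a) * (1 - w / a)" using nz[OF that] by (simp add: right_diff_distrib)
      then show ?thesis by (metis power_mult_distrib)
    qed
    have "(\<Prod>a\<in>Z. (w - a) ^ m a) = c * P w" for w
      unfolding c_def P_def prod.distrib[symmetric] by (intro prod.cong refl fac)
    then have gP: "g w = P w * h w" for w
      using k(3) by (simp add: h_def)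
    have "P 0 = 1" by (simp add: P_def)
    then have h0: "h 0 = g 0" using gP[of 0] by simp
    have c0: "c \<noteq> 0" using nz fin by (auto simp: c_def)
    have hol: "h holomorphic_on UNIV" unfolding h_def by (intro holomorphic_intros k)
    have hnz: "h w \<noteq> 0" if "cmod w \<le> R" for w
    proof (cases "w \<in> Z")
      case True
      then show ?thesis using k(2) c0 by (simp add: h_def)
    next
      case False
      then have "g w \<noteq> 0" using that by (auto simp: Z_def)
      then show ?thesis using gP[of w] by auto
    qed
    have Pge: "1 \<le> cmod (P w)" if "cmod w = 2 * R" for w
    proof -
      have "1 \<le> cmod (1 - w / a)" if "a \<in> Z" for a
      proof -
        have "2 \<le> cmod (w / a)"
          using \<open>cmod w = 2 * R\<close> nz[OF that] that by (simp add: Z_def norm_divide field_simps)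
        then show ?thesis
          using norm_triangle_ineq3[of 1 "w / a"] by simp
      qed
      then show ?thesis
        unfolding P_def prod_norm[symmetric] norm_power
        by (intro prod_ge_1 one_le_power)
    qed
    define B where "B = C * exp ((2 * R) powr \<rho>)"
    have hB: "cmod (h w) \<le> B" if "cmod w \<le> 2 * R" for w
    proof (rule maximum_modulus_frontier[of h "cball 0 (2 * R)"])
      fix v :: complex assume "v \<in> frontier (cball 0 (2 * R))"
      then have v: "cmod v = 2 * R" using Rge by (simp add: frontier_cball)
      have "cmod (h v) \<le> cmod (P v) * cmod (h v)"
        using mult_right_mono[OF Pge[OF v] norm_ge_zero[of "h v"]] by simp
      also have "\<dots> \<le> B" using gr[of v] v by (simp add: gP norm_mult B_def)
      finally show "cmod (h v) \<le> B" .
    qed (use that in \<open>auto intro: holomorphic_on_subset[OF hol] holomorphic_on_imp_continuous_on\<close>)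
    have hR: "(\<lambda>w. h w / g 0) holomorphic_on ball 0 R"
      by (intro holomorphic_intros holomorphic_on_subset[OF hol]) (use g0 in auto)
    obtain q1 where q1: "q1 holomorphic_on ball 0 R" "\<And>w. w \<in> ball 0 R \<Longrightarrow> exp (q1 w) = h w / g 0"
      by (rule holomorphic_logarithm_exists[OF convex_ball open_ball hR, of 0])
         (use hnz g0 Rge in auto)
    define q where "q = (\<lambda>w. q1 w - q1 0)"
    have eq: "exp (q w) = h w / g 0" if "w \<in> ball 0 R" for w
      using q1(2)[OF that] q1(2)[of 0] Rge h0 g0 by (simp add: q_def exp_diff)
    have LR: "L R > 0" by (simp add: L_def add_pos_nonneg)
    have Re: "Re (q w) < L R" if "w \<in> ball 0 R" for w
    proof -
      have "exp (Re (q w)) = cmod (h w) / cmod (g 0)"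
        using arg_cong[OF eq[OF that], of cmod] by (simp add: norm_divide)
      also have "\<dots> \<le> B / cmod (g 0)"
        using hB[of w] that Rge by (intro divide_right_mono) auto
      also have "\<dots> = exp (ln (C / cmod (g 0)) + (2 * R) powr \<rho>)"
        using C g0 by (simp add: exp_add B_def)
      finally show ?thesis by (simp add: L_def)
    qed
    have main: "cmod (h w / g 0 - 1) \<le> \<epsilon>" if w: "cmod w \<le> r" for w
    proof -
      have w': "cmod w < R" using w Rge by auto
      have r0: "0 \<le> r" using w norm_ge_zero[of w] by linarith
      have "q holomorphic_on ball 0 R" unfolding q_def by (intro holomorphic_intros q1)
      then have "cmod (q w) \<le> 2 * L R * cmod w / (R - cmod w)"
        using Re w' LR by (intro Borel_Caratheodory) (auto simp: q_def)
      also have "\<dots> \<le> 2 * L R * r / (R / 2)"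
        using w Rge LR r0 by (intro frac_le mult_left_mono mult_nonneg_nonneg) auto
      also have "\<dots> = 4 * L R * r / R" by simp
      also have "\<dots> < \<delta>" by (rule R1) fact
      finally show ?thesis using \<delta>(2)[of "q w"] eq[of w] w' by simp
    qed
    show ?thesis
      using fin k(2) gP main unfolding Z_def P_def by blast
  qed
  then show ?thesis by blast
qed

text \<open>The hypothesis compares products of two factors, so each point is taken together with
  its conjugate. The inequality between finite products passes to the limit and stays strict because
  one fixed zero contributes a ratio \<theta> < 1 independent of the radius. Without zeros
  \<open>h\<close> equals \<open>g\<close> and is arbitrarily close to \<open>g 0\<close>, so
  \<open>g\<close> is constant.\<close>

lemma Hadamard_comparison:
  assumes g: "g holomorphic_on UNIV" and g0: "g 0 \<noteq> 0"
    and C: "C > 0" and \<rho>: "\<rho> < 1" and gr: "\<And>w. cmod (g w) \<le> C * exp (cmod w powr \<rho>)"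
    and less: "\<And>a. g a = 0 \<Longrightarrow>
       cmod (1 - q / a) * cmod (1 - cnj q / a) < cmod (1 - p / a) * cmod (1 - cnj p / a)"
    and nz: "g p \<noteq> 0" "g (cnj p) \<noteq> 0"
  shows "(\<forall>w. g w = g 0) \<or> cmod (g q) * cmod (g (cnj q)) < cmod (g p) * cmod (g (cnj p))"
proof (cases "\<exists>a. g a = 0")
  case False
  have "g w = g 0" for w
  proof (rule ccontr)
    assume ne: "g w \<noteq> g 0"
    define \<epsilon> where "\<epsilon> = cmod (g w / g 0 - 1) / 2"
    have \<epsilon>: "\<epsilon> > 0" using ne g0 by (simp add: \<epsilon>_def)
    obtain R0 where "\<forall>R\<ge>R0. finite {a. g a = 0 \<and> cmod a \<le> R} \<and> (\<exists>m h. (\<forall>a. g a = 0 \<and> cmod a \<le> R \<longrightarrow> m a > (0::nat)) \<and>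
      (\<forall>w. g w = (\<Prod>a | g a = 0 \<and> cmod a \<le> R. (1 - w / a) ^ m a) * h w) \<and>
      (\<forall>v. cmod v \<le> cmod w \<longrightarrow> cmod (h v / g 0 - 1) \<le> \<epsilon>))"
      using Hadamard_order_less_one[OF g g0 C \<rho> gr \<epsilon>, of "cmod w"] by (rule exE)
    then have "\<exists>h. (\<forall>w. g w = h w) \<and> (\<forall>v. cmod v \<le> cmod w \<longrightarrow> cmod (h v / g 0 - 1) \<le> \<epsilon>)"
      using False by (auto dest!: spec[of _ R0])
    then have "cmod (g w / g 0 - 1) \<le> \<epsilon>" by (metis order_refl)
    then show False using \<epsilon> by (simp add: \<epsilon>_def)
  qed
  then show ?thesis by blast
next
  case True
  then obtain a0 where a0: "g a0 = 0" by blast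
  define D where "D = (\<lambda>a w. cmod (1 - w / a) * cmod (1 - cnj w / a))"
  define E where "E = (\<lambda>w. cmod (g w) * cmod (g (cnj w)))"
  have lessD: "D a q < D a p" if "g a = 0" for a
    using less[OF that] by (simp add: D_def)
  have D0: "D a w \<ge> 0" for a w by (simp add: D_def)
  have E0: "E w \<ge> 0" for w by (simp add: E_def)
  define \<theta> where "\<theta> = D a0 q / D a0 p"
  have Dp: "D a p > 0" if "g a = 0" for a
    using lessD[OF that] D0[of a q] by linarith
  have \<theta>: "0 \<le> \<theta>" "\<theta> < 1"
    using lessD[OF a0] Dp[OF a0] D0[of a0 q] by (auto simp: \<theta>_def)
  \<comment> \<open>Here \<epsilon> bounds the relative error of replacing \<open>h\<close> by
    \<open>g 0\<close>; it tends to 0 at the end while \<theta> stays fixed.\<close>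
  have main: "E q * (1 - \<epsilon>)\<^sup>2 \<le> \<theta> * (1 + \<epsilon>)\<^sup>2 * E p" if \<epsilon>: "0 < \<epsilon>" "\<epsilon> < 1" for \<epsilon>
  proof -
    obtain R0 where R0: "\<forall>R\<ge>R0. finite {a. g a = 0 \<and> cmod a \<le> R} \<and> (\<exists>m h. (\<forall>a. g a = 0 \<and> cmod a \<le> R \<longrightarrow> m a > (0::nat)) \<and>
      (\<forall>w. g w = (\<Prod>a | g a = 0 \<and> cmod a \<le> R. (1 - w / a) ^ m a) * h w) \<and>
      (\<forall>v. cmod v \<le> max (cmod p) (cmod q) \<longrightarrow> cmod (h v / g 0 - 1) \<le> \<epsilon>))"
      using Hadamard_order_less_one[OF g g0 C \<rho> gr \<epsilon>(1), of "max (cmod p) (cmod q)"] by (rule exE)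
    define R where "R = max R0 (cmod a0)"
    have "R \<ge> R0" by (simp add: R_def)
    define Z where "Z = {a. g a = 0 \<and> cmod a \<le> R}"
    obtain m h where fin: "finite Z" and m: "\<And>a. a \<in> Z \<Longrightarrow> m a > (0::nat)"
      and gh: "\<And>w. g w = (\<Prod>a\<in>Z. (1 - w / a) ^ m a) * h w"
      and h: "\<And>v. cmod v \<le> max (cmod p) (cmod q) \<Longrightarrow> cmod (h v / g 0 - 1) \<le> \<epsilon>"
      using R0[rule_format, of R, folded Z_def, OF \<open>R \<ge> R0\<close>] unfolding Z_def by blast
    have a0Z: "a0 \<in> Z" using a0 by (simp add: Z_def R_def)
    define P where "P = (\<lambda>w. \<Prod>a\<in>Z. D a w ^ m a)"
    define G where "G = (cmod (g 0))\<^sup>2"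
    have E: "E w = P w * (cmod (h w) * cmod (h (cnj w)))" for w
    proof -
      have "cmod (g w) = (\<Prod>a\<in>Z. cmod (1 - w / a) ^ m a) * cmod (h w)" for w
        by (simp add: gh norm_mult prod_norm[symmetric] norm_power)
      then show ?thesis
        by (simp add: E_def P_def D_def power_mult_distrib prod.distrib)
    qed
    have Pp: "P p \<ge> 0" "P q \<ge> 0" by (auto simp: P_def intro!: prod_nonneg zero_le_power D0)
    have hb: "cmod (h v) \<le> (1 + \<epsilon>) * cmod (g 0)" "(1 - \<epsilon>) * cmod (g 0) \<le> cmod (h v)"
      if "cmod v \<le> max (cmod p) (cmod q)" for v
    proof -
      have "cmod (h v) = cmod (h v / g 0) * cmod (g 0)" using g0 by (simp add: norm_divide)
      moreover have "cmod (h v / g 0) \<le> 1 + \<epsilon>" "1 - \<epsilon> \<le> cmod (h v / g 0)"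
        using h[OF that] norm_triangle_ineq2[of "h v / g 0" 1] norm_triangle_ineq2[of 1 "h v / g 0"]
        by (auto simp: norm_minus_commute)
      ultimately show "cmod (h v) \<le> (1 + \<epsilon>) * cmod (g 0)" "(1 - \<epsilon>) * cmod (g 0) \<le> cmod (h v)"
        by (auto intro!: mult_right_mono)
    qed
    have up: "cmod (h q) * cmod (h (cnj q)) \<le> (1 + \<epsilon>)\<^sup>2 * G"
      using mult_mono[OF hb(1)[of q] hb(1)[of "cnj q"]] \<epsilon> by (simp add: G_def power2_eq_square algebra_simps)
    have lo: "(1 - \<epsilon>)\<^sup>2 * G \<le> cmod (h p) * cmod (h (cnj p))"
      using mult_mono[OF hb(2)[of p] hb(2)[of "cnj p"] norm_ge_zero] \<epsilon>
      by (simp add: G_def power2_eq_square mult_ac)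
    have PP: "P q \<le> \<theta> * P p"
    proof -
      have split: "P w = D a0 w ^ m a0 * (\<Prod>a\<in>Z - {a0}. D a w ^ m a)" for w
        unfolding P_def by (rule prod.remove[OF fin a0Z])
      \<comment> \<open>Since \<open>m a0\<close> is at least 1, \<theta> ^ \<open>m a0\<close> <=
        \<theta>: the gain does not depend on the multiplicity, which was chosen together with
        \<epsilon>.\<close>
      have "(D a0 q) ^ m a0 = \<theta> ^ m a0 * (D a0 p) ^ m a0"
        using Dp[OF a0] by (simp add: \<theta>_def power_divide)
      also have "\<dots> \<le> \<theta> * (D a0 p) ^ m a0"
        using power_decreasing[of 1 "m a0" \<theta>] m[OF a0Z] \<theta> D0 by (intro mult_right_mono) auto
      finally have 1: "(D a0 q) ^ m a0 \<le> \<theta> * (D a0 p) ^ m a0" .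
      have 2: "(\<Prod>a\<in>Z - {a0}. D a q ^ m a) \<le> (\<Prod>a\<in>Z - {a0}. D a p ^ m a)"
        using lessD D0 by (intro prod_mono) (auto intro!: power_mono simp: Z_def less_imp_le)
      show ?thesis
        using mult_mono[OF 1 2] D0 \<theta> unfolding split by (auto intro!: prod_nonneg zero_le_power simp: mult_ac)
    qed
    have "E q * ((1 - \<epsilon>)\<^sup>2 * G) \<le> (\<theta> * P p) * ((1 + \<epsilon>)\<^sup>2 * G) * ((1 - \<epsilon>)\<^sup>2 * G)"
      unfolding E using PP up Pp \<theta>
      by (intro mult_right_mono mult_mono[OF PP up]) (auto simp: G_def)
    also have "\<dots> = (\<theta> * (1 + \<epsilon>)\<^sup>2 * G) * (P p * ((1 - \<epsilon>)\<^sup>2 * G))"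
      by (simp add: mult_ac)
    also have "\<dots> \<le> (\<theta> * (1 + \<epsilon>)\<^sup>2 * G) * E p"
      unfolding E using lo Pp \<theta> by (intro mult_left_mono) (auto simp: G_def)
    finally have "(E q * (1 - \<epsilon>)\<^sup>2) * G \<le> (\<theta> * (1 + \<epsilon>)\<^sup>2 * E p) * G"
      by (simp add: mult_ac)
    moreover have "G > 0" using g0 by (simp add: G_def)
    ultimately show ?thesis by (simp add: mult_le_cancel_right)
  qed
  have "E q * (1 - 0)\<^sup>2 \<le> \<theta> * (1 + 0)\<^sup>2 * E p"
  proof (rule tendsto_le[of "at_right (0::real)"])
    show "((\<lambda>\<epsilon>. \<theta> * (1 + \<epsilon>)\<^sup>2 * E p) \<longlongrightarrow> \<theta> * (1 + 0)\<^sup>2 * E p) (at_right 0)"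
      "((\<lambda>\<epsilon>. E q * (1 - \<epsilon>)\<^sup>2) \<longlongrightarrow> E q * (1 - 0)\<^sup>2) (at_right 0)"
      by (intro tendsto_intros)+
    show "\<forall>\<^sub>F \<epsilon> in at_right 0. E q * (1 - \<epsilon>)\<^sup>2 \<le> \<theta> * (1 + \<epsilon>)\<^sup>2 * E p"
      using eventually_at_right[of 0 "1::real"] main by (auto intro!: exI[of _ 1])
  qed auto
  moreover have "E p > 0" using nz by (simp add: E_def)
  then have "\<theta> * E p < E p" using \<theta> by simp
  ultimately show ?thesis by (simp add: E_def)
qed

text \<open>If every zero \<open>a + \<i>b\<close> violated the conclusion, each pair of factors belonging to
  \<open>a \<plusminus> \<i>b\<close> would be strictly larger at \<open>x + \<i>(y + l)\<close> than at \<open>x + \<i>(y - l)\<close>, so the two values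
  could not cancel.\<close>
lemma de_Bruijn_step:
  assumes g: "g holomorphic_on UNIV" and g0: "g 0 \<noteq> 0"
    and C: "C > 0" and \<rho>: "\<rho> < 1" and gr: "\<And>w. cmod (g w) \<le> C * exp (cmod w powr \<rho>)"
    and sym: "\<And>w. g (cnj w) = cnj (g w)" and l: "l > 0" and y: "y > 0"
    and zero: "g ((Complex x (y + l))\<^sup>2) + g ((Complex x (y - l))\<^sup>2) = 0"
  shows "\<exists>a b. g ((Complex a b)\<^sup>2) = 0 \<and> (x - a)\<^sup>2 + y\<^sup>2 + l\<^sup>2 \<le> b\<^sup>2"
proof (rule ccontr)
  assume "\<not> ?thesis"
  then have far: "(x - a)\<^sup>2 + y\<^sup>2 + l\<^sup>2 > b\<^sup>2" if "g ((Complex a b)\<^sup>2) = 0" for a b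
    using that by force
  define p where "p = Complex x (y + l)"
  define q where "q = Complex x (y - l)"
  \<comment> \<open>Pairing \<open>s\<close> with its conjugate makes the square of \<open>Q\<close>
    a polynomial in b^2 and the squared height. Between the heights y + l and y - l, only the sign
    of (x - a)^2 + y^2 + l^2 - b^2 decides.\<close>
  define Q where "Q = (\<lambda>s w. cmod (w - s) * cmod (w - cnj s))"
  have Q0: "Q s w \<ge> 0" for s w by (simp add: Q_def)
  have Qless: "Q s q < Q s p" if "g (s\<^sup>2) = 0" for s
  proof -
    obtain a b where s: "s = Complex a b" by (cases s)
    have Q2: "(Q s (Complex x Y))\<^sup>2 = (x - a)^4 + 2 * (x - a)\<^sup>2 * (Y\<^sup>2 + b\<^sup>2) + (Y\<^sup>2 - b\<^sup>2)\<^sup>2" for Y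
      unfolding Q_def power_mult_distrib cmod_power2 by (simp add: s, algebra)
    have "(Q s p)\<^sup>2 - (Q s q)\<^sup>2 = 8 * (y * l) * ((x - a)\<^sup>2 + y\<^sup>2 + l\<^sup>2 - b\<^sup>2)"
      unfolding p_def q_def Q2 by algebra
    moreover have "\<dots> > 0" using far[of a b] that y l by (auto simp: s)
    ultimately have "(Q s q)\<^sup>2 < (Q s p)\<^sup>2" by linarith
    then show ?thesis using Q0 power_less_imp_less_base by blast
  qed
  \<comment> \<open>In the squared variable a zero s^2 carries both roots s and -s, so a pair of
    factors splits into two values of \<open>Q\<close>.\<close>
  have D: "cmod (1 - w\<^sup>2 / s\<^sup>2) * cmod (1 - cnj (w\<^sup>2) / s\<^sup>2) = Q s w * Q (- s) w / cmod s ^ 4"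
    if "s \<noteq> 0" for s w
  proof -
    have "1 - w\<^sup>2 / s\<^sup>2 = - ((w - s) * (w + s)) / s\<^sup>2" "1 - cnj (w\<^sup>2) / s\<^sup>2 = - ((cnj w - s) * (cnj w + s)) / s\<^sup>2"
      using that by (simp_all add: field_simps power2_eq_square)
    moreover have "cmod (cnj w - s) = cmod (w - cnj s)" "cmod (cnj w + s) = cmod (w + cnj s)"
      by (metis complex_cnj_diff complex_cnj_cnj complex_mod_cnj,
          metis complex_cnj_add complex_cnj_cnj complex_mod_cnj)
    ultimately show ?thesis
      by (simp add: Q_def norm_mult norm_divide norm_power power2_eq_square power4_eq_xxxx mult_ac)
  qed
  have less: "cmod (1 - q\<^sup>2 / a) * cmod (1 - cnj (q\<^sup>2) / a) < cmod (1 - p\<^sup>2 / a) * cmod (1 - cnj (p\<^sup>2) / a)"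
    if "g a = 0" for a
  proof -
    define s where "s = csqrt a"
    have a: "a = s\<^sup>2" by (simp add: s_def)
    have s0: "s \<noteq> 0" using that g0 a by auto
    have "Q s q < Q s p" "Q (- s) q < Q (- s) p" using Qless[of s] Qless[of "- s"] that a by auto
    then have "Q s q * Q (- s) q < Q s p * Q (- s) p" using Q0 by (intro mult_strict_mono) (auto intro: le_less_trans)
    then show ?thesis unfolding a D[OF s0] using s0 by (intro divide_strict_right_mono) auto
  qed
  \<comment> \<open>A vanishing sum forces equal moduli, so with \<open>sym\<close> the strict
    alternative of the comparison is impossible; a constant \<open>g\<close> would give 2 g(0) =
    0.\<close>
  have eq: "cmod (g (q\<^sup>2)) = cmod (g (p\<^sup>2))"
    using zero unfolding p_def q_def by (metis add_eq_0_iff norm_minus_cancel)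
  \<comment> \<open>A zero at \<open>p\<close> itself would contradict \<open>far\<close>, because
    (y + l)^2 exceeds y^2 + l^2.\<close>
  have nz: "g (p\<^sup>2) \<noteq> 0"
  proof
    assume "g (p\<^sup>2) = 0"
    then have "y\<^sup>2 + l\<^sup>2 > (y + l)\<^sup>2" using far[of x "y + l"] by (simp add: p_def)
    then show False using mult_pos_pos[OF y l] by (simp add: power2_sum mult.commute)
  qed
  have "g (cnj (p\<^sup>2)) \<noteq> 0" unfolding sym using nz by simp
  from Hadamard_comparison[OF g g0 C \<rho> gr less nz this]
  have "\<forall>w. g w = g 0" unfolding sym complex_mod_cnj eq by simp
  then have "g 0 + g 0 = 0" using zero by metis
  then show False using g0 by simp
qed

section \<open>Cosine transforms of rapidly decaying kernels\<close>

abbreviation half_line :: "real measure" where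
  "half_line \<equiv> restrict_space lborel {0..}"

text \<open>Cubic decay beats both exp (t u^2) and exp (|z| u), so the class is closed under all
  multipliers used here, and it keeps the order of the transform at 3/2, below the critical value 2.
  Positivity on the half-line excludes zeros on the imaginary axis.\<close>

definition rapidly_decaying :: "(real \<Rightarrow> real) \<Rightarrow> bool" where
  "rapidly_decaying K \<longleftrightarrow> K \<in> borel_measurable borel \<and> (\<forall>u\<ge>0. K u > 0) \<and>
     (\<forall>a. \<exists>C. \<forall>u\<ge>0. K u \<le> C * exp (- a * u ^ 3))"

definition cos_transform :: "(real \<Rightarrow> real) \<Rightarrow> complex \<Rightarrow> complex" where
  "cos_transform K z = (\<integral>u. of_real (K u) * cos (z * of_real u) \<partial>half_line)"

lemma H_eq_cos_transform: "H t = cos_transform (\<lambda>u. exp (t * u\<^sup>2) * Phi u)"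
  by (auto simp: H_def cos_transform_def set_lebesgue_integral_def integral_restrict_space)

lemma H0_eq_cos_transform: "H 0 = cos_transform Phi"
  by (simp add: H_eq_cos_transform)

lemma half_line_measurable [measurable (raw)]:
  "f \<in> borel_measurable borel \<Longrightarrow> f \<in> borel_measurable half_line"
  by (rule measurable_restrict_space1) simp

lemma space_half_line [simp]: "space half_line = {0..}"
  by (simp add: space_restrict_space)

lemma integrable_half_line_exp: "integrable half_line (\<lambda>u. exp (- u))"
proof -
  have "((\<lambda>x::real. exp (- 1 * x)) has_integral exp (- 1 * 0) / 1) {0..}"
    by (rule has_integral_exp_minus_to_infinity) simp
  then have "(\<lambda>x::real. exp (- x)) integrable_on {0..}" by auto
  then have "(\<lambda>x::real. exp (- x)) absolutely_integrable_on {0..}"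
    by (rule nonnegative_absolutely_integrable_1) simp
  then have "integrable lborel (\<lambda>x::real. indicator {0..} x *\<^sub>R exp (- x))"
    unfolding set_integrable_def by (subst (asm) integrable_completion) auto
  then show ?thesis
    by (subst integrable_restrict_space) auto
qed

text \<open>A multiplier of size exp (b u^3) costs only a shift of the decay rate \<open>a\<close>,
  and \<open>a\<close> is arbitrary.\<close>

lemma rapidly_decaying_mult:
  assumes K: "rapidly_decaying K" and f: "f \<in> borel_measurable borel"
    and pos: "\<And>u. u \<ge> 0 \<Longrightarrow> f u > 0" and le: "\<And>u. u \<ge> 0 \<Longrightarrow> f u \<le> B * exp (b * u ^ 3)"
  shows "rapidly_decaying (\<lambda>u. f u * K u)"
  unfolding rapidly_decaying_def
proof (intro conjI allI impI)
  show "(\<lambda>u. f u * K u) \<in> borel_measurable borel"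
    using K f by (auto simp: rapidly_decaying_def)
  show "f u * K u > 0" if "u \<ge> 0" for u
    using K that pos by (auto simp: rapidly_decaying_def)
  fix a
  obtain C where C: "\<And>u. u \<ge> 0 \<Longrightarrow> K u \<le> C * exp (- (a + b) * u ^ 3)"
    using K unfolding rapidly_decaying_def by meson
  show "\<exists>C. \<forall>u\<ge>0. f u * K u \<le> C * exp (- a * u ^ 3)"
  proof (intro exI[of _ "B * C"] allI impI)
    fix u :: real assume u: "u \<ge> 0"
    have "f u * K u \<le> (B * exp (b * u ^ 3)) * (C * exp (- (a + b) * u ^ 3))"
      using pos[OF u] K u order.strict_trans2[OF pos[OF u] le[OF u]]
      by (intro mult_mono le C) (auto simp: rapidly_decaying_def less_imp_le)
    also have "\<dots> = B * C * (exp (b * u ^ 3) * exp (- (a + b) * u ^ 3))" by simp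
    also have "exp (b * u ^ 3) * exp (- (a + b) * u ^ 3) = exp (- a * u ^ 3)"
      by (simp add: exp_add[symmetric] algebra_simps)
    finally show "f u * K u \<le> B * C * exp (- a * u ^ 3)" .
  qed
qed

section \<open>Stability of rapid decay, integrability, and growth of the transform\<close>

lemma le_one_plus_cube: "u \<le> 1 + u ^ 3" if "u \<ge> 0" for u :: real
proof (cases "u \<le> 1")
  case True
  then show ?thesis using that zero_le_power[of u 3] by linarith
next
  case False
  then show ?thesis using self_le_power[of u 3] by simp
qed

lemma square_le_one_plus_cube: "u\<^sup>2 \<le> 1 + u ^ 3" if "u \<ge> 0" for u :: real
proof (cases "u \<le> 1")
  case True
  then have "u\<^sup>2 \<le> 1" using that by (simp add: power_le_one)
  then show ?thesis using that zero_le_power[of u 3] by linarith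
next
  case False
  then have "u\<^sup>2 \<le> u ^ 3" by (intro power_increasing) auto
  then show ?thesis by simp
qed

lemma rapidly_decaying_heat:
  assumes K: "rapidly_decaying K"
  shows "rapidly_decaying (\<lambda>u. exp (t * u\<^sup>2) * K u)"
proof (rule rapidly_decaying_mult[OF K])
  fix u :: real assume u: "u \<ge> 0"
  have "t * u\<^sup>2 \<le> \<bar>t\<bar> * (1 + u ^ 3)"
    by (rule mult_mono) (use square_le_one_plus_cube[OF u] in auto)
  then show "exp (t * u\<^sup>2) \<le> exp \<bar>t\<bar> * exp (\<bar>t\<bar> * u ^ 3)"
    by (simp add: exp_add[symmetric] algebra_simps)
qed auto

lemma rapidly_decaying_cosh:
  assumes K: "rapidly_decaying K"
  shows "rapidly_decaying (\<lambda>u. cosh (l * u) * K u)"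
proof (rule rapidly_decaying_mult[OF K])
  show "(\<lambda>u. cosh (l * u)) \<in> borel_measurable borel"
    by (intro borel_measurable_continuous_onI continuous_intros)
  fix u :: real assume u: "u \<ge> 0"
  have "cosh (l * u) \<le> exp \<bar>l * u\<bar>"
  proof -
    have "exp (l * u) \<le> exp \<bar>l * u\<bar>" "exp (- (l * u)) \<le> exp \<bar>l * u\<bar>"
      by (subst exp_le_cancel_iff, linarith)+
    then show ?thesis unfolding cosh_def by (simp del: exp_le_cancel_iff)
  qed
  also have "\<bar>l * u\<bar> \<le> \<bar>l\<bar> * (1 + u ^ 3)"
    using le_one_plus_cube[OF u] u by (auto simp: abs_mult intro!: mult_left_mono)
  finally show "cosh (l * u) \<le> exp \<bar>l\<bar> * exp (\<bar>l\<bar> * u ^ 3)"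
    by (simp add: exp_add[symmetric] algebra_simps)
qed (auto simp: cosh_real_pos)

lemma rapidly_decaying_integrable:
  assumes K: "rapidly_decaying K"
  shows "integrable half_line (\<lambda>u. K u * exp (b * u ^ 3))"
proof -
  obtain C where C: "\<And>u. u \<ge> 0 \<Longrightarrow> K u \<le> C * exp (- (b + 1) * u ^ 3)"
    using K unfolding rapidly_decaying_def by meson
  have [measurable]: "K \<in> borel_measurable borel" using K by (simp add: rapidly_decaying_def)
  have Kpos: "K u > 0" if "u \<ge> 0" for u using K that by (simp add: rapidly_decaying_def)
  show ?thesis
  proof (rule Bochner_Integration.integrable_bound[OF integrable_mult_right[OF integrable_half_line_exp, of "C * exp 1"]])
    show "AE u in half_line. norm (K u * exp (b * u ^ 3)) \<le> norm (C * exp 1 * exp (- u))"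
    proof (rule AE_I2, simp del: real_norm_def)
      fix u :: real assume u: "0 \<le> u"
      have C0: "C \<ge> 0" using C[of 0] Kpos[of 0] by simp
      have "K u * exp (b * u ^ 3) \<le> (C * exp (- (b + 1) * u ^ 3)) * exp (b * u ^ 3)"
        using C[OF u] by (intro mult_right_mono) auto
      also have "\<dots> = C * exp (- (u ^ 3))" by (simp add: exp_add[symmetric] algebra_simps)
      also have "\<dots> \<le> C * exp (1 - u)" using le_one_plus_cube[OF u] C0 by (intro mult_left_mono) auto
      finally show "norm (K u * exp (b * u ^ 3)) \<le> norm (C * exp 1 * exp (- u))"
        using Kpos[OF u] C0 by (simp add: exp_diff exp_minus divide_inverse abs_mult mult_ac)
    qed
  qed (measurable)
qed

text \<open>With r = sqrt |z|, r^2 u <= max (r, u)^3 <= r^3 + u^3. This is where the order 3/2 comes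
  from.\<close>

lemma exp_norm_mult_le:
  fixes z :: complex
  assumes "u \<ge> 0"
  shows "exp (cmod z * u) \<le> exp (cmod z powr (3 / 2)) * exp (u ^ 3)"
proof -
  define r where "r = sqrt (cmod z)"
  have r: "r \<ge> 0" "cmod z = r\<^sup>2" by (auto simp: r_def)
  have p: "cmod z powr (3 / 2) = r ^ 3"
  proof (cases "r = 0")
    case False
    then have "r > 0" using r by simp
    then have "cmod z powr (3 / 2) = (r powr 2) powr (3 / 2)" by (simp add: r(2))
    also have "\<dots> = r powr 3" unfolding powr_powr by simp
    finally show ?thesis using \<open>r > 0\<close> by simp
  qed (use r in simp)
  have "cmod z * u \<le> r ^ 3 + u ^ 3"
  proof (cases "u \<le> r")
    case True
    then have "r\<^sup>2 * u \<le> r\<^sup>2 * r" by (intro mult_left_mono) auto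
    then show ?thesis using assms r by (simp add: power2_eq_square power3_eq_cube add_increasing2)
  next
    case False
    then have "r\<^sup>2 * u \<le> u\<^sup>2 * u" using r assms by (intro mult_right_mono power_mono) auto
    then have "cmod z * u \<le> u ^ 3" by (simp add: r(2) power2_eq_square power3_eq_cube)
    moreover have "0 \<le> r ^ 3" using r by simp
    ultimately show ?thesis by linarith
  qed
  then show ?thesis unfolding p exp_add[symmetric] by simp
qed

lemma norm_cos_of_real_le: "u \<ge> 0 \<Longrightarrow> cmod (cos (z * of_real u)) \<le> exp (cmod z * u)"
  using norm_cos_le[of "z * of_real u"] by (simp add: norm_mult)

lemma rapidly_decaying_exp_weight_le:
  fixes z :: complex
  assumes K: "rapidly_decaying K" and u: "u \<ge> 0"
  shows "K u * exp (cmod z * u) \<le> exp (cmod z powr (3 / 2)) * (K u * exp (1 * u ^ 3))"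
  using mult_left_mono[OF exp_norm_mult_le[OF u, of z], of "K u"] K u
  by (simp add: rapidly_decaying_def less_imp_le mult_ac)

lemma integrable_exp_weight:
  fixes z :: complex
  assumes K: "rapidly_decaying K"
  shows "integrable half_line (\<lambda>u. K u * exp (cmod z * u))"
proof (rule Bochner_Integration.integrable_bound[OF integrable_mult_right[OF rapidly_decaying_integrable[OF K, of 1], of "exp (cmod z powr (3 / 2))"]])
  have [measurable]: "K \<in> borel_measurable borel" using K by (simp add: rapidly_decaying_def)
  show "(\<lambda>u. K u * exp (cmod z * u)) \<in> borel_measurable half_line" by measurable
  show "AE u in half_line. norm (K u * exp (cmod z * u)) \<le> norm (exp (cmod z powr (3 / 2)) * (K u * exp (1 * u ^ 3)))"
    using rapidly_decaying_exp_weight_le[OF K] K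
    by (intro AE_I2) (auto simp: rapidly_decaying_def abs_mult less_imp_le)
qed

lemma integrable_cos_transform:
  fixes z :: complex
  assumes K: "rapidly_decaying K"
  shows "integrable half_line (\<lambda>u. of_real (K u) * cos (z * of_real u))"
proof (rule Bochner_Integration.integrable_bound[OF integrable_exp_weight[OF K, of z]])
  have [measurable]: "K \<in> borel_measurable borel" using K by (simp add: rapidly_decaying_def)
  have "(\<lambda>u::real. cos (z * of_real u)) \<in> borel_measurable borel"
    by (intro borel_measurable_continuous_onI continuous_intros)
  then show "(\<lambda>u. of_real (K u) * cos (z * of_real u)) \<in> borel_measurable half_line" by measurable
  show "AE u in half_line. norm (of_real (K u) * cos (z * of_real u)) \<le> norm (K u * exp (cmod z * u))"
    using norm_cos_of_real_le K
    by (intro AE_I2) (auto simp: rapidly_decaying_def norm_mult less_imp_le intro!: mult_left_mono)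
qed

lemma cos_transform_growth:
  assumes K: "rapidly_decaying K"
  shows "\<exists>C>0. \<forall>z. cmod (cos_transform K z) \<le> C * exp (cmod z powr (3 / 2))"
proof -
  define I where "I = (\<integral>u. K u * exp (1 * u ^ 3) \<partial>half_line)"
  have I0: "I \<ge> 0"
    unfolding I_def using K by (intro integral_nonneg_AE AE_I2) (auto simp: rapidly_decaying_def less_imp_le)
  have "cmod (cos_transform K z) \<le> (I + 1) * exp (cmod z powr (3 / 2))" for z
  proof -
    have "cmod (cos_transform K z) \<le> (\<integral>u. exp (cmod z powr (3 / 2)) * (K u * exp (1 * u ^ 3)) \<partial>half_line)"
      unfolding cos_transform_def
    proof (rule order_trans[OF integral_norm_bound integral_mono[OF
          integrable_norm[OF integrable_cos_transform[OF K]]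
          integrable_mult_right[OF rapidly_decaying_integrable[OF K]]]])
      fix u assume "u \<in> space half_line"
      then have u: "u \<ge> 0" by simp
      then have Ku: "K u > 0" using K by (simp add: rapidly_decaying_def)
      have "norm (of_real (K u) * cos (z * of_real u)) \<le> K u * exp (cmod z * u)"
        using norm_cos_of_real_le[OF u] Ku by (auto simp: norm_mult)
      then show "norm (of_real (K u) * cos (z * of_real u)) \<le> exp (cmod z powr (3 / 2)) * (K u * exp (1 * u ^ 3))"
        using rapidly_decaying_exp_weight_le[OF K u, of z] by linarith
    qed
    also have "\<dots> = I * exp (cmod z powr (3 / 2))" by (simp add: I_def)
    also have "\<dots> \<le> (I + 1) * exp (cmod z powr (3 / 2))" by (intro mult_right_mono) auto
    finally show ?thesis .
  qed
  then show ?thesis using I0 by (intro exI[of _ "I + 1"]) auto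
qed

text \<open>Termwise integration of the cosine series, dominated by K u exp (|z| u). The power
  series shows at once that the transform is entire and contains even powers only.\<close>

lemma cos_transform_sums:
  fixes z :: complex
  assumes K: "rapidly_decaying K"
  shows "(\<lambda>n. of_real (cos_coeff n) * (\<integral>u. of_real (K u * u ^ n) \<partial>half_line) * z ^ n) sums cos_transform K z"
proof -
  have [measurable]: "K \<in> borel_measurable borel" using K by (simp add: rapidly_decaying_def)
  define f where "f = (\<lambda>n u. of_real (K u) * (cos_coeff n *\<^sub>R (z * of_real u) ^ n))"
  have Kpos: "K u > 0" if "u \<ge> 0" for u using K that by (simp add: rapidly_decaying_def)
  have coeff: "\<bar>cos_coeff n\<bar> \<le> 1 / fact n" for n
    by (auto simp: cos_coeff_def abs_divide power_abs)
  have partial: "cmod (\<Sum>i<n. f i u) \<le> K u * exp (cmod z * u)" if u: "u \<ge> 0" for n u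
  proof -
    have "cmod (f i u) \<le> K u * ((cmod z * u) ^ i /\<^sub>R fact i)" for i
    proof -
      have "cmod (f i u) = K u * (\<bar>cos_coeff i\<bar> * (cmod z * u) ^ i)"
        using Kpos[OF u] u by (simp add: f_def norm_mult norm_power)
      also have "\<dots> \<le> K u * (1 / fact i * (cmod z * u) ^ i)"
        using Kpos[OF u] u coeff by (intro mult_left_mono mult_right_mono) auto
      finally show ?thesis by (simp add: field_simps)
    qed
    then have "cmod (\<Sum>i<n. f i u) \<le> (\<Sum>i<n. K u * ((cmod z * u) ^ i /\<^sub>R fact i))"
      by (intro sum_norm_le) auto
    also have "\<dots> = K u * (\<Sum>i<n. (cmod z * u) ^ i /\<^sub>R fact i)"
      by (simp add: sum_distrib_left)
    also have "\<dots> \<le> K u * exp (cmod z * u)"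
      using Kpos[OF u] u unfolding exp_def
      by (intro mult_left_mono sum_le_suminf summable_exp_generic) auto
    finally show ?thesis .
  qed
  have fmeas: "(\<lambda>u. f i u) \<in> borel_measurable half_line" for i
  proof -
    have "(\<lambda>u::real. cos_coeff i *\<^sub>R (z * of_real u) ^ i) \<in> borel_measurable borel"
      by (intro borel_measurable_continuous_onI continuous_intros)
    then show ?thesis unfolding f_def by measurable
  qed
  have fint: "integrable half_line (f i)" for i
  proof (rule Bochner_Integration.integrable_bound[OF integrable_mult_right[OF integrable_exp_weight[OF K, of z], of 2] fmeas])
    have "cmod (f i u) \<le> 2 * (K u * exp (cmod z * u))" if u: "u \<ge> 0" for u
    proof -
      \<comment> \<open>A single term is a difference of two partial sums, hence the factor 2 in the
        majorant.\<close>
      have "f i u = (\<Sum>j<Suc i. f j u) - (\<Sum>j<i. f j u)" by simp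
      then have "cmod (f i u) \<le> cmod (\<Sum>j<Suc i. f j u) + cmod (\<Sum>j<i. f j u)"
        by (metis norm_triangle_ineq4)
      then show ?thesis using partial[OF u, of "Suc i"] partial[OF u, of i] by linarith
    qed
    then show "AE u in half_line. norm (f i u) \<le> norm (2 * (K u * exp (cmod z * u)))"
      using Kpos by (intro AE_I2) (auto simp: abs_mult abs_of_nonneg less_imp_le)
  qed
  have "(\<lambda>n. \<integral>u. (\<Sum>i<n. f i u) \<partial>half_line) \<longlonglongrightarrow> (\<integral>u. of_real (K u) * cos (z * of_real u) \<partial>half_line)"
  proof (rule integral_dominated_convergence[where w = "\<lambda>u. K u * exp (cmod z * u)"])
    show "AE u in half_line. (\<lambda>n. \<Sum>i<n. f i u) \<longlonglongrightarrow> of_real (K u) * cos (z * of_real u)"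
      unfolding f_def sum_distrib_left[symmetric]
      by (intro AE_I2 tendsto_mult_left) (use cos_converges in \<open>auto simp: sums_def\<close>)
    show "(\<lambda>u. of_real (K u) * cos (z * of_real u)) \<in> borel_measurable half_line"
      using integrable_cos_transform[OF K] by (rule borel_measurable_integrable)
    show "(\<lambda>u. \<Sum>i<n. f i u) \<in> borel_measurable half_line" for n
      using fmeas by measurable
  qed (use partial integrable_exp_weight[OF K] in auto)
  then have "(\<lambda>n. integral\<^sup>L half_line (f n)) sums cos_transform K z"
    unfolding sums_def cos_transform_def using fint by (simp add: Bochner_Integration.integral_sum)
  moreover have "integral\<^sup>L half_line (f n) = of_real (cos_coeff n) * (\<integral>u. of_real (K u * u ^ n) \<partial>half_line) * z ^ n" for n
  proof -
    have "f n = (\<lambda>u. (of_real (cos_coeff n) * z ^ n) * of_real (K u * u ^ n))"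
      by (auto simp: f_def power_mult_distrib scaleR_conv_of_real)
    then show ?thesis by simp
  qed
  ultimately show ?thesis by simp
qed

lemma cos_transform_minus: "cos_transform K (- z) = cos_transform K z"
  by (simp add: cos_transform_def)

lemma cos_transform_cnj:
  assumes "rapidly_decaying K"
  shows "cos_transform K (cnj z) = cnj (cos_transform K z)"
proof -
  have "of_real (K u) * cos (cnj z * of_real u) = cnj (of_real (K u) * cos (z * of_real u))" for u
    by (simp add: cnj_cos)
  then show ?thesis unfolding cos_transform_def
    by (simp only: integral_bounded_linear[OF bounded_linear_cnj integrable_cos_transform[OF assms]])
qed

lemma cosh_of_real: "cosh (of_real x) = complex_of_real (cosh x)"
  by (simp add: cosh_def scaleR_conv_of_real flip: exp_of_real of_real_minus)

text \<open>On the imaginary axis the integrand is K u cosh (y u) > 0. This gives g(0) \<noteq> 0 in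
  the factorisation and keeps zeros of \<open>H 0\<close> away from the pole of zeta.\<close>

lemma cos_transform_imag_nonzero:
  assumes K: "rapidly_decaying K"
  shows "cos_transform K (\<i> * of_real y) \<noteq> 0"
proof -
  have eq: "of_real (K u) * cos (\<i> * of_real y * of_real u) = complex_of_real (K u * cosh (y * u))" for u
    by (simp add: cosh_conv_cos mult_ac flip: cosh_of_real)
  have int: "integrable half_line (\<lambda>u. K u * cosh (y * u))"
    using integrable_cos_transform[OF K, of "\<i> * of_real y"]
    unfolding eq complex_of_real_integrable_eq .
  have "0 < (\<integral>u. K u * cosh (y * u) \<partial>half_line)"
  proof -
    have "emeasure lborel {0..1::real} \<le> emeasure lborel {0::real..}"
      by (intro emeasure_mono) auto
    then have nz: "emeasure half_line (space half_line) \<noteq> 0"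
      by (auto simp: emeasure_restrict_space)
    have pos: "K u * cosh (y * u) > 0" if "u \<ge> 0" for u
      using K that by (auto simp: rapidly_decaying_def cosh_real_pos)
    have "\<not> (AE u in half_line. K u * cosh (y * u) = 0)"
    proof
      assume "AE u in half_line. K u * cosh (y * u) = 0"
      then have "AE u in half_line. False"
        using AE_space
      proof eventually_elim
        case (elim u)
        then show ?case using pos[of u] by simp
      qed
      then show False
        using nz ae_filter_eq_bot_iff[of half_line] unfolding trivial_limit_def by blast
    qed
    moreover have nonneg: "AE u in half_line. 0 \<le> K u * cosh (y * u)"
      by (rule AE_I2) (use pos in \<open>simp add: less_imp_le\<close>)
    ultimately have "(\<integral>u. K u * cosh (y * u) \<partial>half_line) \<noteq> 0"
      by (simp only: integral_nonneg_eq_0_iff_AE[OF int nonneg] not_False_eq_True)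
    moreover have "(\<integral>u. K u * cosh (y * u) \<partial>half_line) \<ge> 0"
      by (rule integral_nonneg_AE[OF nonneg])
    ultimately show ?thesis by linarith
  qed
  then show ?thesis unfolding cos_transform_def eq by (simp del: of_real_mult)
qed

text \<open>Passing to the variable z^2 halves the order from 3/2 to 3/4, and being below 1 is what
  the Hadamard argument requires. Evenness of the series makes the value at \<open>csqrt w\<close>
  independent of the branch.\<close>

lemma cos_transform_factor:
  assumes K: "rapidly_decaying K"
  obtains g C where "g holomorphic_on UNIV" "\<And>z. cos_transform K z = g (z\<^sup>2)" "g 0 \<noteq> 0" "C > 0"
    "\<And>w. cmod (g w) \<le> C * exp (cmod w powr (3 / 4))" "\<And>w. g (cnj w) = cnj (g w)"
proof -
  define c where "c = (\<lambda>n. of_real (cos_coeff n) * (\<integral>u. complex_of_real (K u * u ^ n) \<partial>half_line))"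
  define g where "g = (\<lambda>w. cos_transform K (csqrt w))"
  have c: "(\<lambda>n. c n * z ^ n) sums cos_transform K z" for z
    using cos_transform_sums[OF K, of z] by (simp add: c_def)
  have even: "(\<lambda>n. c (2 * n) * (z\<^sup>2) ^ n) sums cos_transform K z" for z
  proof -
    have "(\<lambda>n. c (2 * n) * z ^ (2 * n)) sums cos_transform K z"
      using c[of z]
      by (subst sums_mono_reindex[where g = "\<lambda>n. 2 * n" and f = "\<lambda>n. c n * z ^ n"])
         (auto simp: strict_mono_def c_def cos_coeff_def elim!: evenE)
    then show ?thesis by (simp add: power_mult)
  qed
  have sums_g: "(\<lambda>n. c (2 * n) * w ^ n) sums g w" for w
    using even[of "csqrt w"] by (simp add: g_def)
  have gz: "cos_transform K z = g (z\<^sup>2)" for z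
    using sums_unique2[OF even sums_g] .
  have "g holomorphic_on ball 0 r" for r
    by (rule power_series_holomorphic[where a = "\<lambda>n. c (2 * n)"]) (use sums_g in simp)
  then have "g field_differentiable at w" for w
    using holomorphic_on_imp_differentiable_at[of g "ball 0 (cmod w + 1)" w] by auto
  then have hol: "g holomorphic_on UNIV"
    by (simp add: holomorphic_on_def field_differentiable_at_within)
  obtain C where C: "C > 0" "\<And>z. cmod (cos_transform K z) \<le> C * exp (cmod z powr (3 / 2))"
    using cos_transform_growth[OF K] by auto
  have "cmod (g w) \<le> C * exp (cmod w powr (3 / 4))" for w
  proof -
    have "cmod (csqrt w) = cmod w powr (1 / 2)" by (simp add: norm_csqrt powr_half_sqrt)
    then have "cmod (csqrt w) powr (3 / 2) = cmod w powr (3 / 4)" by (simp add: powr_powr)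
    then show ?thesis using C(2)[of "csqrt w"] by (simp add: g_def)
  qed
  moreover have "g (cnj w) = cnj (g w)" for w
  proof -
    have "g (cnj w) = g ((cnj (csqrt w))\<^sup>2)"
      by (metis complex_cnj_power power2_csqrt)
    also have "\<dots> = cnj (cos_transform K (csqrt w))" unfolding gz[symmetric] by (rule cos_transform_cnj[OF K])
    also have "\<dots> = cnj (g w)" by (simp add: g_def)
    finally show ?thesis .
  qed
  moreover have "g 0 \<noteq> 0"
    using cos_transform_imag_nonzero[OF K, of 0] gz[of 0] by simp
  ultimately show thesis using that[OF hol gz _ C(1)] by blast
qed

lemma cos_transform_holomorphic:
  assumes "rapidly_decaying K"
  shows "cos_transform K holomorphic_on A"
proof -
  obtain g where g: "g holomorphic_on UNIV" "\<And>z. cos_transform K z = g (z\<^sup>2)"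
    using cos_transform_factor[OF assms] by metis
  have "(\<lambda>z. g (z\<^sup>2)) holomorphic_on A"
    by (rule holomorphic_on_compose_gen[OF _ g(1), unfolded o_def]) (auto intro!: holomorphic_intros)
  then show ?thesis using g(2) by (metis (no_types, lifting) ext)
qed

lemma cos_transform_cosh:
  assumes K: "rapidly_decaying K"
  shows "cos_transform (\<lambda>u. cosh (l * u) * K u) z
       = (cos_transform K (z + \<i> * of_real l) + cos_transform K (z - \<i> * of_real l)) / 2"
proof -
  have "of_real (cosh (l * u) * K u) * cos (z * of_real u) =
      (of_real (K u) * cos ((z + \<i> * of_real l) * of_real u) + of_real (K u) * cos ((z - \<i> * of_real l) * of_real u)) / 2" for u
  proof -
    have "complex_of_real (cosh (l * u)) = cos (\<i> * of_real l * of_real u)"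
      by (simp add: cosh_conv_cos mult_ac flip: cosh_of_real)
    then show ?thesis
      by (simp add: algebra_simps cos_add cos_diff)
  qed
  then show ?thesis
    unfolding cos_transform_def by (simp only: integral_divide_zero
      Bochner_Integration.integral_add[OF integrable_cos_transform[OF K] integrable_cos_transform[OF K]])
qed

lemma cos_transform_step:
  assumes K: "rapidly_decaying K" and l: "l > 0" and y: "y > 0"
    and zero: "cos_transform (\<lambda>u. cosh (l * u) * K u) (Complex x y) = 0"
  shows "\<exists>a b. cos_transform K (Complex a b) = 0 \<and> (x - a)\<^sup>2 + y\<^sup>2 + l\<^sup>2 \<le> b\<^sup>2"
proof -
  obtain g C where g: "g holomorphic_on UNIV" "\<And>z. cos_transform K z = g (z\<^sup>2)" "g 0 \<noteq> 0" "C > 0"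
    "\<And>w. cmod (g w) \<le> C * exp (cmod w powr (3 / 4))" "\<And>w. g (cnj w) = cnj (g w)"
    using cos_transform_factor[OF K] by metis
  have "Complex x y + \<i> * of_real l = Complex x (y + l)" "Complex x y - \<i> * of_real l = Complex x (y - l)"
    by (auto simp: complex_eq_iff)
  then have "g ((Complex x (y + l))\<^sup>2) + g ((Complex x (y - l))\<^sup>2) = 0"
    using zero by (simp add: cos_transform_cosh[OF K] g(2))
  from de_Bruijn_step[OF g(1,3,4) _ g(5,6) l y this] show ?thesis by (simp add: g(2))
qed

section \<open>Discretised heat flow\<close>

lemma cosh_ge_quadratic: "1 + v\<^sup>2 / 2 \<le> cosh v" for v :: real
proof -
  have "cosh v = 1 + 2 * (sinh (v / 2))\<^sup>2"
    using cosh_double_cosh[of "v / 2"] by (simp add: cosh_square_eq)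
  moreover have "(v / 2)\<^sup>2 \<le> (sinh (v / 2))\<^sup>2"
    using real_le_abs_sinh[of "v / 2"] by (simp only: abs_le_square_iff sinh_field_def exp_minus)
  ultimately show ?thesis by (simp add: power_divide)
qed

lemma tanh_le_self: "tanh v \<le> v" if "v \<ge> 0" for v :: real
proof -
  have "0 - tanh 0 \<le> v - tanh v"
  proof (rule DERIV_nonneg_imp_nondecreasing[OF that])
    fix x :: real
    have "((\<lambda>v. v - tanh v) has_real_derivative (tanh x)\<^sup>2) (at x)"
      by (auto intro!: derivative_eq_intros simp: cosh_real_nonzero)
    then show "\<exists>y. ((\<lambda>v. v - tanh v) has_real_derivative y) (at x) \<and> 0 \<le> y" by force
  qed
  then show ?thesis by simp
qed

text \<open>For v >= 0 the function v^2 / 2 - ln (cosh v) vanishes at 0 and has derivative v - tanh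
  v >= 0.\<close>

lemma cosh_le_gaussian: "cosh v \<le> exp (v\<^sup>2 / 2)" for v :: real
proof -
  have *: "cosh v \<le> exp (v\<^sup>2 / 2)" if "v \<ge> 0" for v :: real
  proof -
    have "0\<^sup>2 / 2 - ln (cosh 0) \<le> v\<^sup>2 / 2 - ln (cosh v)"
    proof (rule DERIV_nonneg_imp_nondecreasing[OF that])
      fix x :: real assume "0 \<le> x"
      have "((\<lambda>v. v\<^sup>2 / 2 - ln (cosh v)) has_real_derivative x - tanh x) (at x)"
        by (auto intro!: derivative_eq_intros simp: cosh_real_pos tanh_def)
      then show "\<exists>y. ((\<lambda>v. v\<^sup>2 / 2 - ln (cosh v)) has_real_derivative y) (at x) \<and> 0 \<le> y"
        using tanh_le_self[OF \<open>0 \<le> x\<close>] by force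
    qed
    then have "ln (cosh v) \<le> v\<^sup>2 / 2" by simp
    then show ?thesis by (metis cosh_real_pos exp_le_cancel_iff exp_ln)
  qed
  show ?thesis using *[of "\<bar>v\<bar>"] by simp
qed

text \<open>With a = v^2 / 2, one factor errs by at most exp a - 1 - a <= a^2 exp a, and the errors
  of \<open>k\<close> factors add up. For v^2 of size 1/N and k <= N the total is of size
  1/N.\<close>

lemma exp_power_minus_cosh_power:
  fixes v :: real
  shows "0 \<le> exp (v\<^sup>2 / 2) ^ k - cosh v ^ k"
    and "exp (v\<^sup>2 / 2) ^ k - cosh v ^ k \<le> real k * (v\<^sup>2 / 2)\<^sup>2 * exp (v\<^sup>2 / 2) ^ k"
proof -
  define a where "a = v\<^sup>2 / 2"
  have a: "a \<ge> 0" by (simp add: a_def)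
  have c: "1 + a \<le> cosh v" "cosh v \<le> exp a"
    using cosh_ge_quadratic cosh_le_gaussian by (auto simp: a_def)
  show "0 \<le> exp (v\<^sup>2 / 2) ^ k - cosh v ^ k"
    using power_mono[OF c(2), of k] a c by (simp add: a_def)
  have e1: "exp a - 1 \<le> a * exp a"
    using exp_ge_add_one_self[of "- a"] mult_left_mono[of "1 - a" "exp (- a)" "exp a"]
    by (simp add: algebra_simps flip: exp_add)
  have "exp a - cosh v \<le> a * (exp a - 1)"
    using e1 c(1) by (simp add: algebra_simps)
  also have "\<dots> \<le> a * (a * exp a)" by (intro mult_left_mono e1 a)
  finally have ec: "exp a - cosh v \<le> a\<^sup>2 * exp a" by (simp add: power2_eq_square mult_ac)
  have "exp a ^ k - cosh v ^ k \<le> real k * a\<^sup>2 * exp a ^ k"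
  proof (induction k)
    case (Suc k)
    have "exp a ^ Suc k - cosh v ^ Suc k = exp a * (exp a ^ k - cosh v ^ k) + (exp a - cosh v) * cosh v ^ k"
      by (simp add: algebra_simps)
    also have "\<dots> \<le> exp a * (real k * a\<^sup>2 * exp a ^ k) + (a\<^sup>2 * exp a) * exp a ^ k"
      using Suc ec c a by (intro add_mono mult_left_mono mult_mono power_mono) auto
    also have "\<dots> = real (Suc k) * a\<^sup>2 * exp a ^ Suc k" by (simp add: algebra_simps)
    finally show ?case .
  qed simp
  then show "exp (v\<^sup>2 / 2) ^ k - cosh v ^ k \<le> real k * (v\<^sup>2 / 2)\<^sup>2 * exp (v\<^sup>2 / 2) ^ k"
    by (simp add: a_def)
qed

text \<open>The heat factor \<open>exp (t u\<^sup>2)\<close> at time \<open>t = k T / N\<close> is replaced by the \<open>k\<close>-th power of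
  \<open>cosh (l u)\<close> with \<open>l\<^sup>2 = 2 T / N\<close>; each factor amounts to averaging the transform over
  vertical shifts by \<open>\<plusminus> l\<close>.\<close>
definition heat_approx :: "(real \<Rightarrow> real) \<Rightarrow> real \<Rightarrow> nat \<Rightarrow> nat \<Rightarrow> real \<Rightarrow> real" where
  "heat_approx K T N k u = cosh (sqrt (2 * T / real N) * u) ^ k * K u"

lemma rapidly_decaying_heat_approx:
  assumes "rapidly_decaying K"
  shows "rapidly_decaying (heat_approx K T N k)"
proof (induction k)
  case 0
  then show ?case using assms by (simp add: heat_approx_def[abs_def])
next
  case (Suc k)
  from rapidly_decaying_cosh[OF this, of "sqrt (2 * T / real N)"]
  show ?case by (simp add: heat_approx_def[abs_def] mult_ac)
qed

lemma heat_approx_Suc: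
  "heat_approx K T N (Suc k) = (\<lambda>u. cosh (sqrt (2 * T / real N) * u) * heat_approx K T N k u)"
  by (simp add: heat_approx_def[abs_def] mult_ac)

text \<open>In the weight exp ((T + 1) u^2), the T serves the heat factor and the 1 absorbs u^4
  through u^4 <= 2 exp (u^2). The weight is the same for all \<open>k\<close>, which makes the later
  bounds uniform in time.\<close>

lemma heat_approx_error:
  assumes T: "T > 0" and k: "k \<le> N" and N: "N > 0" and K: "K u > 0"
  shows "\<bar>heat_approx K T N k u - exp (real k * T / real N * u\<^sup>2) * K u\<bar>
      \<le> 2 * T\<^sup>2 / real N * (exp ((T + 1) * u\<^sup>2) * K u)"
proof -
  define v where "v = sqrt (2 * T / real N) * u"
  have v: "v\<^sup>2 / 2 = T * u\<^sup>2 / real N"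
    using T N by (simp add: v_def power_mult_distrib)
  have e: "exp (v\<^sup>2 / 2) ^ k = exp (real k * T / real N * u\<^sup>2)"
    unfolding v by (simp add: exp_of_nat_mult[symmetric])
  have u4: "(u\<^sup>2)\<^sup>2 \<le> 2 * exp (u\<^sup>2)"
    using exp_lower_Taylor_quadratic[of "u\<^sup>2"] zero_le_power2[of u] by linarith
  have kN: "real k * T / real N * u\<^sup>2 \<le> T * u\<^sup>2"
    using k N T by (intro mult_right_mono) (auto simp: field_simps)
  have "\<bar>heat_approx K T N k u - exp (real k * T / real N * u\<^sup>2) * K u\<bar>
      = (exp (v\<^sup>2 / 2) ^ k - cosh v ^ k) * K u"
  proof -
    have "heat_approx K T N k u - exp (real k * T / real N * u\<^sup>2) * K u
        = - ((exp (v\<^sup>2 / 2) ^ k - cosh v ^ k) * K u)"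
      unfolding heat_approx_def v_def[symmetric] e by (simp add: algebra_simps)
    then show ?thesis using exp_power_minus_cosh_power(1)[of v k] K by simp
  qed
  also have "\<dots> \<le> (real k * (v\<^sup>2 / 2)\<^sup>2 * exp (v\<^sup>2 / 2) ^ k) * K u"
    using exp_power_minus_cosh_power(2)[of v k] K by (intro mult_right_mono) auto
  also have "\<dots> \<le> (real N * (v\<^sup>2 / 2)\<^sup>2 * exp (T * u\<^sup>2)) * K u"
    using k K kN unfolding e by (intro mult_right_mono mult_mono) auto
  also have "real N * (v\<^sup>2 / 2)\<^sup>2 = T\<^sup>2 / real N * (u\<^sup>2)\<^sup>2"
    using N unfolding v by (simp add: power2_eq_square field_simps)
  also have "(T\<^sup>2 / real N * (u\<^sup>2)\<^sup>2 * exp (T * u\<^sup>2)) * K u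
       \<le> (T\<^sup>2 / real N * (2 * exp (u\<^sup>2)) * exp (T * u\<^sup>2)) * K u"
    using K u4 by (intro mult_right_mono mult_left_mono) auto
  also have "\<dots> = 2 * T\<^sup>2 / real N * ((exp (u\<^sup>2) * exp (T * u\<^sup>2)) * K u)" by simp
  also have "exp (u\<^sup>2) * exp (T * u\<^sup>2) = exp ((T + 1) * u\<^sup>2)"
    by (simp add: algebra_simps flip: exp_add)
  finally show ?thesis .
qed

text \<open>Uniformity in \<open>k\<close> matters because the barrier has to be respected at all
  intermediate times k T / N, not only at the end.\<close>

lemma cos_transform_heat_approx:
  assumes K: "rapidly_decaying K" and T: "T > 0"
  shows "\<exists>M. \<forall>N k z. 0 < N \<longrightarrow> k \<le> N \<longrightarrow> cmod z \<le> r \<longrightarrow>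
     cmod (cos_transform (heat_approx K T N k) z
       - cos_transform (\<lambda>u. exp (real k * T / real N * u\<^sup>2) * K u) z) \<le> M / real N"
proof -
  define W where "W = (\<lambda>u. exp ((T + 1) * u\<^sup>2) * K u)"
  have W: "rapidly_decaying W" unfolding W_def by (rule rapidly_decaying_heat[OF K])
  \<comment> \<open>\<open>max r 0\<close> appears as a modulus so that
    \<open>integrable_exp_weight\<close> applies for any real \<open>r\<close>.\<close>
  define M where "M = 2 * T\<^sup>2 * (\<integral>u. W u * exp (cmod (of_real (max r 0)) * u) \<partial>half_line)"
  have "cmod (cos_transform (heat_approx K T N k) z
       - cos_transform (\<lambda>u. exp (real k * T / real N * u\<^sup>2) * K u) z) \<le> M / real N"
    if N: "0 < N" and k: "k \<le> N" and z: "cmod z \<le> r" for N k z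
  proof -
    let ?A = "heat_approx K T N k" and ?B = "\<lambda>u. exp (real k * T / real N * u\<^sup>2) * K u"
    note intA = integrable_cos_transform[OF rapidly_decaying_heat_approx[OF K], of T N k z]
    note intB = integrable_cos_transform[OF rapidly_decaying_heat[OF K], of "real k * T / real N" z]
    have "cos_transform ?A z - cos_transform ?B z
       = (\<integral>u. of_real (?A u) * cos (z * of_real u) - of_real (?B u) * cos (z * of_real u) \<partial>half_line)"
      unfolding cos_transform_def by (rule Bochner_Integration.integral_diff[OF intA intB, symmetric])
    also have "cmod \<dots> \<le> (\<integral>u. 2 * T\<^sup>2 / real N * (W u * exp (cmod (of_real (max r 0)) * u)) \<partial>half_line)"
    proof (rule order_trans[OF integral_norm_bound integral_mono])
      show "integrable half_line (\<lambda>u. norm (of_real (?A u) * cos (z * of_real u) - of_real (?B u) * cos (z * of_real u)))"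
        by (rule integrable_norm[OF Bochner_Integration.integrable_diff[OF intA intB]])
      show "integrable half_line (\<lambda>u. 2 * T\<^sup>2 / real N * (W u * exp (cmod (of_real (max r 0)) * u)))"
        by (rule integrable_mult_right[OF integrable_exp_weight[OF W]])
      fix u assume "u \<in> space half_line"
      then have u: "u \<ge> 0" by simp
      then have Ku: "K u > 0" using K by (simp add: rapidly_decaying_def)
      have "cmod (of_real (?A u) * cos (z * of_real u) - of_real (?B u) * cos (z * of_real u))
          = \<bar>?A u - ?B u\<bar> * cmod (cos (z * of_real u))"
        by (simp only: left_diff_distrib[symmetric] norm_mult of_real_diff[symmetric] norm_of_real)
      also have "\<dots> \<le> (2 * T\<^sup>2 / real N * W u) * exp (max r 0 * u)"
      proof (rule mult_mono)
        show "\<bar>?A u - ?B u\<bar> \<le> 2 * T\<^sup>2 / real N * W u"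
          unfolding W_def by (rule heat_approx_error[where K = K and u = u, OF T k N Ku])
        have "cmod z * u \<le> max r 0 * u" using z u by (intro mult_right_mono) auto
        then show "cmod (cos (z * of_real u)) \<le> exp (max r 0 * u)"
          using norm_cos_of_real_le[OF u, of z] by (meson exp_le_cancel_iff order_trans)
        show "0 \<le> 2 * T\<^sup>2 / real N * W u" using Ku by (simp add: W_def)
      qed auto
      finally show "norm (of_real (?A u) * cos (z * of_real u) - of_real (?B u) * cos (z * of_real u))
         \<le> 2 * T\<^sup>2 / real N * (W u * exp (cmod (of_real (max r 0)) * u))" by (simp add: mult_ac)
    qed
    also have "\<dots> = M / real N" by (simp add: M_def)
    finally show ?thesis .
  qed
  then show ?thesis by blast
qed

text \<open>Joint continuity in time and space turns the absence of zeros in (iii) into a positive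
  lower bound on a compact set.\<close>

lemma cos_transform_heat_continuous:
  assumes K: "rapidly_decaying K"
  shows "continuous_on A (\<lambda>(t, z). cos_transform (\<lambda>u. exp (t * u\<^sup>2) * K u) z)"
  unfolding continuous_on_sequentially
proof (intro allI ballI impI)
  fix X and p :: "real \<times> complex" assume "p \<in> A" and "(\<forall>n. X n \<in> A) \<and> X \<longlonglongrightarrow> p"
  then have lim: "X \<longlonglongrightarrow> p" by simp
  define t z where "t = (\<lambda>n. fst (X n))" and "z = (\<lambda>n. snd (X n))"
  have tl: "t \<longlonglongrightarrow> fst p" and zl: "z \<longlonglongrightarrow> snd p"
    unfolding t_def z_def by (intro tendsto_fst tendsto_snd lim)+
  obtain a where a: "\<And>n. \<bar>t n\<bar> \<le> a"
    using convergent_imp_Bseq[OF convergentI[OF tl]] by (auto simp: Bseq_def)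
  obtain b where b: "\<And>n. cmod (z n) \<le> b" "b > 0"
    using convergent_imp_Bseq[OF convergentI[OF zl]] by (auto simp: Bseq_def)
  have [measurable]: "K \<in> borel_measurable borel" using K by (simp add: rapidly_decaying_def)
  have "(\<lambda>n. \<integral>u. of_real (exp (t n * u\<^sup>2) * K u) * cos (z n * of_real u) \<partial>half_line)
      \<longlonglongrightarrow> (\<integral>u. of_real (exp (fst p * u\<^sup>2) * K u) * cos (snd p * of_real u) \<partial>half_line)"
  proof (rule integral_dominated_convergence[where w = "\<lambda>u. exp (a * u\<^sup>2) * K u * exp (cmod (of_real b) * u)"])
    show "integrable half_line (\<lambda>u. exp (a * u\<^sup>2) * K u * exp (cmod (of_real b) * u))"
      by (rule integrable_exp_weight[OF rapidly_decaying_heat[OF K]])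
    show "AE u in half_line. (\<lambda>n. of_real (exp (t n * u\<^sup>2) * K u) * cos (z n * of_real u))
        \<longlonglongrightarrow> of_real (exp (fst p * u\<^sup>2) * K u) * cos (snd p * of_real u)"
      by (intro AE_I2 tendsto_intros tl zl)
    show "AE u in half_line. norm (of_real (exp (t n * u\<^sup>2) * K u) * cos (z n * of_real u))
        \<le> exp (a * u\<^sup>2) * K u * exp (cmod (of_real b) * u)" for n
    proof (rule AE_I2)
      fix u assume "u \<in> space half_line"
      then have u: "u \<ge> 0" by simp
      then have Ku: "K u > 0" using K by (simp add: rapidly_decaying_def)
      have "t n * u\<^sup>2 \<le> a * u\<^sup>2" using a[of n] by (intro mult_right_mono) auto
      moreover have "cmod (z n) * u \<le> b * u" using b u by (intro mult_right_mono) auto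
      then have "cmod (cos (z n * of_real u)) \<le> exp (b * u)"
        using norm_cos_of_real_le[OF u, of "z n"] by (meson exp_le_cancel_iff order_trans)
      ultimately have "exp (t n * u\<^sup>2) * K u * cmod (cos (z n * of_real u)) \<le> exp (a * u\<^sup>2) * K u * exp (b * u)"
        using Ku by (intro mult_mono) auto
      then show "norm (of_real (exp (t n * u\<^sup>2) * K u) * cos (z n * of_real u))
        \<le> exp (a * u\<^sup>2) * K u * exp (cmod (of_real b) * u)"
        using Ku b by (simp add: norm_mult)
    qed
  qed (rule borel_measurable_integrable[OF integrable_cos_transform[OF rapidly_decaying_heat[OF K]]])+
  then show "((\<lambda>(t, z). cos_transform (\<lambda>u. exp (t * u\<^sup>2) * K u) z) \<circ> X)
      \<longlonglongrightarrow> (case p of (t, z) \<Rightarrow> cos_transform (\<lambda>u. exp (t * u\<^sup>2) * K u) z)"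
    by (simp add: o_def case_prod_beta t_def z_def cos_transform_def)
qed

text \<open>Zeros of the limit are approached by zeros of the approximants at the final step k = N.
  The freedom in \<open>N0\<close> lets the lemma be combined with bounds valid only for large
  \<open>N\<close>.\<close>

lemma cos_transform_heat_Hurwitz:
  assumes K: "rapidly_decaying K" and T: "T > 0" and S: "open S" "z0 \<in> S"
    and zero: "cos_transform (\<lambda>u. exp (T * u\<^sup>2) * K u) z0 = 0"
  shows "\<exists>N>N0. \<exists>z\<in>S. cos_transform (heat_approx K T N N) z = 0"
proof (rule ccontr)
  assume "\<not> ?thesis"
  then have nz: "cos_transform (heat_approx K T N N) z \<noteq> 0" if "N > N0" "z \<in> S" for N z
    using that by blast
  obtain e where e: "e > 0" "ball z0 e \<subseteq> S" using S by (metis open_contains_ball)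
  let ?g = "cos_transform (\<lambda>u. exp (T * u\<^sup>2) * K u)"
  have KT: "rapidly_decaying (\<lambda>u. exp (T * u\<^sup>2) * K u)" by (rule rapidly_decaying_heat[OF K])
  have "?g z0 \<noteq> 0"
  proof (rule Hurwitz_no_zeros[of "ball z0 e" "\<lambda>n. cos_transform (heat_approx K T (Suc N0 + n) (Suc N0 + n))" ?g z0])
    show "cos_transform (heat_approx K T (Suc N0 + n) (Suc N0 + n)) holomorphic_on ball z0 e" for n
      by (rule cos_transform_holomorphic[OF rapidly_decaying_heat_approx[OF K]])
    show "?g holomorphic_on ball z0 e" by (rule cos_transform_holomorphic[OF KT])
    \<comment> \<open>The constant would be 0, and by continuation the transform would vanish at the
      origin, where it is nonzero.\<close>
    show "\<not> ?g constant_on ball z0 e"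
    proof
      assume "?g constant_on ball z0 e"
      then have g0: "?g z = 0" if "z \<in> ball z0 e" for z
        using that zero e(1) unfolding constant_on_def by (metis centre_in_ball)
      have "?g 0 = 0"
        by (rule analytic_continuation_open[of "ball z0 e" UNIV ?g "\<lambda>_. 0"])
           (use e(1) g0 in \<open>auto intro: cos_transform_holomorphic[OF KT]\<close>)
      then show False using cos_transform_imag_nonzero[OF KT, of 0] by simp
    qed
    show "uniform_limit C (\<lambda>n. cos_transform (heat_approx K T (Suc N0 + n) (Suc N0 + n))) ?g sequentially"
      if "compact C" "C \<subseteq> ball z0 e" for C
    proof (rule uniform_limitI)
      fix \<epsilon> :: real assume \<epsilon>: "\<epsilon> > 0"
      obtain M where M: "\<And>N k z. 0 < N \<Longrightarrow> k \<le> N \<Longrightarrow> cmod z \<le> cmod z0 + e \<Longrightarrow>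
         cmod (cos_transform (heat_approx K T N k) z
         - cos_transform (\<lambda>u. exp (real k * T / real N * u\<^sup>2) * K u) z) \<le> M / real N"
        using cos_transform_heat_approx[OF K T, of "cmod z0 + e"] by blast
      have "(\<lambda>n. M / real (Suc N0 + n)) \<longlonglongrightarrow> 0" by real_asymp
      then have "\<forall>\<^sub>F n in sequentially. M / real (Suc N0 + n) < \<epsilon>" using \<epsilon> by (rule order_tendstoD)
      then show "\<forall>\<^sub>F n in sequentially. \<forall>z\<in>C. dist (cos_transform (heat_approx K T (Suc N0 + n) (Suc N0 + n)) z) (?g z) < \<epsilon>"
      proof eventually_elim
        case (elim n)
        show ?case
        proof
          fix z assume "z \<in> C"
          then have "dist z0 z < e" using that(2) by auto
          then have "cmod z \<le> cmod z0 + e"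
            using norm_triangle_ineq2[of z z0] by (simp add: dist_norm norm_minus_commute)
          then show "dist (cos_transform (heat_approx K T (Suc N0 + n) (Suc N0 + n)) z) (?g z) < \<epsilon>"
            using M[of "Suc N0 + n" "Suc N0 + n" z] elim by (simp add: dist_norm)
        qed
      qed
    qed
  qed (use nz e in auto)
  then show False using zero by simp
qed

section \<open>Location of zeros along the discrete flow\<close>

lemma cos_transform_zero_nonneg_imag:
  assumes K: "rapidly_decaying K" and zero: "cos_transform K (Complex x y) = 0"
  shows "cos_transform K (Complex \<bar>x\<bar> \<bar>y\<bar>) = 0" "cos_transform K (Complex x \<bar>y\<bar>) = 0"
proof -
  have c: "cos_transform K (Complex x (- y)) = 0" if "cos_transform K (Complex x y) = 0" for x y
    using cos_transform_cnj[OF K, of "Complex x y"] that by (simp add: complex_cnj)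
  have m: "cos_transform K (Complex (- x) y) = 0" if "cos_transform K (Complex x y) = 0" for x y
  proof -
    have "- Complex x (- y) = Complex (- x) y" by (simp add: complex_eq_iff)
    then show ?thesis using cos_transform_minus[of K "Complex x (- y)"] c[OF that] by simp
  qed
  show "cos_transform K (Complex x \<bar>y\<bar>) = 0"
    using c[OF zero] zero by (auto simp: abs_if)
  then show "cos_transform K (Complex \<bar>x\<bar> \<bar>y\<bar>) = 0"
    using m[of x "\<bar>y\<bar>"] by (auto simp: abs_if)
qed

text \<open>The step inequality with its horizontal term dropped: each step lowers the squared
  height by l^2 = 2 T / N. The alternative y = 0 covers the regime where the bound has become
  negative and only real zeros are left.\<close>

lemma heat_approx_strip:
  assumes K: "rapidly_decaying K" and T: "T > 0" and N: "N > 0"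
    and base: "\<And>x y. cos_transform K (Complex x y) = 0 \<Longrightarrow> y = 0 \<or> y\<^sup>2 \<le> B"
    and zero: "cos_transform (heat_approx K T N k) (Complex x y) = 0"
  shows "y = 0 \<or> y\<^sup>2 \<le> B - real k * (2 * T / real N)"
  using zero
proof (induction k arbitrary: x y)
  case 0
  then have "cos_transform K (Complex x y) = 0" by (simp add: heat_approx_def[abs_def])
  then show ?case using base by simp
next
  case (Suc k)
  let ?l = "sqrt (2 * T / real N)"
  have l: "?l > 0" "?l\<^sup>2 = 2 * T / real N" using T N by auto
  show ?case
  proof (cases "y = 0")
    case False
    then have y: "\<bar>y\<bar> > 0" by simp
    have "cos_transform (\<lambda>u. cosh (?l * u) * heat_approx K T N k u) (Complex x \<bar>y\<bar>) = 0"
      using cos_transform_zero_nonneg_imag(2)[OF rapidly_decaying_heat_approx[OF K] Suc.prems]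
      by (simp add: heat_approx_Suc)
    from cos_transform_step[OF rapidly_decaying_heat_approx[OF K] l(1) y this]
    obtain a b where ab: "cos_transform (heat_approx K T N k) (Complex a b) = 0"
      "(x - a)\<^sup>2 + \<bar>y\<bar>\<^sup>2 + ?l\<^sup>2 \<le> b\<^sup>2" by blast
    have "y\<^sup>2 > 0" using False by simp
    moreover have ab': "y\<^sup>2 + 2 * T / real N \<le> b\<^sup>2"
      using ab(2) zero_le_power2[of "x - a"] unfolding l(2) power2_abs by linarith
    moreover have "2 * T / real N > 0" using T N by simp
    \<comment> \<open>The earlier zero is off the real axis, which selects the second alternative of
      the induction hypothesis.\<close>
    ultimately have "b\<^sup>2 > 0" by linarith
    then have "b \<noteq> 0" by auto
    then show ?thesis using Suc.IH[OF ab(1)] ab' by (auto simp: algebra_simps add_divide_distrib)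
  qed simp
qed

text \<open>De Bruijn's strip theorem. Points violating the claim form an open set, so Hurwitz would
  place a zero of some approximant in it.\<close>

lemma heat_strip:
  assumes K: "rapidly_decaying K" and T: "T > 0"
    and base: "\<And>x y. cos_transform K (Complex x y) = 0 \<Longrightarrow> y = 0 \<or> y\<^sup>2 \<le> B"
    and zero: "cos_transform (\<lambda>u. exp (T * u\<^sup>2) * K u) (Complex x y) = 0"
  shows "y = 0 \<or> y\<^sup>2 \<le> B - 2 * T"
proof (rule ccontr)
  assume neg: "\<not> ?thesis"
  define S where "S = {z. Im z \<noteq> 0} \<inter> {z. (Im z)\<^sup>2 > B - 2 * T}"
  have "open S" unfolding S_def
    by (intro open_Int open_Collect_neq open_Collect_less continuous_intros)
  moreover have "Complex x y \<in> S" using neg by (simp add: S_def)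
  ultimately obtain N z where N: "N > 0" "z \<in> S" "cos_transform (heat_approx K T N N) z = 0"
    using cos_transform_heat_Hurwitz[OF K T _ _ zero, of S 0] by blast
  have "Im z = 0 \<or> (Im z)\<^sup>2 \<le> B - real N * (2 * T / real N)"
    by (rule heat_approx_strip[where k = N and x = "Re z" and y = "Im z", OF K T N(1) base]) (use N(3) in auto)
  then show False using N by (simp add: S_def)
qed

text \<open>Trace a zero one step back to a + i b. For |a| <= X the induction hypothesis applies,
  inside the barrier the assumption \<open>barrier\<close> does, and beyond it the global strip
  bound for b^2, which starts at \<open>B1\<close>, is reduced by (x - a)^2 >= w^2, with B1 - w^2 <=
  B.\<close>

lemma heat_approx_barrier:
  assumes K: "rapidly_decaying K" and T: "T > 0" and N: "N > 0"
    and strip: "\<And>x y. cos_transform K (Complex x y) = 0 \<Longrightarrow> y = 0 \<or> y\<^sup>2 \<le> B1"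
    and base: "\<And>x y. cos_transform K (Complex x y) = 0 \<Longrightarrow> \<bar>x\<bar> \<le> X \<Longrightarrow> y = 0 \<or> y\<^sup>2 \<le> B"
    and barrier: "\<And>j x y. j < k \<Longrightarrow> cos_transform (heat_approx K T N j) (Complex x y) = 0 \<Longrightarrow>
       X \<le> \<bar>x\<bar> \<Longrightarrow> \<bar>x\<bar> \<le> X + w \<Longrightarrow> y = 0 \<or> y\<^sup>2 \<le> B - real j * (2 * T / real N)"
    and w: "w \<ge> 0" "B1 - w\<^sup>2 \<le> B"
    and zero: "cos_transform (heat_approx K T N k) (Complex x y) = 0" and x: "\<bar>x\<bar> \<le> X"
  shows "y = 0 \<or> y\<^sup>2 \<le> B - real k * (2 * T / real N)"
  using zero x barrier
proof (induction k arbitrary: x y)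
  case 0
  then have "cos_transform K (Complex x y) = 0" by (simp add: heat_approx_def[abs_def])
  then show ?case using base 0 by simp
next
  case (Suc k)
  let ?l = "sqrt (2 * T / real N)"
  have l: "?l > 0" "?l\<^sup>2 = 2 * T / real N" using T N by auto
  have lpos: "2 * T / real N > 0" using T N by simp
  show ?case
  proof (cases "y = 0")
    case False
    then have y: "\<bar>y\<bar> > 0" by simp
    have "cos_transform (\<lambda>u. cosh (?l * u) * heat_approx K T N k u) (Complex x \<bar>y\<bar>) = 0"
      using cos_transform_zero_nonneg_imag(2)[OF rapidly_decaying_heat_approx[OF K] Suc.prems(1)]
      by (simp add: heat_approx_Suc)
    from cos_transform_step[OF rapidly_decaying_heat_approx[OF K] l(1) y this]
    obtain a b where ab: "cos_transform (heat_approx K T N k) (Complex a b) = 0"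
      "(x - a)\<^sup>2 + y\<^sup>2 + 2 * T / real N \<le> b\<^sup>2" unfolding l(2) by auto
    have "y\<^sup>2 > 0" using False by simp
    then have "b\<^sup>2 > 0"
      using ab(2) lpos zero_le_power2[of "x - a"] by linarith
    then have b0: "b \<noteq> 0" by auto
    have S: "real (Suc k) * (2 * T / real N) = real k * (2 * T / real N) + 2 * T / real N"
      by (simp add: algebra_simps add_divide_distrib)
    have "y\<^sup>2 \<le> B - real (Suc k) * (2 * T / real N)"
    proof (cases "\<bar>a\<bar> \<le> X + w")
      case True
      have "b = 0 \<or> b\<^sup>2 \<le> B - real k * (2 * T / real N)"
      proof (cases "\<bar>a\<bar> \<le> X")
        case True
        show ?thesis by (rule Suc.IH[OF ab(1) True]) (use Suc.prems(3) in simp)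
      next
        case False
        then show ?thesis using Suc.prems(3)[of k a b] ab(1) True by simp
      qed
      then show ?thesis using b0 ab(2) zero_le_power2[of "x - a"] S by linarith
    next
      case False
      then have "w \<le> \<bar>x - a\<bar>" using Suc.prems(2) by linarith
      then have "w\<^sup>2 \<le> (x - a)\<^sup>2" using w by (metis abs_le_square_iff abs_of_nonneg)
      moreover have "b = 0 \<or> b\<^sup>2 \<le> B1 - real k * (2 * T / real N)"
        by (rule heat_approx_strip[where k = k and x = a and y = b, OF K T N strip]) (use ab(1) in auto)
      then have "b\<^sup>2 \<le> B1 - real k * (2 * T / real N)"
        using b0 by blast
      ultimately show ?thesis using ab(2) S w by linarith
    qed
    then show ?thesis by blast
  qed simp
qed

section \<open>The theta transformation formula\<close>

text \<open>The segment is centred at 0 so that it lies in the unit disc, where exp (2 pi i z) - 1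
  vanishes only at 0.\<close>

definition Fourier_coeff :: "(complex \<Rightarrow> complex) \<Rightarrow> int \<Rightarrow> complex" where
  "Fourier_coeff f k = integral {- 1 / 2..1 / 2} (\<lambda>v. f (of_real v) * exp (- 2 * pi * \<i> * of_int k * of_real v))"

lemma Fourier_coeff_integrable:
  assumes "continuous_on (complex_of_real ` {- 1 / 2..1 / 2}) f"
  shows "(\<lambda>v. f (of_real v) * exp (- 2 * pi * \<i> * of_int k * of_real v)) integrable_on {- 1 / 2..1 / 2}"
  by (intro integrable_continuous_real continuous_intros continuous_on_compose2[OF assms]) auto

text \<open>One integration by parts. The values at the two ends of the segment may differ, so
  boundary terms remain and contribute 2 A; a decay of order 1/|k| is enough to kill the ends of a
  telescoping sum.\<close>

lemma Fourier_coeff_decay: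
  assumes g: "g holomorphic_on ball 0 1"
  shows "\<exists>M. \<forall>k. k \<noteq> 0 \<longrightarrow> cmod (Fourier_coeff g k) \<le> M / real_of_int \<bar>k\<bar>"
proof -
  let ?I = "{- 1 / 2..1 / 2 :: real}"
  have sub: "of_real v \<in> ball (0 :: complex) 1" if "v \<in> ?I" for v
    using that by (auto simp: norm_of_real)
  have sub': "complex_of_real ` ?I \<subseteq> ball 0 1" using sub by auto
  have dg: "deriv g holomorphic_on ball 0 1" by (intro holomorphic_deriv g) auto
  have contg: "continuous_on (complex_of_real ` ?I) g"
    using holomorphic_on_imp_continuous_on[OF holomorphic_on_subset[OF g sub']] .
  have contdg: "continuous_on (complex_of_real ` ?I) (deriv g)"
    using holomorphic_on_imp_continuous_on[OF holomorphic_on_subset[OF dg sub']] .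
  have comp: "compact (complex_of_real ` ?I)"
    by (intro compact_continuous_image continuous_intros) auto
  obtain A where A: "\<And>z. z \<in> complex_of_real ` ?I \<Longrightarrow> cmod (g z) \<le> A"
    using compact_imp_bounded[OF compact_continuous_image[OF contg comp]] by (auto simp: bounded_iff)
  obtain B where B: "\<And>z. z \<in> complex_of_real ` ?I \<Longrightarrow> cmod (deriv g z) \<le> B"
    using compact_imp_bounded[OF compact_continuous_image[OF contdg comp]] by (auto simp: bounded_iff)
  have "cmod (Fourier_coeff g k) \<le> ((B + 2 * A) / (2 * pi)) / real_of_int \<bar>k\<bar>" if k: "k \<noteq> 0" for k
  proof -
    let ?e = "\<lambda>v::real. exp (- 2 * pi * \<i> * of_int k * of_real v)"
    have ne: "cmod (?e v) = 1" for v by (simp add: norm_exp_eq_Re)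
    have "((\<lambda>v. g (of_real v) * ?e v) has_vector_derivative
        deriv g (of_real v) * ?e v + (- 2 * pi * \<i> * of_int k) * (g (of_real v) * ?e v)) (at v within ?I)"
      if "v \<in> ?I" for v
    proof -
      have "(g has_field_derivative deriv g (of_real v)) (at (of_real v))"
        using holomorphic_derivI[OF g open_ball sub[OF that]] .
      then have "((\<lambda>z. g z * exp (- 2 * pi * \<i> * of_int k * z)) has_field_derivative
         deriv g (of_real v) * ?e v + (- 2 * pi * \<i> * of_int k) * (g (of_real v) * ?e v)) (at (of_real v))"
        by (auto intro!: derivative_eq_intros)
      from has_vector_derivative_real_field[OF this] show ?thesis by simp
    qed
    then have "((\<lambda>v. deriv g (of_real v) * ?e v + (- 2 * pi * \<i> * of_int k) * (g (of_real v) * ?e v))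
       has_integral (g (of_real (1 / 2)) * ?e (1 / 2) - g (of_real (- 1 / 2)) * ?e (- 1 / 2))) ?I"
      by (intro fundamental_theorem_of_calculus) auto
    moreover have "((\<lambda>v. deriv g (of_real v) * ?e v + (- 2 * pi * \<i> * of_int k) * (g (of_real v) * ?e v))
       has_integral (Fourier_coeff (deriv g) k + (- 2 * pi * \<i> * of_int k) * Fourier_coeff g k)) ?I"
      unfolding Fourier_coeff_def
      by (intro has_integral_add has_integral_mult_right integrable_integral
          Fourier_coeff_integrable[OF contg] Fourier_coeff_integrable[OF contdg])
    ultimately have "Fourier_coeff (deriv g) k + (- 2 * pi * \<i> * of_int k) * Fourier_coeff g k
        = g (of_real (1 / 2)) * ?e (1 / 2) - g (of_real (- 1 / 2)) * ?e (- 1 / 2)"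
      by (rule has_integral_unique[rotated])
    then have "2 * pi * \<i> * of_int k * Fourier_coeff g k
        = Fourier_coeff (deriv g) k - (g (of_real (1 / 2)) * ?e (1 / 2) - g (of_real (- 1 / 2)) * ?e (- 1 / 2))"
      by (simp add: algebra_simps)
    then have "cmod (2 * pi * \<i> * of_int k * Fourier_coeff g k)
        \<le> cmod (Fourier_coeff (deriv g) k) + (cmod (g (of_real (1 / 2)) * ?e (1 / 2)) + cmod (g (of_real (- 1 / 2)) * ?e (- 1 / 2)))"
      by (simp only:) (intro order_trans[OF norm_triangle_ineq4] add_left_mono norm_triangle_ineq4)
    also have "\<dots> \<le> B + (A + A)"
    proof (intro add_mono)
      have "cmod (Fourier_coeff (deriv g) k) \<le> B * (1 / 2 - (- 1 / 2))"
        unfolding Fourier_coeff_def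
        by (rule integral_bound)
           (use B ne in \<open>auto simp: norm_mult intro!: continuous_intros continuous_on_compose2[OF contdg]\<close>)
      then show "cmod (Fourier_coeff (deriv g) k) \<le> B" by simp
      show "cmod (g (of_real (1 / 2)) * ?e (1 / 2)) \<le> A" "cmod (g (of_real (- 1 / 2)) * ?e (- 1 / 2)) \<le> A"
        unfolding norm_mult ne mult_1_right by (intro A imageI; simp)+
    qed
    finally have "2 * pi * \<bar>of_int k\<bar> * cmod (Fourier_coeff g k) \<le> B + 2 * A"
      by (simp add: norm_mult)
    then show ?thesis using k by (simp add: field_simps)
  qed
  then show ?thesis by blast
qed

text \<open>The zeros of exp (2 pi i z) - 1 are the integers and the one at 0 is simple, so division
  by z leaves no zero in the unit disc.\<close>

lemma exp_2pi_i_minus_1_factor: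
  obtains E where "E holomorphic_on UNIV" "\<And>z. z \<in> ball 0 1 \<Longrightarrow> E z \<noteq> 0"
    "\<And>z. exp (2 * pi * \<i> * z) - 1 = z * E z"
proof -
  define f where "f = (\<lambda>z::complex. exp (2 * pi * \<i> * z))"
  define E where "E = (\<lambda>z. if z = 0 then deriv f 0 else (f z - f 0) / (z - 0))"
  have "f holomorphic_on UNIV" unfolding f_def by (intro holomorphic_intros)
  then have "E holomorphic_on UNIV" unfolding E_def by (intro pole_lemma_open) auto
  moreover have "deriv f 0 = 2 * pi * \<i>"
    unfolding f_def by (rule DERIV_imp_deriv) (auto intro!: derivative_eq_intros)
  moreover have "f z \<noteq> 1" if "z \<in> ball 0 1" "z \<noteq> 0" for z
  proof
    assume "f z = 1"
    then obtain n :: int where "Im z = 0" "2 * pi * Re z = of_int (2 * n) * pi"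
      unfolding f_def exp_eq_1 by auto
    then have z: "z = of_int n" by (auto simp: complex_eq_iff)
    have "\<bar>real_of_int n\<bar> < 1" using that(1) unfolding z by simp
    then have "n = 0" by linarith
    then show False using z that(2) by simp
  qed
  moreover have "f 0 = 1" by (simp add: f_def)
  ultimately show thesis using that[of E] by (auto simp: E_def f_def)
qed

text \<open>Chernoff's argument: writing \<open>f - f 0 = g \<cdot> (e - 1)\<close> with \<open>e z = exp (2 \<pi> \<i> z)\<close>, the Fourier
  coefficients of \<open>f - f 0\<close> are differences of consecutive coefficients of \<open>g\<close>.\<close>
lemma Fourier_series_at_0:
  assumes f: "f holomorphic_on UNIV"
  shows "(\<lambda>n. \<Sum>k\<in>{- int n..int n}. Fourier_coeff f k) \<longlonglongrightarrow> f 0"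
proof -
  let ?I = "{- 1 / 2..1 / 2 :: real}"
  obtain E where E: "E holomorphic_on UNIV" "\<And>z. z \<in> ball 0 1 \<Longrightarrow> E z \<noteq> 0"
    "\<And>z. exp (2 * pi * \<i> * z) - 1 = z * E z"
    using exp_2pi_i_minus_1_factor by blast
  define F where "F = (\<lambda>z. if z = 0 then deriv f 0 else (f z - f 0) / (z - 0))"
  have F: "F holomorphic_on UNIV" unfolding F_def by (intro pole_lemma_open f) auto
  define g where "g = (\<lambda>z. F z / E z)"
  have g: "g holomorphic_on ball 0 1"
    unfolding g_def by (intro holomorphic_intros holomorphic_on_subset[OF F] holomorphic_on_subset[OF E(1)]) (use E(2) in auto)
  have fg: "f z - f 0 = g z * (exp (2 * pi * \<i> * z) - 1)" if "z \<in> ball 0 1" for z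
  proof -
    have "f z - f 0 = z * F z" by (simp add: F_def)
    also have "\<dots> = g z * (z * E z)" using E(2)[OF that] by (simp add: g_def)
    finally show ?thesis by (simp only: E(3))
  qed
  have sub: "complex_of_real ` ?I \<subseteq> ball 0 1" by auto
  have contg: "continuous_on (complex_of_real ` ?I) g"
    using holomorphic_on_imp_continuous_on[OF holomorphic_on_subset[OF g sub]] .
  have const: "Fourier_coeff (\<lambda>_. f 0) k = (if k = 0 then f 0 else 0)" for k
  proof (cases "k = 0")
    case False
    let ?e = "\<lambda>v::complex. exp (- 2 * pi * \<i> * of_int k * v) / (- 2 * pi * \<i> * of_int k)"
    have "((\<lambda>v. ?e (of_real v)) has_vector_derivative exp (- 2 * pi * \<i> * of_int k * of_real v)) (at v within ?I)" for v
      by (rule has_vector_derivative_real_field) (use False in \<open>auto intro!: derivative_eq_intros\<close>)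
    then have "((\<lambda>v. exp (- 2 * pi * \<i> * of_int k * of_real v)) has_integral ?e (of_real (1 / 2)) - ?e (of_real (- 1 / 2))) ?I"
      by (intro fundamental_theorem_of_calculus) auto
    moreover have "?e (of_real (1 / 2)) = ?e (of_real (- 1 / 2))"
    proof -
      have "exp (- 2 * pi * \<i> * of_int k * of_real (- 1 / 2)) = exp (- 2 * pi * \<i> * of_int k * of_real (1 / 2) + of_int k * (2 * of_real pi * \<i>))"
        by (simp add: algebra_simps)
      also have "\<dots> = exp (- 2 * pi * \<i> * of_int k * of_real (1 / 2))"
        unfolding exp_add by (simp add: exp_eq_1)
      finally show ?thesis by simp
    qed
    ultimately have "((\<lambda>v. exp (- 2 * pi * \<i> * of_int k * of_real v)) has_integral 0) ?I"
      by (simp only: diff_self)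
    from integral_unique[OF has_integral_mult_right[OF this, of "f 0"]] show ?thesis
      using False unfolding Fourier_coeff_def by simp
  qed (simp add: Fourier_coeff_def)
  have step: "Fourier_coeff f k = (if k = 0 then f 0 else 0) + (Fourier_coeff g (k - 1) - Fourier_coeff g k)" for k
  proof -
    have "Fourier_coeff f k = integral ?I (\<lambda>v. f 0 * exp (- 2 * pi * \<i> * of_int k * of_real v) +
        (g (of_real v) * exp (- 2 * pi * \<i> * of_int (k - 1) * of_real v) - g (of_real v) * exp (- 2 * pi * \<i> * of_int k * of_real v)))"
      unfolding Fourier_coeff_def
    proof (rule integral_cong)
      fix v assume "v \<in> ?I"
      then have "of_real v \<in> ball (0::complex) 1" using sub by auto
      from fg[OF this] have "f (of_real v) = f 0 + g (of_real v) * (exp (2 * pi * \<i> * of_real v) - 1)" by (simp add: algebra_simps)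
      moreover have "exp (- 2 * pi * \<i> * of_int (k - 1) * of_real v) = exp (2 * pi * \<i> * of_real v) * exp (- 2 * pi * \<i> * of_int k * of_real v)"
        by (simp add: algebra_simps flip: exp_add)
      ultimately show "f (of_real v) * exp (- 2 * pi * \<i> * of_int k * of_real v) = f 0 * exp (- 2 * pi * \<i> * of_int k * of_real v) +
        (g (of_real v) * exp (- 2 * pi * \<i> * of_int (k - 1) * of_real v) - g (of_real v) * exp (- 2 * pi * \<i> * of_int k * of_real v))"
        by (simp only: ring_distribs mult_1_right mult_ac) simp
    qed
    also have "\<dots> = Fourier_coeff (\<lambda>_. f 0) k + (Fourier_coeff g (k - 1) - Fourier_coeff g k)"
      unfolding Fourier_coeff_def
      by (intro integral_unique has_integral_add has_integral_diff integrable_integral Fourier_coeff_integrable contg continuous_on_const)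
    finally show ?thesis by (simp add: const)
  qed
  \<comment> \<open>All inner coefficients of \<open>g\<close> cancel; those at -n - 1 and n remain
    and tend to 0.\<close>
  have telescope: "(\<Sum>k\<in>{- int n..int n}. Fourier_coeff f k) = f 0 + (Fourier_coeff g (- int n - 1) - Fourier_coeff g (int n))" for n
  proof (induction n)
    case 0
    then show ?case using step[of 0] by simp
  next
    case (Suc n)
    have "{- int (Suc n)..int (Suc n)} = insert (int n + 1) (insert (- int n - 1) {- int n..int n})" by auto
    then have "(\<Sum>k\<in>{- int (Suc n)..int (Suc n)}. Fourier_coeff f k)
      = Fourier_coeff f (int n + 1) + (Fourier_coeff f (- int n - 1) + (\<Sum>k\<in>{- int n..int n}. Fourier_coeff f k))"
      by simp
    then show ?case unfolding Suc.IH step[of "int n + 1"] step[of "- int n - 1"] by (simp add: algebra_simps)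
  qed
  obtain M where M: "\<And>k. k \<noteq> 0 \<Longrightarrow> cmod (Fourier_coeff g k) \<le> M / real_of_int \<bar>k\<bar>"
    using Fourier_coeff_decay[OF g] by blast
  have "(\<lambda>n. Fourier_coeff g (- int n - 1)) \<longlonglongrightarrow> 0"
  proof (rule Lim_null_comparison)
    show "\<forall>\<^sub>F n in sequentially. norm (Fourier_coeff g (- int n - 1)) \<le> M / real (Suc n)"
    proof (intro always_eventually allI)
      fix n
      have "real_of_int \<bar>- int n - 1\<bar> = real (Suc n)" by simp
      then show "norm (Fourier_coeff g (- int n - 1)) \<le> M / real (Suc n)"
        using M[of "- int n - 1"] by simp
    qed
    show "(\<lambda>n. M / real (Suc n)) \<longlonglongrightarrow> 0" by (rule LIMSEQ_Suc[OF lim_const_over_n])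
  qed
  moreover have "(\<lambda>n. Fourier_coeff g (int n)) \<longlonglongrightarrow> 0"
  proof (rule Lim_null_comparison)
    show "\<forall>\<^sub>F n in sequentially. norm (Fourier_coeff g (int n)) \<le> M / real n"
      using eventually_gt_at_top[of 0]
    proof eventually_elim
      case (elim n)
      then show ?case using M[of "int n"] by simp
    qed
  qed (rule lim_const_over_n)
  ultimately have "(\<lambda>n. f 0 + (Fourier_coeff g (- int n - 1) - Fourier_coeff g (int n))) \<longlonglongrightarrow> f 0 + (0 - 0)"
    by (intro tendsto_intros)
  then show ?thesis unfolding telescope by simp
qed

text \<open>Read off from the characteristic function of the standard normal law: y = c t with c^2 =
  2 pi x turns exp (- y^2 / 2) into exp (- pi x t^2), and \<open>s\<close> is the matching
  frequency.\<close>

lemma gaussian_Fourier_transform: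
  fixes x :: real and k :: int
  assumes x: "x > 0"
  shows "integrable lborel (\<lambda>t. exp (- of_real (pi * x * t\<^sup>2)) * exp (- 2 * pi * \<i> * of_int k * of_real t))"
    and "(\<integral>t. exp (- of_real (pi * x * t\<^sup>2)) * exp (- 2 * pi * \<i> * of_int k * of_real t) \<partial>lborel)
       = of_real (exp (- pi * (of_int k)\<^sup>2 / x) / sqrt x)"
proof -
  define c where "c = sqrt (2 * pi * x)"
  have c: "c > 0" "c\<^sup>2 = 2 * pi * x" using x by (auto simp: c_def)
  define s where "s = - 2 * pi * of_int k / c"
  define h where "h = (\<lambda>y. std_normal_density y *\<^sub>R iexp (s * y))"
  have hint: "integrable lborel h"
  proof (rule Bochner_Integration.integrable_bound[of _ std_normal_density])
    show "h \<in> borel_measurable lborel" unfolding h_def by measurable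
    show "AE y in lborel. norm (h y) \<le> norm (std_normal_density y)"
      by (simp add: h_def)
  qed simp
  have "char std_normal_distribution s = (\<integral>y. h y \<partial>lborel)"
    unfolding char_def h_def by (subst integral_density) auto
  then have hval: "(\<integral>y. h y \<partial>lborel) = of_real (exp (- s\<^sup>2 / 2))"
    by (simp add: char_std_normal_distribution)
  have eq: "h (0 + c * t) = of_real (1 / sqrt (2 * pi)) *
      (exp (- of_real (pi * x * t\<^sup>2)) * exp (- 2 * pi * \<i> * of_int k * of_real t))" for t
  proof -
    have "(c * t)\<^sup>2 / 2 = pi * x * t\<^sup>2" by (simp add: power_mult_distrib c(2))
    then have "std_normal_density (c * t) = 1 / sqrt (2 * pi) * exp (- (pi * x * t\<^sup>2))"
      by (simp add: std_normal_density_def)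
    moreover have "s * (c * t) = - 2 * pi * of_int k * t" using c by (simp add: s_def)
    moreover have "iexp (- 2 * pi * of_int k * t) = exp (- 2 * pi * \<i> * of_int k * of_real t)"
      by (rule arg_cong[of _ _ exp]) simp
    moreover have "complex_of_real (exp (- (pi * x * t\<^sup>2))) = exp (- of_real (pi * x * t\<^sup>2))"
      by (simp flip: exp_of_real)
    ultimately show ?thesis
      unfolding h_def by (simp only: scaleR_conv_of_real of_real_mult mult.assoc add_0)
  qed
  have c1: "complex_of_real (sqrt (2 * pi)) * of_real (1 / sqrt (2 * pi)) = 1"
    unfolding of_real_mult[symmetric] by simp
  have "integrable lborel (\<lambda>t. h (0 + c * t))"
    by (rule lborel_integrable_real_affine[OF hint]) (use c in auto)
  then show int: "integrable lborel (\<lambda>t. exp (- of_real (pi * x * t\<^sup>2)) * exp (- 2 * pi * \<i> * of_int k * of_real t))"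
  proof -
    assume "integrable lborel (\<lambda>t. h (0 + c * t))"
    from integrable_mult_right[OF this, of "of_real (sqrt (2 * pi))"]
    show ?thesis unfolding eq mult.assoc[symmetric] c1 by (simp only: mult_1_left)
  qed
  have "of_real (exp (- s\<^sup>2 / 2)) = \<bar>c\<bar> *\<^sub>R (\<integral>t. h (0 + c * t) \<partial>lborel)"
    unfolding hval[symmetric] by (rule lborel_integral_real_affine) (use c in auto)
  also have "\<dots> = of_real (c / sqrt (2 * pi)) * (\<integral>t. exp (- of_real (pi * x * t\<^sup>2)) * exp (- 2 * pi * \<i> * of_int k * of_real t) \<partial>lborel)"
    unfolding eq using c by (subst integral_mult_right_zero) (simp add: scaleR_conv_of_real)
  also have "c / sqrt (2 * pi) = sqrt x" by (simp add: c_def real_sqrt_mult)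
  finally have "(\<integral>t. exp (- of_real (pi * x * t\<^sup>2)) * exp (- 2 * pi * \<i> * of_int k * of_real t) \<partial>lborel)
      = of_real (exp (- s\<^sup>2 / 2)) / of_real (sqrt x)"
    using x by (simp add: field_simps)
  also have "- s\<^sup>2 / 2 = - pi * (of_int k)\<^sup>2 / x"
    unfolding s_def power_divide c(2) using x by (simp add: power2_eq_square field_simps)
  finally show "(\<integral>t. exp (- of_real (pi * x * t\<^sup>2)) * exp (- 2 * pi * \<i> * of_int k * of_real t) \<partial>lborel)
       = of_real (exp (- pi * (of_int k)\<^sup>2 / x) / sqrt x)" by simp
qed

text \<open>The translates by m with |m| <= n, paired as m and -m. The argument is complex because
  \<open>Fourier_series_at_0\<close> asks for an entire function.\<close>

definition periodized_gaussian :: "real \<Rightarrow> nat \<Rightarrow> complex \<Rightarrow> complex" where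
  "periodized_gaussian x n z = exp (- of_real (pi * x) * z\<^sup>2) +
     (\<Sum>i<n. exp (- of_real (pi * x) * (z + of_nat (Suc i))\<^sup>2) + exp (- of_real (pi * x) * (z - of_nat (Suc i))\<^sup>2))"

lemma periodized_gaussian_limit:
  assumes x: "x > 0"
  obtains f where "f holomorphic_on UNIV" "\<And>R. uniform_limit (cball 0 R) (periodized_gaussian x) f sequentially"
proof -
  define a where "a = (\<lambda>i z. exp (- complex_of_real (pi * x) * (z + of_nat (Suc i))\<^sup>2) + exp (- complex_of_real (pi * x) * (z - of_nat (Suc i))\<^sup>2))"
  define f where "f = (\<lambda>z. exp (- complex_of_real (pi * x) * z\<^sup>2) + (\<Sum>i. a i z))"
  have lim: "uniform_limit (cball 0 R) (periodized_gaussian x) f sequentially" for R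
  proof -
    \<comment> \<open>With |Re z|, |Im z| <= R and |r| = n, completing the square in n gives Im^2 -
      (Re + r)^2 <= R^2 + 2 n R - n^2 <= R^2 + (R + 1/2)^2 - n. This is linear in n, hence a
      geometric majorant.\<close>
    define A where "A = exp (pi * x * (R\<^sup>2 + (R + 1 / 2)\<^sup>2))"
    have single: "cmod (exp (- complex_of_real (pi * x) * (z + of_real r)\<^sup>2)) \<le> A * exp (- (pi * x)) ^ n"
      if z: "cmod z \<le> R" and r: "\<bar>r\<bar> = real n" for z r n
    proof -
      have "Im z ^ 2 \<le> R\<^sup>2" using z abs_Im_le_cmod[of z] by (simp add: abs_le_square_iff[symmetric])
      moreover have "- (2 * real n * R) \<le> 2 * (Re z * r)"
      proof -
        have "\<bar>Re z * r\<bar> \<le> R * real n"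
          unfolding abs_mult r using z abs_Re_le_cmod[of z] by (intro mult_right_mono) auto
        then show ?thesis by (simp add: abs_le_iff mult_ac)
      qed
      moreover have "r\<^sup>2 = (real n)\<^sup>2" using r by (metis power2_abs)
      moreover have "0 \<le> (real n - (R + 1 / 2))\<^sup>2" by simp
      moreover have "(real n - (R + 1 / 2))\<^sup>2 = (real n)\<^sup>2 - 2 * real n * R - real n + (R + 1 / 2)\<^sup>2" by algebra
      moreover have "(Re z + r)\<^sup>2 = (Re z)\<^sup>2 + 2 * (Re z * r) + r\<^sup>2" by algebra
      ultimately have "(Im z)\<^sup>2 - (Re z + r)\<^sup>2 \<le> R\<^sup>2 + (R + 1 / 2)\<^sup>2 - real n"
        using zero_le_power2[of "Re z"] by linarith
      then have "pi * x * ((Im z)\<^sup>2 - (Re z + r)\<^sup>2) \<le> pi * x * (R\<^sup>2 + (R + 1 / 2)\<^sup>2 - real n)"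
        using x by (intro mult_left_mono) auto
      then have "exp (pi * x * ((Im z)\<^sup>2 - (Re z + r)\<^sup>2)) \<le> exp (pi * x * (R\<^sup>2 + (R + 1 / 2)\<^sup>2) + real n * (- (pi * x)))"
        by (simp add: algebra_simps)
      also have "\<dots> = A * exp (- (pi * x)) ^ n" unfolding exp_add A_def exp_of_nat_mult ..
      also have "exp (pi * x * ((Im z)\<^sup>2 - (Re z + r)\<^sup>2)) = cmod (exp (- complex_of_real (pi * x) * (z + of_real r)\<^sup>2))"
        by (simp add: norm_exp_eq_Re Re_power2 algebra_simps)
      finally show ?thesis .
    qed
    have "uniform_limit (cball 0 R) (\<lambda>n z. \<Sum>i<n. a i z) (\<lambda>z. \<Sum>i. a i z) sequentially"
    proof (rule Weierstrass_m_test)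
      fix n z assume "z \<in> cball (0::complex) R"
      then have z: "cmod z \<le> R" by simp
      have "cmod (a n z) \<le> A * exp (- (pi * x)) ^ Suc n + A * exp (- (pi * x)) ^ Suc n"
        unfolding a_def using single[OF z, of "real (Suc n)" "Suc n"] single[OF z, of "- real (Suc n)" "Suc n"]
        by (intro order_trans[OF norm_triangle_ineq] add_mono)
           (simp_all only: abs_of_nat abs_minus_cancel of_real_of_nat_eq of_real_minus diff_conv_add_uminus)
      then show "cmod (a n z) \<le> 2 * A * exp (- (pi * x)) ^ Suc n" by simp
    next
      have "summable (\<lambda>n. exp (- (pi * x)) ^ n)" using x by (intro summable_geometric) simp
      then have "summable (\<lambda>n. exp (- (pi * x)) ^ Suc n)" by (subst summable_Suc_iff)
      then show "summable (\<lambda>n. 2 * A * exp (- (pi * x)) ^ Suc n)" by (rule summable_mult)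
    qed
    then show ?thesis
      unfolding f_def periodized_gaussian_def[abs_def] a_def by (intro uniform_limit_add uniform_limit_const)
  qed
  have "f holomorphic_on UNIV"
  proof (rule holomorphic_uniform_sequence[OF open_UNIV])
    show "periodized_gaussian x n holomorphic_on UNIV" for n
      unfolding periodized_gaussian_def[abs_def] by (intro holomorphic_intros)
    show "\<exists>d>0. cball z d \<subseteq> UNIV \<and> uniform_limit (cball z d) (periodized_gaussian x) f sequentially" for z
    proof (intro exI[of _ 1] conjI uniform_limit_on_subset[OF lim[of "cmod z + 1"]] subsetI)
      fix w assume "w \<in> cball z 1"
      then show "w \<in> cball 0 (cmod z + 1)"
        using norm_triangle_sub[of w z] by (simp add: dist_norm norm_minus_commute)
    qed auto
  qed
  then show thesis using lim that by blast
qed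

text \<open>The exponential has period 1, so the translates of [-1/2, 1/2] by |m| <= n unfold into a
  single interval of length 2 n + 1.\<close>

lemma Fourier_coeff_periodized_gaussian:
  assumes x: "x > 0"
  defines "h \<equiv> \<lambda>k t. exp (- of_real (pi * x * t\<^sup>2)) * exp (- 2 * pi * \<i> * of_int k * of_real t)"
  shows "Fourier_coeff (periodized_gaussian x n) k = integral {- real n - 1 / 2..real n + 1 / 2} (h k)"
proof -
  have cont: "continuous_on S (h k)" for S
    unfolding h_def by (intro continuous_intros)
  have int: "(h k) integrable_on {a..b}" for a b by (rule integrable_continuous_real[OF cont])
  have shift: "((\<lambda>v. exp (- of_real (pi * x) * (of_real v + of_int c)\<^sup>2) * exp (- 2 * pi * \<i> * of_int k * of_real v))
      has_integral integral {of_int c - 1 / 2..of_int c + 1 / 2} (h k)) {- 1 / 2..1 / 2}" for c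
  proof -
    have "(h k has_integral integral {of_int c - 1 / 2..of_int c + 1 / 2} (h k)) (cbox (of_int c - 1 / 2) (of_int c + 1 / 2))"
      unfolding cbox_interval by (rule integrable_integral[OF int])
    from has_integral_affinity[OF this, of 1 "of_int c"]
    have "((\<lambda>v. h k (v + of_int c)) has_integral integral {of_int c - 1 / 2..of_int c + 1 / 2} (h k)) {- 1 / 2..1 / 2}"
      by simp
    moreover have "h k (v + of_int c) = exp (- of_real (pi * x) * (of_real v + of_int c)\<^sup>2) * exp (- 2 * pi * \<i> * of_int k * of_real v)" for v
    proof -
      have "exp (- 2 * pi * \<i> * of_int k * of_real (v + of_int c))
          = exp (- 2 * pi * \<i> * of_int k * of_real v) * exp (2 * of_int (- (k * c)) * pi * \<i>)"
        by (simp add: algebra_simps flip: exp_add)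
      also have "exp (2 * of_int (- (k * c)) * pi * \<i>) = 1"
        by (subst exp_eq_1) (auto intro!: exI[of _ "- (k * c)"])
      finally show ?thesis by (simp add: h_def)
    qed
    ultimately show ?thesis by simp
  qed
  define e where "e = (\<lambda>v. exp (- 2 * pi * \<i> * of_int k * complex_of_real v))"
  define J where "J = (\<lambda>c. integral {real_of_int c - 1 / 2..real_of_int c + 1 / 2} (h k))"
  have shift': "((\<lambda>v. exp (- of_real (pi * x) * (of_real v + of_int c)\<^sup>2) * e v) has_integral J c) {- 1 / 2..1 / 2}" for c
    using shift[of c] by (simp add: e_def J_def)
  have "((\<lambda>v. periodized_gaussian x n (of_real v) * e v) has_integral integral {- real n - 1 / 2..real n + 1 / 2} (h k)) {- 1 / 2..1 / 2}"
  proof (induction n)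
    case 0
    show ?case using shift'[of 0] by (simp add: J_def periodized_gaussian_def)
  next
    case (Suc n)
    have step: "periodized_gaussian x (Suc n) (of_real v) * e v = periodized_gaussian x n (of_real v) * e v +
       (exp (- of_real (pi * x) * (of_real v + of_int (int (Suc n)))\<^sup>2) * e v
        + exp (- of_real (pi * x) * (of_real v + of_int (- int (Suc n)))\<^sup>2) * e v)" for v
      by (simp add: periodized_gaussian_def algebra_simps)
    have "integral {- real (Suc n) - 1 / 2..- real n - 1 / 2} (h k) = J (- int (Suc n))"
      "integral {real n + 1 / 2..real (Suc n) + 1 / 2} (h k) = J (int (Suc n))"
      unfolding J_def by (intro arg_cong2[of _ _ _ _ integral]; simp add: algebra_simps)+
    moreover have "integral {- real (Suc n) - 1 / 2..- real n - 1 / 2} (h k) + integral {- real n - 1 / 2..real n + 1 / 2} (h k)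
        = integral {- real (Suc n) - 1 / 2..real n + 1 / 2} (h k)"
      "integral {- real (Suc n) - 1 / 2..real n + 1 / 2} (h k) + integral {real n + 1 / 2..real (Suc n) + 1 / 2} (h k)
        = integral {- real (Suc n) - 1 / 2..real (Suc n) + 1 / 2} (h k)"
      by (intro Henstock_Kurzweil_Integration.integral_combine int; simp)+
    ultimately have "integral {- real (Suc n) - 1 / 2..real (Suc n) + 1 / 2} (h k)
        = integral {- real n - 1 / 2..real n + 1 / 2} (h k) + (J (int (Suc n)) + J (- int (Suc n)))"
      by (simp add: algebra_simps)
    then show ?case
      unfolding step by (simp only:) (intro has_integral_add Suc.IH shift')
  qed
  then show ?thesis unfolding Fourier_coeff_def e_def by (rule integral_unique)
qed

lemma integral_symmetric_limit:
  fixes h :: "real \<Rightarrow> complex"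
  assumes h: "integrable lborel h" and cont: "continuous_on UNIV h"
  shows "(\<lambda>n. integral {- real n - 1 / 2..real n + 1 / 2} h) \<longlonglongrightarrow> (\<integral>t. h t \<partial>lborel)"
proof -
  have eq: "integral {a..b} h = (\<integral>t. indicator {a..b} t *\<^sub>R h t \<partial>lborel)" for a b
  proof -
    have "set_integrable lborel {a..b} h"
      by (rule borel_integrable_compact[unfolded set_integrable_def[symmetric]]) (auto intro: continuous_on_subset[OF cont])
    from set_borel_integral_eq_integral(2)[OF this] show ?thesis by (simp add: set_lebesgue_integral_def)
  qed
  show ?thesis unfolding eq
  proof (rule integral_dominated_convergence[where w = "\<lambda>t. norm (h t)"])
    show "AE t in lborel. (\<lambda>n. indicator {- real n - 1 / 2..real n + 1 / 2} t *\<^sub>R h t) \<longlonglongrightarrow> h t"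
    proof (rule AE_I2, rule tendsto_eventually)
      fix t :: real
      obtain N where N: "\<bar>t\<bar> \<le> real N" using real_arch_simple by blast
      show "\<forall>\<^sub>F n in sequentially. indicator {- real n - 1 / 2..real n + 1 / 2} t *\<^sub>R h t = h t"
        using eventually_ge_at_top[of N] by eventually_elim (use N in \<open>auto simp: indicator_def\<close>)
    qed
    show "AE t in lborel. norm (indicator {- real n - 1 / 2..real n + 1 / 2} t *\<^sub>R h t) \<le> norm (h t)" for n
      by (auto simp: indicator_def)
  qed (use h in auto)
qed

text \<open>Poisson summation for the Gaussian: the periodization at 0 is the theta series at x, and
  the sum of its Fourier coefficients is the one at 1/x divided by sqrt x.\<close>

theorem theta_transformation:
  fixes x :: real
  assumes x: "x > 0"
  defines "\<omega> \<equiv> \<lambda>x. \<Sum>n. exp (- pi * (real (Suc n))\<^sup>2 * x)"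
  shows "1 + 2 * \<omega> x = (1 + 2 * \<omega> (1 / x)) / sqrt x"
proof -
  have om: "(\<lambda>n. \<Sum>i<n. exp (- pi * (real (Suc i))\<^sup>2 * y)) \<longlonglongrightarrow> \<omega> y" if y: "y > 0" for y
  proof -
    have "summable (\<lambda>n. exp (- pi * (real (Suc n))\<^sup>2 * y))"
    proof (rule summable_comparison_test')
      have "summable (\<lambda>n. exp (- (pi * y)) ^ n)" using y by (intro summable_geometric) simp
      then show "summable (\<lambda>n. exp (- (pi * y)) ^ Suc n)" by (subst summable_Suc_iff)
      fix n
      have "real (Suc n) \<le> (real (Suc n))\<^sup>2" by (rule self_le_power) auto
      then have "real (Suc n) * (pi * y) \<le> (real (Suc n))\<^sup>2 * (pi * y)" using y by (intro mult_right_mono) auto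
      then show "norm (exp (- pi * (real (Suc n))\<^sup>2 * y)) \<le> exp (- (pi * y)) ^ Suc n"
        unfolding exp_of_nat_mult[symmetric] by (simp add: mult_ac)
    qed
    then show ?thesis unfolding \<omega>_def using summable_LIMSEQ by blast
  qed
  define h where "h = (\<lambda>k t. exp (- of_real (pi * x * t\<^sup>2)) * exp (- 2 * pi * \<i> * of_int k * complex_of_real t))"
  obtain f where f: "f holomorphic_on UNIV" "\<And>R. uniform_limit (cball 0 R) (periodized_gaussian x) f sequentially"
    using periodized_gaussian_limit[OF x] by blast
  \<comment> \<open>Uniform convergence carries the coefficients of the partial sums over to
    \<open>f\<close>; unfolded, they are integrals over growing intervals.\<close>
  have coeff: "Fourier_coeff f k = of_real (exp (- pi * (of_int k)\<^sup>2 / x) / sqrt x)" for k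
  proof (rule LIMSEQ_unique)
    define e where "e = (\<lambda>v. exp (- 2 * pi * \<i> * of_int k * complex_of_real v))"
    let ?I = "{- 1 / 2..1 / 2 :: real}"
    have ne: "cmod (e v) = 1" for v by (simp add: e_def norm_exp_eq_Re)
    have "uniform_limit ?I (\<lambda>n v. periodized_gaussian x n (of_real v) * e v) (\<lambda>v. f (of_real v) * e v) sequentially"
    proof (rule uniform_limitI)
      fix \<epsilon> :: real assume "\<epsilon> > 0"
      from uniform_limitD[OF f(2)[of 1] this]
      show "\<forall>\<^sub>F n in sequentially. \<forall>v\<in>?I. dist (periodized_gaussian x n (of_real v) * e v) (f (of_real v) * e v) < \<epsilon>"
      proof eventually_elim
        case (elim n)
        show ?case
        proof
          fix v assume "v \<in> ?I"
          then have "complex_of_real v \<in> cball 0 1" by auto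
          then have "dist (periodized_gaussian x n (of_real v)) (f (of_real v)) < \<epsilon>" using elim by blast
          then show "dist (periodized_gaussian x n (of_real v) * e v) (f (of_real v) * e v) < \<epsilon>"
            by (simp add: dist_norm left_diff_distrib[symmetric] norm_mult ne)
        qed
      qed
    qed
    then obtain I J where IJ: "\<And>n. ((\<lambda>v. periodized_gaussian x n (of_real v) * e v) has_integral I n) ?I"
      "((\<lambda>v. f (of_real v) * e v) has_integral J) ?I" "I \<longlonglongrightarrow> J"
      by (rule uniform_limit_integral)
         (auto simp: periodized_gaussian_def e_def intro!: continuous_intros)
    have J: "J = Fourier_coeff f k" and I: "I n = Fourier_coeff (periodized_gaussian x n) k" for n
      using integral_unique[OF IJ(1)] integral_unique[OF IJ(2)] unfolding Fourier_coeff_def e_def by simp_all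
    show "(\<lambda>n. Fourier_coeff (periodized_gaussian x n) k) \<longlonglongrightarrow> Fourier_coeff f k"
      using IJ(3) unfolding J I[symmetric] .
    have "(\<lambda>n. integral {- real n - 1 / 2..real n + 1 / 2} (h k)) \<longlonglongrightarrow> (\<integral>t. h k t \<partial>lborel)"
      by (rule integral_symmetric_limit)
         (use gaussian_Fourier_transform(1)[OF x, of k] in \<open>auto simp: h_def intro!: continuous_intros\<close>)
    then show "(\<lambda>n. Fourier_coeff (periodized_gaussian x n) k) \<longlonglongrightarrow> of_real (exp (- pi * (of_int k)\<^sup>2 / x) / sqrt x)"
      using gaussian_Fourier_transform(2)[OF x, of k] Fourier_coeff_periodized_gaussian[OF x]
      unfolding h_def by simp
  qed
  have f0: "f 0 = of_real (1 + 2 * \<omega> x)"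
  proof (rule LIMSEQ_unique)
    show "(\<lambda>n. periodized_gaussian x n 0) \<longlonglongrightarrow> f 0"
      by (rule tendsto_uniform_limitI[OF f(2)[of 1]]) simp
    have pg: "periodized_gaussian x n 0 = of_real (1 + 2 * (\<Sum>i<n. exp (- pi * (real (Suc i))\<^sup>2 * x)))" for n
    proof -
      have "(- 1 - z)\<^sup>2 = (1 + z)\<^sup>2" for z :: complex by algebra
      then show ?thesis
        by (simp add: periodized_gaussian_def sum_distrib_left mult_ac flip: exp_of_real)
    qed
    show "(\<lambda>n. periodized_gaussian x n 0) \<longlonglongrightarrow> of_real (1 + 2 * \<omega> x)"
      unfolding pg by (intro tendsto_intros om x)
  qed
  have "(\<Sum>k\<in>{- int n..int n}. Fourier_coeff f k) = of_real ((1 + 2 * (\<Sum>i<n. exp (- pi * (real (Suc i))\<^sup>2 * (1 / x)))) / sqrt x)" for n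
  proof (induction n)
    case (Suc n)
    have "{- int (Suc n)..int (Suc n)} = insert (int n + 1) (insert (- int n - 1) {- int n..int n})" by auto
    then have "(\<Sum>k\<in>{- int (Suc n)..int (Suc n)}. Fourier_coeff f k)
      = Fourier_coeff f (int n + 1) + (Fourier_coeff f (- int n - 1) + (\<Sum>k\<in>{- int n..int n}. Fourier_coeff f k))"
      by simp
    moreover have "Fourier_coeff f (int n + 1) = of_real (exp (- pi * (real (Suc n))\<^sup>2 * (1 / x)) / sqrt x)"
      by (simp add: coeff add.commute)
    moreover have "(- 1 - real n)\<^sup>2 = (1 + real n)\<^sup>2" "(- real n - 1)\<^sup>2 = (1 + real n)\<^sup>2"
      by algebra+
    then have "Fourier_coeff f (- int n - 1) = of_real (exp (- pi * (real (Suc n))\<^sup>2 * (1 / x)) / sqrt x)"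
      by (simp add: coeff)
    ultimately show ?case
      by (simp only: Suc.IH of_real_add[symmetric] of_real_eq_iff) (simp add: add_divide_distrib)
  qed (simp add: coeff)
  with Fourier_series_at_0[OF f(1)]
  have "(\<lambda>n. complex_of_real ((1 + 2 * (\<Sum>i<n. exp (- pi * (real (Suc i))\<^sup>2 * (1 / x)))) / sqrt x)) \<longlonglongrightarrow> f 0" by simp
  moreover have "(\<lambda>n. complex_of_real ((1 + 2 * (\<Sum>i<n. exp (- pi * (real (Suc i))\<^sup>2 * (1 / x)))) / sqrt x))
      \<longlonglongrightarrow> of_real ((1 + 2 * \<omega> (1 / x)) / sqrt x)"
    using om[of "1 / x"] x by (intro tendsto_intros) auto
  ultimately have "of_real ((1 + 2 * \<omega> (1 / x)) / sqrt x) = complex_of_real (1 + 2 * \<omega> x)"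
    unfolding f0 by (rule LIMSEQ_unique[rotated])
  then show ?thesis unfolding of_real_eq_iff by simp
qed

section \<open>The kernel Phi\<close>

definition Phi_term :: "nat \<Rightarrow> real \<Rightarrow> real" where
  "Phi_term n u = (2 * pi\<^sup>2 * real (Suc n) ^ 4 * exp (9 * u) - 3 * pi * (real (Suc n))\<^sup>2 * exp (5 * u))
       * exp (- pi * (real (Suc n))\<^sup>2 * exp (4 * u))"

lemma Phi_eq_suminf: "Phi u = (\<Sum>n. Phi_term n u)"
  by (simp add: Phi_def Phi_term_def Let_def)

text \<open>The common exponent of the series below: their terms are exp u times a polynomial in it
  times its negative exponential, and its derivative is 4 times itself.\<close>

definition gauss_exponent :: "nat \<Rightarrow> real \<Rightarrow> real" where
  "gauss_exponent n u = pi * (real (Suc n))\<^sup>2 * exp (4 * u)"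

lemma gauss_exponent_pos: "gauss_exponent n u > 0"
  by (simp add: gauss_exponent_def)

lemma Phi_term_eq:
  "Phi_term n u = exp u * (2 * (gauss_exponent n u)\<^sup>2 - 3 * gauss_exponent n u) * exp (- gauss_exponent n u)"
proof -
  have "exp (9 * u) = exp u * exp (4 * u) * exp (4 * u)" "exp (5 * u) = exp u * exp (4 * u)"
    by (simp_all flip: exp_add)
  moreover have "real (Suc n) ^ 4 = (real (Suc n))\<^sup>2 * (real (Suc n))\<^sup>2" by (simp flip: power_add)
  ultimately show ?thesis
    by (simp add: Phi_term_def gauss_exponent_def power2_eq_square algebra_simps)
qed

section \<open>Convergence, positivity and decay of the series for Phi\<close>

lemma gauss_exponent_ge: "gauss_exponent n u \<ge> 2 * (real (Suc n) * exp (4 * u))"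
proof -
  have "2 * real (Suc n) \<le> pi * (real (Suc n))\<^sup>2"
    using pi_ge_two self_le_power[of "real (Suc n)" 2] by (intro mult_mono) auto
  then show ?thesis
    unfolding gauss_exponent_def using mult_right_mono[of _ _ "exp (4 * u)"] by (fastforce simp: mult_ac)
qed

text \<open>1 + 24 a + 16 a^2 dominates every polynomial factor that occurs in these series. The 128
  comes from 16 a^2 = 128 (a/2)^2 / 2, the quadratic Taylor term of 128 exp (a/2).\<close>

lemma quadratic_exp_bound:
  fixes a :: real assumes "a \<ge> 0"
  shows "(1 + 24 * a + 16 * a\<^sup>2) * exp (- a) \<le> 128 * exp (- (a / 2))"
proof -
  have "1 + 24 * a + 16 * a\<^sup>2 \<le> 128 * exp (a / 2)"
    using exp_lower_Taylor_quadratic[of "a / 2"] assms by (simp add: power_divide)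
  then have "(1 + 24 * a + 16 * a\<^sup>2) * exp (- a) \<le> 128 * exp (a / 2) * exp (- a)"
    by (intro mult_right_mono) auto
  also have "\<dots> = 128 * exp (- (a / 2))" by (simp flip: exp_add)
  finally show ?thesis .
qed

lemma exp_minus_half_exponent_le:
  "exp (- (gauss_exponent n u / 2)) \<le> exp (- exp (4 * u)) ^ Suc n"
  using gauss_exponent_ge[of n u] unfolding exp_of_nat_mult[symmetric] by simp

lemma summable_exp_minus_power: "c > 0 \<Longrightarrow> summable (\<lambda>n. exp (- c) ^ Suc n)" for c :: real
  by (subst summable_Suc_iff) (rule summable_geometric, simp)

lemma summable_exponent_term:
  assumes "\<And>n. \<bar>f n\<bar> \<le> C * ((1 + 24 * gauss_exponent n u + 16 * (gauss_exponent n u)\<^sup>2) * exp (- gauss_exponent n u))"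
    and "C \<ge> 0"
  shows "summable f"
proof (rule summable_comparison_test'[OF summable_mult[OF summable_exp_minus_power[of "exp (4 * u)"], of "C * 128"]])
  fix n
  have "\<bar>f n\<bar> \<le> C * (128 * exp (- (gauss_exponent n u / 2)))"
    using assms(1)[of n] mult_left_mono[OF quadratic_exp_bound[of "gauss_exponent n u"] \<open>C \<ge> 0\<close>] gauss_exponent_pos[of n u]
    by (meson less_imp_le order_trans)
  also have "\<dots> \<le> C * (128 * exp (- exp (4 * u)) ^ Suc n)"
    using exp_minus_half_exponent_le \<open>C \<ge> 0\<close> by (intro mult_left_mono) auto
  finally show "norm (f n) \<le> C * 128 * exp (- exp (4 * u)) ^ Suc n" by simp
qed simp

lemma summable_abs_Phi_term: "summable (\<lambda>n. \<bar>Phi_term n u\<bar>)"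
proof (rule summable_exponent_term[where C = "exp u" and u = u])
  fix n
  let ?a = "gauss_exponent n u"
  have "\<bar>2 * ?a\<^sup>2 - 3 * ?a\<bar> \<le> 1 + 24 * ?a + 16 * ?a\<^sup>2"
    using gauss_exponent_pos[of n u] zero_le_power2[of ?a] by (simp add: abs_le_iff)
  then show "\<bar>\<bar>Phi_term n u\<bar>\<bar> \<le> exp u * ((1 + 24 * ?a + 16 * ?a\<^sup>2) * exp (- ?a))"
    unfolding Phi_term_eq abs_mult by (simp add: mult_ac mult_left_mono)
qed simp

lemma summable_Phi_term: "summable (\<lambda>n. Phi_term n u)"
  using summable_abs_Phi_term by (rule summable_rabs_cancel)

text \<open>For u >= 0 the exponent is at least 2, beyond the zero 3/2 of 2 a^2 - 3 a.\<close>

lemma Phi_term_pos: "Phi_term n u > 0" if "u \<ge> 0"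
proof -
  let ?a = "gauss_exponent n u"
  have "real (Suc n) * exp (4 * u) \<ge> 1 * 1" using that by (intro mult_mono) auto
  then have "?a \<ge> 2" using gauss_exponent_ge[of n u] by linarith
  then have "?a * (2 * ?a - 3) > 0" by (intro mult_pos_pos) auto
  then have "2 * ?a\<^sup>2 - 3 * ?a > 0" by (simp add: power2_eq_square algebra_simps)
  then show ?thesis unfolding Phi_term_eq by (intro mult_pos_pos) auto
qed

lemma Phi_pos: "Phi u > 0" if "u \<ge> 0"
  unfolding Phi_eq_suminf using summable_Phi_term Phi_term_pos[OF that] by (rule suminf_pos)

lemma Phi_measurable [measurable]: "Phi \<in> borel_measurable borel"
  unfolding Phi_eq_suminf[abs_def] Phi_term_def
  by (intro borel_measurable_suminf borel_measurable_continuous_onI continuous_intros)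

text \<open>A geometric majorant with ratio q <= exp (-1) <= 1/2, whose sum is at most twice its
  first term: hence 256 = 2 * 128.\<close>

lemma Phi_le: "Phi u \<le> 256 * exp u * exp (- exp (4 * u))" if u: "u \<ge> 0"
proof -
  define q where "q = exp (- exp (4 * u))"
  have "exp (4 * u) \<ge> 1" using u by simp
  then have "q \<le> exp (- 1)" unfolding q_def by simp
  also have "exp (- 1) \<le> (1 / 2 :: real)"
    using exp_ge_add_one_self[of 1] by (simp add: exp_minus field_simps)
  finally have q: "0 < q" "q \<le> 1 / 2" by (auto simp: q_def)
  have geo: "(\<lambda>n. 128 * exp u * q ^ Suc n) sums (128 * exp u * (1 / (1 - q) * q))"
    unfolding power_Suc2 using q by (intro sums_mult sums_mult2 geometric_sums) simp
  have "Phi u \<le> (\<Sum>n. 128 * exp u * q ^ Suc n)"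
    unfolding Phi_eq_suminf
  proof (rule suminf_le[OF _ summable_Phi_term sums_summable[OF geo]])
    fix n
    let ?a = "gauss_exponent n u"
    have "2 * ?a\<^sup>2 - 3 * ?a \<le> 1 + 24 * ?a + 16 * ?a\<^sup>2"
      using gauss_exponent_pos[of n u] zero_le_power2[of ?a] by linarith
    then have "(2 * ?a\<^sup>2 - 3 * ?a) * exp (- ?a) \<le> 128 * exp (- (?a / 2))"
      using quadratic_exp_bound[of ?a] gauss_exponent_pos[of n u]
      by (meson exp_ge_zero less_imp_le mult_right_mono order_trans)
    also have "\<dots> \<le> 128 * q ^ Suc n" using exp_minus_half_exponent_le[of n u] unfolding q_def by simp
    finally have "exp u * ((2 * ?a\<^sup>2 - 3 * ?a) * exp (- ?a)) \<le> exp u * (128 * q ^ Suc n)"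
      by (rule mult_left_mono) simp
    then show "Phi_term n u \<le> 128 * exp u * q ^ Suc n" unfolding Phi_term_eq by (simp add: mult_ac)
  qed
  also have "\<dots> = 128 * exp u * (1 / (1 - q) * q)" using geo by (rule sums_unique[symmetric])
  also have "\<dots> \<le> 128 * exp u * (2 * q)"
    using q by (intro mult_left_mono mult_right_mono) (auto simp: field_simps)
  finally show ?thesis by (simp add: q_def)
qed

lemma rapidly_decaying_Phi: "rapidly_decaying Phi"
  unfolding rapidly_decaying_def
proof (intro conjI allI impI)
  fix a :: real
  \<comment> \<open>The decay is doubly exponential, so even after multiplication by exp (a u^3) the
    bound of \<open>Phi_le\<close> stays bounded.\<close>
  define h where "h = (\<lambda>u::real. exp (u - exp (4 * u) + a * u ^ 3))"
  have "(h \<longlongrightarrow> 0) at_top" unfolding h_def by real_asymp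
  then have "eventually (\<lambda>u. h u < 1) at_top" by (rule order_tendstoD) simp
  then obtain U where U: "\<And>u. u \<ge> U \<Longrightarrow> h u < 1" by (auto simp: eventually_at_top_linorder)
  have "compact (h ` {0..\<bar>U\<bar>})"
    unfolding h_def by (intro compact_continuous_image continuous_intros) auto
  then obtain B where B: "\<And>u. u \<in> {0..\<bar>U\<bar>} \<Longrightarrow> \<bar>h u\<bar> \<le> B"
    using compact_imp_bounded by (fastforce simp: bounded_iff)
  show "\<exists>C. \<forall>u\<ge>0. Phi u \<le> C * exp (- a * u ^ 3)"
  proof (intro exI[of _ "256 * max 1 B"] allI impI)
    fix u :: real assume u: "0 \<le> u"
    have hu: "h u \<le> max 1 B"
    proof (cases "u \<le> \<bar>U\<bar>")
      case True
      then show ?thesis using B[of u] u by auto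
    next
      case False
      then have "h u < 1" using U[of u] by linarith
      then show ?thesis by (simp add: le_max_iff_disj)
    qed
    have "exp u * exp (- exp (4 * u)) = h u * exp (- a * u ^ 3)"
      by (simp add: h_def flip: exp_add)
    then have "Phi u \<le> 256 * (h u * exp (- a * u ^ 3))"
      using Phi_le[OF u] by (simp add: mult.assoc)
    also have "\<dots> \<le> 256 * (max 1 B * exp (- a * u ^ 3))"
      by (intro mult_left_mono mult_right_mono hu) auto
    finally show "Phi u \<le> 256 * max 1 B * exp (- a * u ^ 3)" by simp
  qed
qed (auto simp: Phi_pos)

text \<open>Since \<open>\<Phi> = (\<Psi>'' - \<Psi>) / 16\<close> for \<open>\<Psi> u = exp u * \<theta> (exp (4 * u))\<close>, evenness of \<open>\<Phi>\<close>
  comes from the theta transformation formula, which says that \<open>\<Psi>\<close> is even.\<close>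
definition theta_term :: "nat \<Rightarrow> real \<Rightarrow> real" where
  "theta_term n u = exp u * exp (- gauss_exponent n u)"

definition theta_term' :: "nat \<Rightarrow> real \<Rightarrow> real" where
  "theta_term' n u = exp u * (1 - 4 * gauss_exponent n u) * exp (- gauss_exponent n u)"

definition theta_term'' :: "nat \<Rightarrow> real \<Rightarrow> real" where
  "theta_term'' n u = exp u * (1 - 24 * gauss_exponent n u + 16 * (gauss_exponent n u)\<^sup>2) * exp (- gauss_exponent n u)"

lemma gauss_exponent_deriv:
  "(gauss_exponent n has_real_derivative 4 * gauss_exponent n u) (at u within A)"
  unfolding gauss_exponent_def[abs_def] by (auto intro!: derivative_eq_intros)

lemma theta_term_deriv: "(theta_term n has_real_derivative theta_term' n u) (at u within A)"
  unfolding theta_term_def[abs_def] theta_term'_def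
  by (rule derivative_eq_intros gauss_exponent_deriv refl)+ (simp add: algebra_simps)

lemma theta_term'_deriv: "(theta_term' n has_real_derivative theta_term'' n u) (at u within A)"
  unfolding theta_term'_def[abs_def] theta_term''_def
  by (rule derivative_eq_intros gauss_exponent_deriv refl)+ (simp add: algebra_simps power2_eq_square)

lemma theta_term_bounds:
  "\<bar>theta_term n u\<bar> \<le> exp u * ((1 + 24 * gauss_exponent n u + 16 * (gauss_exponent n u)\<^sup>2) * exp (- gauss_exponent n u))"
  "\<bar>theta_term' n u\<bar> \<le> exp u * ((1 + 24 * gauss_exponent n u + 16 * (gauss_exponent n u)\<^sup>2) * exp (- gauss_exponent n u))"
  "\<bar>theta_term'' n u\<bar> \<le> exp u * ((1 + 24 * gauss_exponent n u + 16 * (gauss_exponent n u)\<^sup>2) * exp (- gauss_exponent n u))"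
proof -
  let ?a = "gauss_exponent n u"
  have a: "?a > 0" "?a\<^sup>2 \<ge> 0" using gauss_exponent_pos[of n u] by auto
  have *: "\<bar>exp u * c * exp (- ?a)\<bar> \<le> exp u * ((1 + 24 * ?a + 16 * ?a\<^sup>2) * exp (- ?a))"
    if "\<bar>c\<bar> \<le> 1 + 24 * ?a + 16 * ?a\<^sup>2" for c
    unfolding abs_mult using that by (simp add: mult_ac mult_left_mono)
  show "\<bar>theta_term n u\<bar> \<le> exp u * ((1 + 24 * ?a + 16 * ?a\<^sup>2) * exp (- ?a))"
    using *[of 1] a by (simp add: theta_term_def)
  show "\<bar>theta_term' n u\<bar> \<le> exp u * ((1 + 24 * ?a + 16 * ?a\<^sup>2) * exp (- ?a))"
    unfolding theta_term'_def by (rule *) (use a in \<open>simp add: abs_le_iff\<close>)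
  show "\<bar>theta_term'' n u\<bar> \<le> exp u * ((1 + 24 * ?a + 16 * ?a\<^sup>2) * exp (- ?a))"
    unfolding theta_term''_def by (rule *) (use a in \<open>simp add: abs_le_iff\<close>)
qed

lemma theta_terms_summable:
  "summable (\<lambda>n. theta_term n u)" "summable (\<lambda>n. theta_term' n u)" "summable (\<lambda>n. theta_term'' n u)"
  by (rule summable_exponent_term[of _ "exp u"], rule theta_term_bounds, simp)+

lemma uniformly_convergent_theta_terms:
  assumes "\<And>n u. \<bar>f n u\<bar> \<le> exp u * ((1 + 24 * gauss_exponent n u + 16 * (gauss_exponent n u)\<^sup>2) * exp (- gauss_exponent n u))"
  shows "uniformly_convergent_on (ball (0::real) R) (\<lambda>n u. \<Sum>i<n. f i u)"
proof (rule Weierstrass_m_test')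
  fix n and u :: real assume "u \<in> ball 0 R"
  then have u: "- R \<le> u" "u \<le> R" by auto
  have "\<bar>f n u\<bar> \<le> exp u * (128 * exp (- (gauss_exponent n u / 2)))"
    using assms[of n u] mult_left_mono[OF quadratic_exp_bound[of "gauss_exponent n u"], of "exp u"] gauss_exponent_pos[of n u]
    by (meson exp_ge_zero less_imp_le order_trans)
  \<comment> \<open>The left end -R of the ball has the slowest decay in n.\<close>
  also have "\<dots> \<le> exp R * (128 * exp (- exp (4 * (- R))) ^ Suc n)"
  proof (intro mult_mono)
    have "exp (- exp (4 * u)) ^ Suc n \<le> exp (- exp (4 * (- R))) ^ Suc n"
      using u by (intro power_mono) auto
    then show "exp (- (gauss_exponent n u / 2)) \<le> exp (- exp (4 * (- R))) ^ Suc n"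
      using exp_minus_half_exponent_le[of n u] by linarith
  qed (use u in auto)
  finally show "norm (f n u) \<le> exp R * 128 * exp (- exp (4 * (- R))) ^ Suc n" by simp
next
  show "summable (\<lambda>n. exp R * 128 * exp (- exp (4 * (- R))) ^ Suc n)"
    by (intro summable_mult summable_exp_minus_power) simp
qed

lemma theta_series_deriv:
  "((\<lambda>u. \<Sum>n. theta_term n u) has_real_derivative (\<Sum>n. theta_term' n u)) (at u)"
  by (rule has_field_derivative_series'(2)[where S = "ball 0 (\<bar>u\<bar> + 1)" and ?x0.0 = u])
     (auto intro!: theta_term_deriv uniformly_convergent_theta_terms theta_term_bounds theta_terms_summable)

lemma theta_series'_deriv:
  "((\<lambda>u. \<Sum>n. theta_term' n u) has_real_derivative (\<Sum>n. theta_term'' n u)) (at u)"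
  by (rule has_field_derivative_series'(2)[where S = "ball 0 (\<bar>u\<bar> + 1)" and ?x0.0 = u])
     (auto intro!: theta_term'_deriv uniformly_convergent_theta_terms theta_term_bounds theta_terms_summable)

lemma Phi_even: "Phi (- u) = Phi u"
proof -
  define \<Psi> where "\<Psi> = (\<lambda>u. exp u + 2 * (\<Sum>n. theta_term n u))"
  define \<Psi>' where "\<Psi>' = (\<lambda>u. exp u + 2 * (\<Sum>n. theta_term' n u))"
  define \<Psi>'' where "\<Psi>'' = (\<lambda>u. exp u + 2 * (\<Sum>n. theta_term'' n u))"
  have d1: "(\<Psi> has_real_derivative \<Psi>' u) (at u)" for u
    unfolding \<Psi>_def \<Psi>'_def by (rule derivative_eq_intros theta_series_deriv refl)+ simp
  have d2: "(\<Psi>' has_real_derivative \<Psi>'' u) (at u)" for u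
    unfolding \<Psi>'_def \<Psi>''_def by (rule derivative_eq_intros theta_series'_deriv refl)+ simp
  have even: "\<Psi> (- u) = \<Psi> u" for u
  proof -
    define \<omega> where "\<omega> = (\<lambda>x. \<Sum>n. exp (- pi * (real (Suc n))\<^sup>2 * x))"
    have \<Psi>: "\<Psi> u = exp u * (1 + 2 * \<omega> (exp (4 * u)))" for u
    proof -
      have "(\<Sum>n. theta_term n u) = exp u * (\<Sum>n. exp (- gauss_exponent n u))"
        unfolding theta_term_def
        by (rule suminf_mult) (rule summable_exponent_term[where C = 1 and u = u], use gauss_exponent_pos[of _ u] in \<open>simp_all add: less_imp_le\<close>)
      then show ?thesis by (simp add: \<Psi>_def \<omega>_def gauss_exponent_def algebra_simps)
    qed
    \<comment> \<open>At x = exp (4 u) the transformation formula produces the factor exp (- 2 u),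
      which turns exp u into exp (- u).\<close>
    have "sqrt (exp (4 * u)) = exp (2 * u)" by (rule real_sqrt_unique) (auto simp flip: exp_double)
    moreover have "1 / exp (4 * u) = exp (4 * (- u))" by (simp add: exp_minus inverse_eq_divide)
    ultimately have "1 + 2 * \<omega> (exp (4 * u)) = (1 + 2 * \<omega> (exp (4 * (- u)))) / exp (2 * u)"
      using theta_transformation[of "exp (4 * u)"] unfolding \<omega>_def by simp
    moreover have "exp u / exp (2 * u) = exp (- u)" by (simp flip: exp_diff)
    ultimately show ?thesis unfolding \<Psi> by (metis times_divide_eq_left times_divide_eq_right)
  qed
  have odd: "\<Psi>' (- u) = - \<Psi>' u" for u
  proof -
    have "((\<lambda>u. \<Psi> (- u)) has_real_derivative - \<Psi>' (- u)) (at u)"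
      using d1[of "- u"] by (simp only: DERIV_mirror)
    then have "- \<Psi>' (- u) = \<Psi>' u" unfolding even by (rule DERIV_unique[OF _ d1])
    then show ?thesis by simp
  qed
  have "\<Psi>'' (- u) = \<Psi>'' u"
  proof -
    have "((\<lambda>u. - \<Psi>' (- u)) has_real_derivative \<Psi>'' (- u)) (at u)"
      using DERIV_minus[OF iffD1[OF DERIV_mirror d2[of "- u"]]] by (simp only: minus_minus)
    then show ?thesis unfolding odd minus_minus by (rule DERIV_unique[OF _ d2])
  qed
  \<comment> \<open>16 a^2 - 24 a is 8 (2 a^2 - 3 a); the summand exp u cancels in the difference,
    and the factor 2 in \<Psi> turns 8 into 16.\<close>
  moreover have P: "Phi u = (\<Psi>'' u - \<Psi> u) / 16" for u
  proof -
    have "Phi_term n u = (theta_term'' n u - theta_term n u) / 8" for n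
      by (simp add: Phi_term_eq theta_term''_def theta_term_def algebra_simps)
    then have "Phi u = (\<Sum>n. (theta_term'' n u - theta_term n u) / 8)"
      by (simp only: Phi_eq_suminf)
    also have "\<dots> = (\<Sum>n. theta_term'' n u - theta_term n u) / 8"
      by (rule suminf_divide[OF summable_diff[OF theta_terms_summable(3,1)]])
    also have "(\<Sum>n. theta_term'' n u - theta_term n u) = (\<Sum>n. theta_term'' n u) - (\<Sum>n. theta_term n u)"
      by (rule suminf_diff[OF theta_terms_summable(3,1), symmetric])
    finally have "Phi u = ((\<Sum>n. theta_term'' n u) - (\<Sum>n. theta_term n u)) / 8" .
    then show ?thesis by (simp add: \<Psi>_def \<Psi>''_def)
  qed
  ultimately show ?thesis unfolding P[of u] P[of "- u"] even by simp
qed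

section \<open>The Mellin transform of Phi and the zeta function\<close>

text \<open>Euler's integral under t = pi exp (4 v), dt = 4 t dv.\<close>

lemma Gamma_integral_exp_substitution:
  fixes w :: complex
  assumes w: "Re w > 0"
  shows "integrable lborel (\<lambda>v. exp (4 * w * of_real v) * of_real (exp (- pi * exp (4 * v))))" (is ?int)
    and "(\<integral>v. exp (4 * w * of_real v) * of_real (exp (- pi * exp (4 * v))) \<partial>lborel)
       = of_real pi powr (- w) * Gamma w / 4" (is ?val)
proof -
  define F where "F = (\<lambda>t. complex_of_real t powr (w - 1) / of_real (exp t))"
  define g where "g = (\<lambda>v::real. pi * exp (4 * v))"
  define G where "G = (\<lambda>v. of_real \<bar>4 * g v\<bar> * F (g v))"
  define c where "c = 4 * exp (w * of_real (ln pi))"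
  have gexp: "g v = exp (ln pi + 4 * v)" for v by (simp add: g_def exp_add)
  have gpos: "g v > 0" for v by (simp add: g_def)
  have G: "G v = c * (exp (4 * w * of_real v) * of_real (exp (- pi * exp (4 * v))))" for v
  proof -
    have "Ln (of_real (g v)) = of_real (ln pi + 4 * v)"
      using Ln_of_real[OF gpos[of v]] by (simp add: gexp)
    then have "complex_of_real (g v) powr (w - 1) = exp ((w - 1) * of_real (ln pi + 4 * v))"
      using gpos[of v] by (simp add: powr_def)
    moreover have "complex_of_real (g v) = exp (of_real (ln pi + 4 * v))"
      unfolding gexp by (rule exp_of_real[symmetric])
    ultimately have "complex_of_real (g v) * complex_of_real (g v) powr (w - 1) = exp (w * of_real (ln pi + 4 * v))"
      by (simp only: exp_add[symmetric]) (rule arg_cong[of _ _ exp], simp add: algebra_simps)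
    also have "\<dots> = exp (w * of_real (ln pi)) * exp (4 * w * of_real v)"
      by (simp add: algebra_simps flip: exp_add)
    finally have "complex_of_real (g v) * complex_of_real (g v) powr (w - 1) = exp (w * of_real (ln pi)) * exp (4 * w * of_real v)" .
    moreover have "G v = 4 * (complex_of_real (g v) * complex_of_real (g v) powr (w - 1)) * of_real (exp (- g v))"
      using gpos[of v] by (simp add: G_def F_def exp_minus divide_inverse)
    ultimately show ?thesis by (simp add: c_def g_def)
  qed
  have img: "g ` UNIV = {0<..}"
  proof (intro equalityI subsetI)
    fix t :: real assume "t \<in> {0<..}"
    then have "t = g (ln (t / pi) / 4)" by (simp add: g_def)
    then show "t \<in> g ` UNIV" by blast
  qed (use gpos in auto)
  have inj: "inj_on g UNIV" by (auto simp: inj_on_def g_def)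
  have der: "(g has_field_derivative 4 * g v) (at v within UNIV)" for v
    unfolding g_def by (auto intro!: derivative_eq_intros)
  have Fint: "F absolutely_integrable_on {0<..}"
    unfolding F_def by (rule absolutely_integrable_Gamma_integral'[OF w])
  have Fval: "(F has_integral Gamma w) {0<..}"
    unfolding F_def by (rule Gamma_integral_complex'[OF w])
  \<comment> \<open>The change of variables is made for real-valued images of \<open>F\<close> under
    a bounded linear \<phi> and then used with \<open>Re\<close> and \<open>Im\<close>.\<close>
  have part: "integrable lborel (\<lambda>v. \<phi> (G v)) \<and> (\<integral>v. \<phi> (G v) \<partial>lborel) = \<phi> (Gamma w)"
    if \<phi>: "bounded_linear \<phi>" for \<phi> :: "complex \<Rightarrow> real"
  proof -
    have scale: "\<phi> (of_real r * z) = r * \<phi> z" for r z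
      using linear_scale[OF bounded_linear.linear[OF \<phi>], of r z] by (simp add: scaleR_conv_of_real)
    have "(\<lambda>t. \<phi> (F t)) absolutely_integrable_on {0<..} \<and> integral {0<..} (\<lambda>t. \<phi> (F t)) = \<phi> (Gamma w)"
      using absolutely_integrable_linear[OF Fint \<phi>] integral_unique[OF has_integral_linear[OF Fval \<phi>]]
      by (simp add: o_def)
    then have "(\<lambda>v. \<bar>4 * g v\<bar> * \<phi> (F (g v))) absolutely_integrable_on UNIV
       \<and> integral UNIV (\<lambda>v. \<bar>4 * g v\<bar> * \<phi> (F (g v))) = \<phi> (Gamma w)"
      using has_absolute_integral_change_of_variables_1'[of UNIV g "\<lambda>v. 4 * g v" "\<lambda>t. \<phi> (F t)" "\<phi> (Gamma w)", OF _ der inj]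
      by (simp add: img)
    then have ai: "(\<lambda>v. \<phi> (G v)) absolutely_integrable_on UNIV" "integral UNIV (\<lambda>v. \<phi> (G v)) = \<phi> (Gamma w)"
      unfolding G_def scale by auto
    have meas: "(\<lambda>v. \<phi> (G v)) \<in> borel_measurable borel"
      unfolding G
      by (intro borel_measurable_continuous_onI continuous_on_compose2[OF linear_continuous_on[OF \<phi>], of UNIV] continuous_intros) auto
    have "integrable lebesgue (\<lambda>v. \<phi> (G v))" using ai(1) by (simp add: set_integrable_def)
    then have int: "integrable lborel (\<lambda>v. \<phi> (G v))"
      by (subst (asm) integrable_completion) (use meas in auto)
    then have "set_integrable lborel UNIV (\<lambda>v. \<phi> (G v))" by (simp add: set_integrable_def)
    from set_borel_integral_eq_integral(2)[OF this] ai(2) int show ?thesis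
      by (simp add: set_lebesgue_integral_def)
  qed
  have split: "G v = of_real (Re (G v)) + \<i> * of_real (Im (G v))" for v by (rule complex_eq)
  have Re: "integrable lborel (\<lambda>v. Re (G v))" "(\<integral>v. Re (G v) \<partial>lborel) = Re (Gamma w)"
    and Im: "integrable lborel (\<lambda>v. Im (G v))" "(\<integral>v. Im (G v) \<partial>lborel) = Im (Gamma w)"
    using part[OF bounded_linear_Re] part[OF bounded_linear_Im] by auto
  have Gint: "integrable lborel G"
  proof -
    have "integrable lborel (\<lambda>v. complex_of_real (Re (G v)) + \<i> * of_real (Im (G v)))"
      by (intro Bochner_Integration.integrable_add integrable_mult_right integrable_of_real Re Im)
    then show ?thesis by (simp only: split[symmetric])
  qed
  have Gval: "(\<integral>v. G v \<partial>lborel) = Gamma w"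
  proof -
    have "(\<integral>v. G v \<partial>lborel) = (\<integral>v. complex_of_real (Re (G v)) + \<i> * of_real (Im (G v)) \<partial>lborel)"
      by (simp only: split[symmetric])
    also have "\<dots> = of_real (Re (Gamma w)) + \<i> * of_real (Im (Gamma w))"
      using Re Im by (subst Bochner_Integration.integral_add) (auto intro!: integrable_mult_right integrable_of_real)
    finally show ?thesis by (simp only: complex_eq[symmetric])
  qed
  have c0: "c \<noteq> 0" by (simp add: c_def)
  have fG: "exp (4 * w * of_real v) * of_real (exp (- pi * exp (4 * v))) = inverse c * G v" for v
    using c0 unfolding G by simp
  show ?int unfolding fG by (rule integrable_mult_right[OF Gint])
  have "(\<integral>v. exp (4 * w * of_real v) * of_real (exp (- pi * exp (4 * v))) \<partial>lborel) = inverse c * Gamma w"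
    unfolding fG using Gval by simp
  also have "inverse c = of_real pi powr (- w) / 4"
  proof -
    have "c = 4 * of_real pi powr w" by (simp add: c_def powr_def Ln_of_real)
    then show ?thesis by (simp add: powr_minus)
  qed
  finally show ?val by simp
qed

text \<open>With Riemann's xi(s) = s (s - 1) pi^(- s/2) Gamma(s/2) zeta(s) / 2, this factor times
  zeta(s) is xi(s) / 4. The form Gamma(s/2 + 1) absorbs s/2.\<close>

definition Mellin_factor :: "complex \<Rightarrow> complex" where
  "Mellin_factor s = of_real pi powr (- s / 2) * Gamma (s / 2 + 1) * (s - 1) / 4"

text \<open>exp (9 v) and exp (5 v) combine with exp ((2 s - 1) v) to the Gamma arguments s/2 + 2
  and s/2 + 1, and 2 Gamma(s/2 + 2) - 3 Gamma(s/2 + 1) = (s - 1) Gamma(s/2 + 1).\<close>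

lemma Phi_term_0_Mellin:
  fixes s :: complex
  assumes s: "Re s > 0"
  shows "integrable lborel (\<lambda>v. of_real (Phi_term 0 v) * exp ((2 * s - 1) * of_real v))" (is ?int)
    and "(\<integral>v. of_real (Phi_term 0 v) * exp ((2 * s - 1) * of_real v) \<partial>lborel) = Mellin_factor s" (is ?val)
proof -
  let ?f = "\<lambda>w v. exp (4 * w * of_real v) * of_real (exp (- pi * exp (4 * v)))"
  have eq: "of_real (Phi_term 0 v) * exp ((2 * s - 1) * of_real v)
      = of_real (2 * pi\<^sup>2) * ?f (s / 2 + 2) v - of_real (3 * pi) * ?f (s / 2 + 1) v" for v
  proof -
    have A: "complex_of_real (exp (9 * v)) * exp ((2 * s - 1) * of_real v) = exp (4 * (s / 2 + 2) * of_real v)"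
      and B: "complex_of_real (exp (5 * v)) * exp ((2 * s - 1) * of_real v) = exp (4 * (s / 2 + 1) * of_real v)"
      by (simp_all add: exp_of_real[symmetric] algebra_simps flip: exp_add)
    have C: "of_real (Phi_term 0 v) = (of_real (2 * pi\<^sup>2) * complex_of_real (exp (9 * v))
        - of_real (3 * pi) * complex_of_real (exp (5 * v))) * of_real (exp (- pi * exp (4 * v)))"
      by (simp add: Phi_term_def)
    show ?thesis
      unfolding A[symmetric] B[symmetric] C by (simp only: left_diff_distrib right_diff_distrib mult_ac)
  qed
  have w: "Re (s / 2 + 2) > 0" "Re (s / 2 + 1) > 0" using s by auto
  note i1 = integrable_mult_right[OF Gamma_integral_exp_substitution(1)[OF w(1)], of "of_real (2 * pi\<^sup>2)"]
  note i2 = integrable_mult_right[OF Gamma_integral_exp_substitution(1)[OF w(2)], of "of_real (3 * pi)"]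
  show ?int unfolding eq by (rule Bochner_Integration.integrable_diff[OF i1 i2])
  have "s / 2 + 1 \<notin> \<int>\<^sub>\<le>\<^sub>0"
  proof
    assume "s / 2 + 1 \<in> \<int>\<^sub>\<le>\<^sub>0"
    then obtain n where n: "s / 2 + 1 = of_int n" "n \<le> 0" by (elim nonpos_Ints_cases)
    have "Re (s / 2 + 1) = of_int n" unfolding n(1) by simp
    then show False using w(2) n(2) by linarith
  qed
  from Gamma_plus1[OF this] have "Gamma (s / 2 + 2) = (s / 2 + 1) * Gamma (s / 2 + 1)"
    by (simp add: add.assoc)
  moreover have "of_real pi powr (- (s / 2 + 2)) = complex_of_real pi powr (- s / 2) / of_real (pi\<^sup>2)"
    "of_real pi powr (- (s / 2 + 1)) = complex_of_real pi powr (- s / 2) / of_real pi"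
  proof -
    let ?L = "Ln (complex_of_real pi)"
    have L: "exp ?L = of_real pi" by simp
    have pd: "complex_of_real pi powr z = exp (z * ?L)" for z by (simp add: powr_def)
    have e: "- (s / 2 + 2) * ?L = (- s / 2) * ?L - (?L + ?L)" "- (s / 2 + 1) * ?L = (- s / 2) * ?L - ?L"
      by (simp_all add: algebra_simps)
    show "of_real pi powr (- (s / 2 + 2)) = complex_of_real pi powr (- s / 2) / of_real (pi\<^sup>2)"
      "of_real pi powr (- (s / 2 + 1)) = complex_of_real pi powr (- s / 2) / of_real pi"
      by (simp_all only: pd e exp_diff exp_add L power2_eq_square of_real_mult)
  qed
  moreover have "of_real (2 * pi\<^sup>2) * (q / of_real (pi\<^sup>2) * ((s / 2 + 1) * G) / 4) - of_real (3 * pi) * (q / of_real pi * G / 4)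
      = q * G * (s - 1) / 4" for q G :: complex
  proof -
    have "of_real (2 * pi\<^sup>2) * (q / of_real (pi\<^sup>2) * ((s / 2 + 1) * G) / 4) = q * ((s / 2 + 1) * G) / 2"
      "of_real (3 * pi) * (q / of_real pi * G / 4) = 3 * (q * G) / 4"
      by simp_all
    then show ?thesis by (simp add: algebra_simps add_divide_distrib diff_divide_distrib)
  qed
  ultimately show ?val
    unfolding eq Bochner_Integration.integral_diff[OF i1 i2] integral_mult_right_zero
      Gamma_integral_exp_substitution(2)[OF w(1)] Gamma_integral_exp_substitution(2)[OF w(2)] Mellin_factor_def
    by (simp only:)
qed

text \<open>The index enters the exponent only through (n + 1)^2 exp (4 u), so a translation by ln
  (n + 1) / 2 absorbs it. Under the Mellin transform this translation becomes the Dirichlet factor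
  (n + 1)^(- s).\<close>

lemma Phi_term_shift:
  "Phi_term n u = exp (- (ln (real (Suc n)) / 2)) * Phi_term 0 (ln (real (Suc n)) / 2 + u)"
proof -
  let ?d = "ln (real (Suc n)) / 2"
  have "exp (4 * ?d) = (real (Suc n))\<^sup>2"
    using exp_of_nat_mult[of 2 "ln (real (Suc n))"] by simp
  then have "gauss_exponent 0 (?d + u) = gauss_exponent n u"
    by (simp add: gauss_exponent_def distrib_left exp_add)
  moreover have "exp u = exp (- ?d) * exp (?d + u)" by (simp flip: exp_add)
  ultimately show ?thesis unfolding Phi_term_eq by (simp only: mult.assoc)
qed

text \<open>The third claim supplies the majorant (n + 1)^(- Re s) for exchanging sum and integral
  when Re s > 1.\<close>

lemma Phi_term_Mellin:
  fixes s :: complex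
  assumes s: "Re s > 0"
  shows "integrable lborel (\<lambda>u. of_real (Phi_term n u) * exp ((2 * s - 1) * of_real u))" (is ?int)
    and "(\<integral>u. of_real (Phi_term n u) * exp ((2 * s - 1) * of_real u) \<partial>lborel)
       = Mellin_factor s / of_nat (Suc n) powr s" (is ?val)
    and "(\<integral>u. norm (of_real (Phi_term n u) * exp ((2 * s - 1) * of_real u)) \<partial>lborel)
       = (\<integral>u. norm (of_real (Phi_term 0 u) * exp ((2 * s - 1) * of_real u)) \<partial>lborel) * real (Suc n) powr (- Re s)" (is ?norm)
proof -
  define d where "d = ln (real (Suc n)) / 2"
  have d: "ln (real (Suc n)) = 2 * d" by (simp add: d_def)
  define h where "h = (\<lambda>v. complex_of_real (Phi_term 0 v) * exp ((2 * s - 1) * of_real v))"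
  have hint: "integrable lborel h" and hval: "(\<integral>v. h v \<partial>lborel) = Mellin_factor s"
    using Phi_term_0_Mellin[OF s] by (simp_all add: h_def)
  have eq: "of_real (Phi_term n u) * exp ((2 * s - 1) * of_real u) = exp (- s * of_real (ln (real (Suc n)))) * h (d + 1 * u)" for u
  proof -
    have 1: "exp ((2 * s - 1) * of_real u) = exp (- (2 * s - 1) * of_real d) * exp ((2 * s - 1) * of_real (d + u))"
      unfolding exp_add[symmetric] by (rule arg_cong[of _ _ exp]) (simp add: algebra_simps)
    have 2: "complex_of_real (exp (- d)) * exp (- (2 * s - 1) * of_real d) = exp (- s * of_real (ln (real (Suc n))))"
      unfolding exp_of_real[symmetric] exp_add[symmetric] d
      by (rule arg_cong[of _ _ exp]) (simp add: algebra_simps)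
    have "of_real (Phi_term n u) * exp ((2 * s - 1) * of_real u)
        = (complex_of_real (exp (- d)) * exp (- (2 * s - 1) * of_real d)) *
          (of_real (Phi_term 0 (d + u)) * exp ((2 * s - 1) * of_real (d + u)))"
      unfolding 1 Phi_term_shift[of n u] d_def[symmetric] of_real_mult by (simp only: mult_ac)
    then show ?thesis unfolding 2 h_def by simp
  qed
  have sh: "integrable lborel (\<lambda>u. h (d + 1 * u))"
    by (rule lborel_integrable_real_affine[OF hint]) simp
  show ?int unfolding eq by (rule integrable_mult_right[OF sh])
  have "(\<integral>u. h (d + 1 * u) \<partial>lborel) = Mellin_factor s"
    using lborel_integral_real_affine[of 1 h d] hval by simp
  moreover have "exp (- s * of_real (ln (real (Suc n)))) = 1 / of_nat (Suc n) powr s"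
    by (simp add: powr_def exp_minus divide_inverse Ln_of_nat del: of_nat_Suc)
  ultimately show ?val unfolding eq integral_mult_right_zero by simp
  have "(\<integral>u. norm (h (d + 1 * u)) \<partial>lborel) = (\<integral>u. norm (h u) \<partial>lborel)"
    using lborel_integral_real_affine[of 1 "\<lambda>u. norm (h u)" d] by simp
  moreover have "norm (exp (- s * of_real (ln (real (Suc n))))) = real (Suc n) powr (- Re s)"
    by (simp add: norm_exp_eq_Re powr_def)
  ultimately show ?norm unfolding eq norm_mult[of "exp _"] integral_mult_right_zero
    unfolding h_def by simp
qed

lemma Phi_Mellin:
  fixes s :: complex
  assumes s: "Re s > 1"
  shows "integrable lborel (\<lambda>u. of_real (Phi u) * exp ((2 * s - 1) * of_real u))" (is ?int)
    and "(\<lambda>n. Mellin_factor s / of_nat (Suc n) powr s) sums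
       (\<integral>u. of_real (Phi u) * exp ((2 * s - 1) * of_real u) \<partial>lborel)" (is ?sums)
proof -
  have s0: "Re s > 0" using s by simp
  define f where "f = (\<lambda>n u. complex_of_real (Phi_term n u) * exp ((2 * s - 1) * of_real u))"
  have int: "integrable lborel (f n)" for n unfolding f_def by (rule Phi_term_Mellin(1)[OF s0])
  have ae: "AE u in lborel. summable (\<lambda>n. norm (f n u))"
    unfolding f_def norm_mult norm_of_real by (rule AE_I2, rule summable_mult2, rule summable_abs_Phi_term)
  have powr: "summable (\<lambda>n. real (Suc n) powr (- Re s))"
  proof (subst summable_Suc_iff[of "\<lambda>n. real n powr (- Re s)"])
    show "summable (\<lambda>n. real n powr (- Re s))" using s by (subst summable_real_powr_iff) simp
  qed
  define C where "C = (\<integral>u. norm (of_real (Phi_term 0 u) * exp ((2 * s - 1) * of_real u)) \<partial>lborel)"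
  have normf: "(\<integral>u. norm (f n u) \<partial>lborel) = C * real (Suc n) powr (- Re s)" for n
    using Phi_term_Mellin(3)[OF s0, of n] unfolding C_def f_def .
  have sm: "summable (\<lambda>n. \<integral>u. norm (f n u) \<partial>lborel)"
    unfolding normf by (rule summable_mult[OF powr])
  have sumf: "(\<Sum>n. f n u) = of_real (Phi u) * exp ((2 * s - 1) * of_real u)" for u
  proof -
    have "(\<lambda>n. Phi_term n u) sums Phi u"
      unfolding Phi_eq_suminf by (rule summable_sums[OF summable_rabs_cancel[OF summable_abs_Phi_term]])
    then have "(\<lambda>n. f n u) sums (of_real (Phi u) * exp ((2 * s - 1) * of_real u))"
      unfolding f_def by (rule sums_mult2[OF sums_of_real])
    then show ?thesis by (rule sums_unique[symmetric])
  qed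
  show ?int using integrable_suminf[OF int ae sm] unfolding sumf .
  show ?sums using sums_integral[OF int ae sm] unfolding sumf
    by (simp only: f_def Phi_term_Mellin(2)[OF s0])
qed

text \<open>Evenness of \<open>Phi\<close> folds the line onto the half-line, where the two
  exponentials add up to twice a cosine.\<close>

lemma Phi_two_sided_integral:
  fixes s :: complex
  assumes int: "integrable lborel (\<lambda>u. of_real (Phi u) * exp ((2 * s - 1) * of_real u))"
  shows "(\<integral>u. of_real (Phi u) * exp ((2 * s - 1) * of_real u) \<partial>lborel) = 2 * H 0 (- \<i> * (2 * s - 1))"
proof -
  define T where "T = (\<lambda>u. complex_of_real (Phi u) * exp ((2 * s - 1) * of_real u))"
  have int: "integrable lborel T" using int by (simp add: T_def)
  have int': "integrable lborel (\<lambda>u. T (- u))"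
    using lborel_integrable_real_affine[OF int, of "- 1" 0] by simp
  have ip: "integrable lborel (\<lambda>u. indicator {0..} u *\<^sub>R T u)"
    by (rule integrable_mult_indicator[OF _ int]) simp
  have im: "integrable lborel (\<lambda>u. indicator {..<0} u *\<^sub>R T u)"
    by (rule integrable_mult_indicator[OF _ int]) simp
  have ip': "integrable lborel (\<lambda>u. indicator {0..} u *\<^sub>R T (- u))"
    by (rule integrable_mult_indicator[OF _ int']) simp
  have "(\<integral>u. T u \<partial>lborel) = (\<integral>u. indicator {0..} u *\<^sub>R T u + indicator {..<0} u *\<^sub>R T u \<partial>lborel)"
    by (intro Bochner_Integration.integral_cong) (auto simp: indicator_def)
  also have "\<dots> = (\<integral>u. indicator {0..} u *\<^sub>R T u \<partial>lborel) + (\<integral>u. indicator {..<0} u *\<^sub>R T u \<partial>lborel)"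
    by (rule Bochner_Integration.integral_add[OF ip im])
  also have "(\<integral>u. indicator {..<0} u *\<^sub>R T u \<partial>lborel) = (\<integral>u. indicator {..<0} (- u) *\<^sub>R T (- u) \<partial>lborel)"
    using lborel_integral_real_affine[of "- 1" "\<lambda>u. indicator {..<0} u *\<^sub>R T u" 0] by simp
  \<comment> \<open>The two indicators differ only at the null set {0}.\<close>
  also have "\<dots> = (\<integral>u. indicator {0..} u *\<^sub>R T (- u) \<partial>lborel)"
  proof (rule integral_cong_AE)
    have "AE u in lborel. u \<noteq> (0::real)" by (rule AE_lborel_singleton)
    then show "AE u in lborel. indicator {..<0} (- u) *\<^sub>R T (- u) = indicator {0..} u *\<^sub>R T (- u)"
      by eventually_elim (auto simp: indicator_def)
    have [measurable]: "(\<lambda>u. T (- u)) \<in> borel_measurable lborel"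
      using int' by (rule borel_measurable_integrable)
    show "(\<lambda>u. indicator {..<0} (- u) *\<^sub>R T (- u)) \<in> borel_measurable lborel" by measurable
  qed (use ip' in auto)
  also have "(\<integral>u. indicator {0..} u *\<^sub>R T u \<partial>lborel) + (\<integral>u. indicator {0..} u *\<^sub>R T (- u) \<partial>lborel)
      = (\<integral>u. indicator {0..} u *\<^sub>R T u + indicator {0..} u *\<^sub>R T (- u) \<partial>lborel)"
    by (rule Bochner_Integration.integral_add[OF ip ip', symmetric])
  also have "\<dots> = (\<integral>u. 2 * (indicator {0..} u *\<^sub>R (of_real (Phi u) * cos (- \<i> * (2 * s - 1) * of_real u))) \<partial>lborel)"
  proof (rule Bochner_Integration.integral_cong[OF refl])
    fix u :: real
    have "\<i> * (- \<i> * (2 * s - 1) * of_real u) = (2 * s - 1) * of_real u"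
      by (simp add: algebra_simps)
    then have "cos (- \<i> * (2 * s - 1) * of_real u) = (exp ((2 * s - 1) * of_real u) + exp (- ((2 * s - 1) * of_real u))) / 2"
      unfolding cos_exp_eq by (simp only:)
    moreover have "T (- u) = of_real (Phi u) * exp (- ((2 * s - 1) * of_real u))"
      by (simp add: T_def Phi_even)
    moreover have "P * a + P * b = 2 * (P * ((a + b) / 2))" for P a b :: complex
      by (simp add: distrib_left)
    ultimately have "T u + T (- u) = 2 * (of_real (Phi u) * cos (- \<i> * (2 * s - 1) * of_real u))"
      unfolding T_def by (simp only:)
    then show "indicator {0..} u *\<^sub>R T u + indicator {0..} u *\<^sub>R T (- u)
       = 2 * (indicator {0..} u *\<^sub>R (of_real (Phi u) * cos (- \<i> * (2 * s - 1) * of_real u)))"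
      by (simp only: scaleR_add_right[symmetric] mult_scaleR_right)
  qed
  also have "\<dots> = 2 * (\<integral>u. indicator {0..} u *\<^sub>R (of_real (Phi u) * cos (- \<i> * (2 * s - 1) * of_real u)) \<partial>lborel)"
    by (rule integral_mult_right_zero)
  also have "(\<integral>u. indicator {0..} u *\<^sub>R (of_real (Phi u) * cos (- \<i> * (2 * s - 1) * of_real u)) \<partial>lborel)
      = H 0 (- \<i> * (2 * s - 1))"
    by (simp add: H_def set_lebesgue_integral_def)
  finally show ?thesis by (simp only: T_def)
qed

lemma Mellin_factor_nonzero:
  assumes "Re s > 1"
  shows "Mellin_factor s \<noteq> 0"
proof -
  have "s / 2 + 1 \<notin> \<int>\<^sub>\<le>\<^sub>0"
  proof
    assume "s / 2 + 1 \<in> \<int>\<^sub>\<le>\<^sub>0"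
    then obtain n where n: "s / 2 + 1 = of_int n" "n \<le> 0" by (elim nonpos_Ints_cases)
    have "Re (s / 2 + 1) = of_int n" unfolding n(1) by simp
    then show False using assms n(2) by simp
  qed
  moreover have "s \<noteq> 1" using assms by auto
  ultimately show ?thesis by (simp add: Mellin_factor_def Gamma_eq_zero_iff)
qed

text \<open>For Re s > 1 the Mellin computation reads 2 H_0(- i (2 s - 1)) =
  \<open>Mellin_factor s\<close> times zeta(s), solved here for zeta(s). With the entire function
  \<open>rGamma\<close> the quotient is holomorphic except at s = 1. This witness gives the choice
  in \<open>zeta\<close> its meaning.\<close>

lemma is_zeta_continuation_H0:
  "is_zeta_continuation (\<lambda>s. 8 * H 0 (- \<i> * (2 * s - 1)) * of_real pi powr (s / 2) * rGamma (s / 2 + 1) / (s - 1))"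
  unfolding is_zeta_continuation_def
proof (intro conjI allI impI)
  have "(\<lambda>s. H 0 (- \<i> * (2 * s - 1))) holomorphic_on - {1}"
    unfolding H0_eq_cos_transform
    by (rule holomorphic_on_compose_gen[OF _ cos_transform_holomorphic[OF rapidly_decaying_Phi], unfolded o_def])
       (auto intro!: holomorphic_intros)
  then show "(\<lambda>s. 8 * H 0 (- \<i> * (2 * s - 1)) * of_real pi powr (s / 2) * rGamma (s / 2 + 1) / (s - 1)) holomorphic_on - {1}"
    by (intro holomorphic_intros) auto
next
  fix s :: complex assume s: "Re s > 1"
  let ?M = "Mellin_factor s"
  have M0: "?M \<noteq> 0" by (rule Mellin_factor_nonzero[OF s])
  have s1: "s - 1 \<noteq> 0" using s by auto
  have "(\<lambda>k. ?M / of_nat (Suc k) powr s) sums (2 * H 0 (- \<i> * (2 * s - 1)))"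
    using Phi_Mellin(2)[OF s] unfolding Phi_two_sided_integral[OF Phi_Mellin(1)[OF s]] .
  from sums_mult[OF this, of "1 / ?M"]
  have "(\<lambda>k. 1 / of_nat (Suc k) powr s) sums (2 * H 0 (- \<i> * (2 * s - 1)) / ?M)"
    using M0 by simp
  moreover have "2 * h / ?M = 8 * h * of_real pi powr (s / 2) * rGamma (s / 2 + 1) / (s - 1)" for h
  proof -
    define P where "P = complex_of_real pi powr (s / 2)"
    define G where "G = Gamma (s / 2 + 1)"
    have M: "?M = inverse P * G * (s - 1) / 4"
      using powr_minus[of "complex_of_real pi" "s / 2"] by (simp add: Mellin_factor_def P_def G_def)
    have "P \<noteq> 0" "G \<noteq> 0" using M0 unfolding M by auto
    then have "2 * h / (inverse P * G * (s - 1) / 4) = 8 * h * P * inverse G / (s - 1)"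
      using s1 by (simp add: field_simps)
    then show ?thesis unfolding M by (simp add: rGamma_inverse_Gamma P_def G_def)
  qed
  ultimately show "(\<lambda>k. 1 / of_nat (Suc k) powr s) sums
      (8 * H 0 (- \<i> * (2 * s - 1)) * of_real pi powr (s / 2) * rGamma (s / 2 + 1) / (s - 1))"
    by simp
qed

lemma is_zeta_continuation_zeta: "is_zeta_continuation zeta"
  unfolding zeta_def by (rule someI[of is_zeta_continuation, OF is_zeta_continuation_H0])

text \<open>For s = (1 + y)/2 + i x/2 the argument - i (2 s - 1) is x - i y, and \<open>H 0\<close>
  commutes with conjugation. The pole s = 1 would mean x = 0, a zero on the imaginary axis.\<close>

lemma H0_zero_imp_zeta_zero:
  assumes zero: "H 0 (Complex x y) = 0"
  shows "Complex ((1 + y) / 2) (x / 2) \<noteq> 1 \<and> zeta (Complex ((1 + y) / 2) (x / 2)) = 0"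
proof -
  let ?s = "Complex ((1 + y) / 2) (x / 2)"
  have arg: "- \<i> * (2 * ?s - 1) = cnj (Complex x y)" by (simp add: complex_eq_iff field_simps)
  have zero': "H 0 (- \<i> * (2 * ?s - 1)) = 0"
    using zero unfolding arg H0_eq_cos_transform cos_transform_cnj[OF rapidly_decaying_Phi] by simp
  have "?s \<noteq> 1"
  proof
    assume "?s = 1"
    then have "x = 0" by (simp add: complex_eq_iff)
    then have "Complex x y = \<i> * of_real y" by (simp add: complex_eq_iff)
    then show False
      using zero cos_transform_imag_nonzero[OF rapidly_decaying_Phi, of y] by (simp add: H0_eq_cos_transform)
  qed
  moreover from zeta_continuation_unique[OF is_zeta_continuation_zeta is_zeta_continuation_H0 this]
  have "zeta ?s = 0" unfolding zero' by simp
  ultimately show ?thesis by blast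
qed

text \<open>Sieving: removing from the Dirichlet series the multiples of a prime \<open>p\<close> multiplies it by
  \<open>1 - p\<^sup>-\<^sup>s\<close>, so if the full series vanished then so would every sieved one; but these tend to \<open>1\<close>.\<close>
lemma zeta_nonzero:
  assumes s: "Re s > 1"
  shows "zeta s \<noteq> 0"
proof
  assume z0: "zeta s = 0"
  define f where "f = (\<lambda>n::nat. complex_of_nat n powr (- s))"
  define G where "G = (\<lambda>k. {n::nat. n \<ge> 1 \<and> (\<forall>p<k. prime p \<longrightarrow> \<not> p dvd n)})"
  have normf: "cmod (f n) = real n powr (- Re s)" for n
    by (cases "n = 0") (auto simp: f_def norm_powr_real_powr)
  have sumN: "summable (\<lambda>n. cmod (f n))"
    unfolding normf using s by (subst summable_real_powr_iff) simp
  then have abs_on: "(\<lambda>n. cmod (f n)) summable_on A" for A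
    by (intro summable_on_subset_banach[OF norm_summable_imp_summable_on subset_UNIV]) simp
  have on: "f summable_on A" for A
    by (rule abs_summable_summable[OF abs_on])
  have sums: "(\<lambda>k. f (Suc k)) sums 0"
  proof -
    have "(\<lambda>k. 1 / of_nat (Suc k) powr s) sums zeta s"
      using is_zeta_continuation_zeta s unfolding is_zeta_continuation_def by blast
    then show ?thesis unfolding f_def powr_minus_divide z0 .
  qed
  have f_exp: "f n = exp (- s * of_real (ln (real n)))" if "n > 0" for n
    using that by (simp add: f_def powr_def Ln_of_nat)
  have mult: "f (p * n) = f p * f n" if "p > 0" "n > 0" for p n
  proof -
    have "f (p * n) = exp (- s * of_real (ln (real p)) + - s * of_real (ln (real n)))"
      using that by (simp add: f_exp ln_mult distrib_left)
    then show ?thesis using that by (simp only: exp_add f_exp)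
  qed
  have "infsum f (G k) = 0" for k
  proof (induction k)
    case 0
    have "G 0 = range Suc" by (auto simp: G_def image_iff gr0_conv_Suc Suc_le_eq)
    have "summable (\<lambda>k. cmod (f (Suc k)))" using sumN by (subst summable_Suc_iff)
    then have "((\<lambda>k. f (Suc k)) has_sum 0) UNIV" using sums by (rule norm_summable_imp_has_sum)
    then have "(f has_sum 0) (range Suc)" by (subst has_sum_reindex) (simp_all add: o_def)
    then show ?case unfolding \<open>G 0 = range Suc\<close> by (rule infsumI)
  next
    case (Suc k)
    show ?case
    proof (cases "prime k")
      case False
      then have "G (Suc k) = G k" by (auto simp: G_def less_Suc_eq)
      then show ?thesis using Suc by simp
    next
      case True
      \<comment> \<open>The multiples of the prime \<open>k\<close> in \<open>G k\<close> are
        exactly \<open>k\<close> times \<open>G k\<close>. Hence the sum over \<open>G k\<close> is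
        the sum over \<open>G (Suc k)\<close> plus \<open>f k\<close> times the sum over
        \<open>G k\<close>, and vanishing is inherited.\<close>
      have split: "G k = G (Suc k) \<union> (*) k ` G k"
      proof (intro equalityI subsetI)
        fix n assume n: "n \<in> G k"
        show "n \<in> G (Suc k) \<union> (*) k ` G k"
        proof (cases "k dvd n")
          case True
          then obtain m where m: "n = k * m" by (elim dvdE)
          then have "m \<in> G k" using n by (auto simp: G_def)
          then show ?thesis using m by blast
        next
          case False
          then show ?thesis using n by (auto simp: G_def less_Suc_eq)
        qed
      next
        fix n assume "n \<in> G (Suc k) \<union> (*) k ` G k"
        then show "n \<in> G k"
        proof
          assume "n \<in> (*) k ` G k"
          then obtain m where m: "n = k * m" "m \<in> G k" by blast
          have "\<not> p dvd n" if "p < k" "prime p" for p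
          proof
            assume "p dvd n"
            then have "p dvd k \<or> p dvd m" using that(2) m(1) prime_dvd_mult_iff by blast
            moreover have "\<not> p dvd k" using primes_dvd_imp_eq[OF that(2) True] that(1) by auto
            ultimately show False using m(2) that by (auto simp: G_def)
          qed
          moreover have "n \<ge> 1" using m prime_gt_0_nat[OF True] by (auto simp: G_def Suc_le_eq)
          ultimately show ?thesis by (simp add: G_def)
        qed (auto simp: G_def)
      qed
      have disj: "G (Suc k) \<inter> (*) k ` G k = {}"
        using True by (auto simp: G_def)
      have "infsum f (G k) = infsum f (G (Suc k)) + infsum f ((*) k ` G k)"
        using infsum_Un_disjoint[OF on on disj] split by simp
      moreover have "infsum f ((*) k ` G k) = infsum (\<lambda>n. f k * f n) (G k)"
      proof (subst infsum_reindex)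
        show "inj_on ((*) k) (G k)" using prime_gt_0_nat[OF True] by (auto simp: inj_on_def)
        show "infsum (f \<circ> (*) k) (G k) = infsum (\<lambda>n. f k * f n) (G k)"
          by (rule infsum_cong) (use prime_gt_0_nat[OF True] in \<open>simp add: mult G_def\<close>)
      qed
      moreover have "\<dots> = f k * infsum f (G k)"
        by (rule infsum_cmult_right') 
      ultimately show ?thesis using Suc by simp
    qed
  qed
  moreover have "\<exists>k. infsum f (G k) \<noteq> 0"
  proof -
    obtain N where N: "\<And>n. n \<ge> N \<Longrightarrow> norm (\<Sum>i. cmod (f (i + n))) < 1"
      using suminf_exist_split[OF zero_less_one sumN] by blast
    define k where "k = N + 2"
    have G1: "1 \<in> G k" by (auto simp: G_def dest: prime_gt_1_nat)
    \<comment> \<open>A prime factor of any other member is at least \<open>k\<close>, so all terms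
      except the term 1 lie in a tail of absolute sum below 1.\<close>
    have sub: "G k - {1} \<subseteq> {k..}"
    proof
      fix n assume n: "n \<in> G k - {1}"
      then obtain p where p: "prime p" "p dvd n" using prime_factor_nat[of n] by blast
      then have "k \<le> p" using n by (force simp: G_def)
      also have "p \<le> n" using p n by (intro dvd_imp_le) (auto simp: G_def)
      finally show "n \<in> {k..}" by simp
    qed
    have "infsum f (G k) = infsum f {1} + infsum f (G k - {1})"
      using infsum_Un_disjoint[OF on on, of "{1}" "G k - {1}"] G1 by (simp add: insert_absorb)
    moreover have "infsum f {1} = 1" by (simp add: f_def)
    moreover have "cmod (infsum f (G k - {1})) < 1"
    proof -
      have "((\<lambda>i. cmod (f (i + k))) has_sum (\<Sum>i. cmod (f (i + k)))) UNIV"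
        by (rule norm_summable_imp_has_sum)
           (use sumN in \<open>auto intro!: summable_sums summable_ignore_initial_segment\<close>)
      moreover have "range (\<lambda>i. i + k) = {k..}" by (auto simp: image_iff intro: exI[of _ "_ - k"] le_add_diff_inverse2[symmetric])
      ultimately have "((\<lambda>n. cmod (f n)) has_sum (\<Sum>i. cmod (f (i + k)))) {k..}"
        using has_sum_reindex[of "\<lambda>i. i + k" UNIV "\<lambda>n. cmod (f n)"] by (simp add: o_def)
      then have tail: "infsum (\<lambda>n. cmod (f n)) {k..} = (\<Sum>i. cmod (f (i + k)))" by (rule infsumI)
      have "cmod (infsum f (G k - {1})) \<le> infsum (\<lambda>n. cmod (f n)) (G k - {1})"
        by (rule norm_infsum_bound[OF abs_on])
      also have "\<dots> \<le> infsum (\<lambda>n. cmod (f n)) {k..}"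
        by (rule infsum_mono2[OF abs_on abs_on sub]) simp
      also have "\<dots> < 1" using N[of k] unfolding tail by (simp add: k_def)
      finally show ?thesis .
    qed
    ultimately have "infsum f (G k) \<noteq> 0"
      by (metis add_eq_0_iff norm_minus_cancel norm_one order_less_irrefl)
    then show ?thesis by blast
  qed
  ultimately show False by blast
qed

section \<open>The barrier argument\<close>

lemma H_zero_abs:
  assumes "H t (Complex x y) = 0"
  shows "H t (Complex \<bar>x\<bar> \<bar>y\<bar>) = 0"
  using cos_transform_zero_nonneg_imag(1)[OF rapidly_decaying_heat[OF rapidly_decaying_Phi]] assms
  unfolding H_eq_cos_transform .

text \<open>|y| > 1 would correspond to a zero of zeta with real part (1 + |y|) / 2 > 1.\<close>

lemma H0_zero_strip:
  assumes "cos_transform Phi (Complex x y) = 0"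
  shows "y = 0 \<or> y\<^sup>2 \<le> 1"
proof (rule ccontr)
  assume neg: "\<not> ?thesis"
  then have "\<bar>y\<bar> > 1" by (metis abs_square_le_1 not_le)
  moreover have "H 0 (Complex \<bar>x\<bar> \<bar>y\<bar>) = 0" using H_zero_abs[of 0 x y] assms by (simp add: H0_eq_cos_transform)
  ultimately have "zeta (Complex ((1 + \<bar>y\<bar>) / 2) (\<bar>x\<bar> / 2)) = 0"
    using H0_zero_imp_zeta_zero by simp
  moreover have "zeta (Complex ((1 + \<bar>y\<bar>) / 2) (\<bar>x\<bar> / 2)) \<noteq> 0"
    using \<open>\<bar>y\<bar> > 1\<close> by (intro zeta_nonzero) simp
  ultimately show False by blast
qed

text \<open>On the compact set of pairs (t, z) described in (iii), |H_t(z)| has a positive minimum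
  \<delta>. Approximants at time j t0 / N differ from H_t by at most M / N there, so for N > M /
  \<delta> they have no zeros in it.\<close>

lemma heat_approx_barrier_of_compact:
  assumes t0: "t0 > 0" and y0: "0 < y0"
    and iii: "\<nexists>t x y. 0 \<le> t \<and> t \<le> t0 \<and> X \<le> x \<and> x \<le> X + w
              \<and> sqrt (y0\<^sup>2 + 2 * (t0 - t)) \<le> y \<and> y \<le> sqrt (1 - 2 * t) \<and> H t (Complex x y) = 0"
  shows "\<exists>N0. \<forall>N>N0. \<forall>j\<le>N. \<forall>x y. cos_transform (heat_approx Phi t0 N j) (Complex x y) = 0 \<longrightarrow>
       X \<le> \<bar>x\<bar> \<longrightarrow> \<bar>x\<bar> \<le> X + w \<longrightarrow> y = 0 \<or> y\<^sup>2 \<le> y0\<^sup>2 + 2 * t0 - real j * (2 * t0 / real N)"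
proof -
  \<comment> \<open>For t > 1/2 the value \<open>sqrt (1 - 2 * t)\<close> is negative while the
    floor is positive, so these time slices are empty.\<close>
  define Z where "Z = {(t, z). 0 \<le> t \<and> t \<le> t0 \<and> X \<le> Re z \<and> Re z \<le> X + w
              \<and> sqrt (y0\<^sup>2 + 2 * (t0 - t)) \<le> Im z \<and> Im z \<le> sqrt (1 - 2 * t)}"
  define f where "f = (\<lambda>(t, z). cos_transform (\<lambda>u. exp (t * u\<^sup>2) * Phi u) z)"
  define r where "r = \<bar>X\<bar> + \<bar>w\<bar> + 1"
  have Zb: "cmod z \<le> r \<and> 0 \<le> t \<and> t \<le> t0" if "(t, z) \<in> Z" for t z
  proof -
    have t: "0 \<le> t" "t \<le> t0" and z: "X \<le> Re z" "Re z \<le> X + w"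
      "sqrt (y0\<^sup>2 + 2 * (t0 - t)) \<le> Im z" "Im z \<le> sqrt (1 - 2 * t)"
      using that by (auto simp: Z_def)
    have "sqrt (1 - 2 * t) \<le> 1" using t by simp
    moreover have "0 \<le> sqrt (y0\<^sup>2 + 2 * (t0 - t))" using t by simp
    ultimately have "\<bar>Im z\<bar> \<le> 1" using z by linarith
    moreover have "\<bar>Re z\<bar> \<le> \<bar>X\<bar> + \<bar>w\<bar>" using z by linarith
    ultimately show ?thesis using cmod_le[of z] t by (simp add: r_def)
  qed
  have "compact Z"
  proof -
    have "Z = {p. 0 \<le> fst p} \<inter> {p. fst p \<le> t0} \<inter> {p. X \<le> Re (snd p)} \<inter> {p. Re (snd p) \<le> X + w}
        \<inter> {p. sqrt (y0\<^sup>2 + 2 * (t0 - fst p)) \<le> Im (snd p)} \<inter> {p. Im (snd p) \<le> sqrt (1 - 2 * fst p)}"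
      by (auto simp: Z_def)
    then have "closed Z"
      by (auto intro!: closed_Int closed_Collect_le continuous_intros)
    moreover have "Z \<subseteq> {0..t0} \<times> cball 0 r" using Zb by auto
    then have "bounded Z" by (rule bounded_subset[rotated]) (intro bounded_Times bounded_closed_interval bounded_cball)
    ultimately show ?thesis by (simp add: compact_eq_bounded_closed)
  qed
  have fZ: "f p \<noteq> 0" if "p \<in> Z" for p
  proof -
    obtain t z where p: "p = (t, z)" by (cases p)
    have "z = Complex (Re z) (Im z)" by simp
    then have "H t z \<noteq> 0" using iii that unfolding p Z_def by (metis (mono_tags, lifting) case_prodD mem_Collect_eq)
    then show ?thesis by (simp add: f_def p H_eq_cos_transform)
  qed
  obtain \<delta> where \<delta>: "\<delta> > 0" "\<And>p. p \<in> Z \<Longrightarrow> \<delta> \<le> cmod (f p)"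
  proof (cases "Z = {}")
    case True
    then show ?thesis using that[of 1] by simp
  next
    case False
    have "continuous_on Z (\<lambda>p. cmod (f p))"
      unfolding f_def by (intro continuous_on_norm cos_transform_heat_continuous rapidly_decaying_Phi)
    then obtain p where "p \<in> Z" "\<And>q. q \<in> Z \<Longrightarrow> cmod (f p) \<le> cmod (f q)"
      using continuous_attains_inf[OF \<open>compact Z\<close> False] by blast
    then show ?thesis using that[of "cmod (f p)"] fZ by simp
  qed
  obtain M where M: "\<And>N k z. 0 < N \<Longrightarrow> k \<le> N \<Longrightarrow> cmod z \<le> r \<Longrightarrow>
     cmod (cos_transform (heat_approx Phi t0 N k) z
       - cos_transform (\<lambda>u. exp (real k * t0 / real N * u\<^sup>2) * Phi u) z) \<le> M / real N"
    using cos_transform_heat_approx[OF rapidly_decaying_Phi t0, of r] by blast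
  obtain N0 where N0: "M / \<delta> < real N0" using reals_Archimedean2 by blast
  have "y = 0 \<or> y\<^sup>2 \<le> y0\<^sup>2 + 2 * t0 - real j * (2 * t0 / real N)"
    if N: "N > N0" and j: "j \<le> N" and zero: "cos_transform (heat_approx Phi t0 N j) (Complex x y) = 0"
      and x: "X \<le> \<bar>x\<bar>" "\<bar>x\<bar> \<le> X + w" for N j x y
  proof (rule ccontr)
    assume neg: "\<not> ?thesis"
    have Npos: "N > 0" using N by simp
    define t where "t = real j * t0 / real N"
    have t2: "real j * (2 * t0 / real N) = 2 * t" by (simp add: t_def)
    have t: "0 \<le> t" "t \<le> t0"
      using j t0 Npos by (auto simp: t_def field_simps)
    \<comment> \<open>The approximants obey the strip bound 1 - 2 t themselves, so a zero above the
      floor also lies below the upper edge and belongs to \<open>Z\<close>.\<close>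
    have "y\<^sup>2 \<le> 1 - 2 * t"
      using heat_approx_strip[where k = j and x = x and y = y, OF rapidly_decaying_Phi t0 Npos H0_zero_strip zero] neg
      unfolding t2 by auto
    then have "\<bar>y\<bar> \<le> sqrt (1 - 2 * t)" using real_le_rsqrt[of "\<bar>y\<bar>"] by simp
    moreover have "sqrt (y0\<^sup>2 + 2 * (t0 - t)) \<le> \<bar>y\<bar>"
      using neg unfolding t2 by (intro real_le_lsqrt) (auto simp: t)
    ultimately have p: "(t, Complex \<bar>x\<bar> \<bar>y\<bar>) \<in> Z" using t x by (simp add: Z_def)
    have zero': "cos_transform (heat_approx Phi t0 N j) (Complex \<bar>x\<bar> \<bar>y\<bar>) = 0"
      by (rule cos_transform_zero_nonneg_imag(1)[OF rapidly_decaying_heat_approx[OF rapidly_decaying_Phi] zero])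
    have "\<delta> \<le> M / real N"
      using \<delta>(2)[OF p] M[OF Npos j, of "Complex \<bar>x\<bar> \<bar>y\<bar>"] Zb[OF p] zero' by (simp add: f_def t_def)
    then have "real N \<le> M / \<delta>" using \<delta>(1) Npos by (simp add: field_simps)
    then show False using N0 N by linarith
  qed
  then show ?thesis by blast
qed

theorem theorem1p2:
  fixes t\<^sub>0 X y\<^sub>0 \<Lambda> :: real
  assumes Lambda: "is_de_Bruijn_Newman_constant \<Lambda>"
    and "t\<^sub>0 > 0" and "X > 0" and "0 < y\<^sub>0" and "y\<^sub>0 \<le> 1"
    and i: "\<nexists>\<sigma> T. (1 + y\<^sub>0) / 2 \<le> \<sigma> \<and> \<sigma> \<le> 1 \<and> 0 \<le> T \<and> T \<le> X / 2
              \<and> Complex \<sigma> T \<noteq> 1 \<and> zeta (Complex \<sigma> T) = 0"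
    and ii: "\<nexists>x y. x \<ge> X + sqrt (1 - y\<^sub>0\<^sup>2) \<and> y\<^sub>0 \<le> y \<and> y \<le> sqrt (1 - 2 * t\<^sub>0)
              \<and> H t\<^sub>0 (Complex x y) = 0"
    and iii: "\<nexists>t x y. 0 \<le> t \<and> t \<le> t\<^sub>0 \<and> X \<le> x \<and> x \<le> X + sqrt (1 - y\<^sub>0\<^sup>2)
              \<and> sqrt (y\<^sub>0\<^sup>2 + 2 * (t\<^sub>0 - t)) \<le> y \<and> y \<le> sqrt (1 - 2 * t)
              \<and> H t (Complex x y) = 0"
  shows "\<Lambda> \<le> t\<^sub>0 + y\<^sub>0\<^sup>2 / 2"
proof -
  define w where "w = sqrt (1 - y\<^sub>0\<^sup>2)"
  have "y\<^sub>0\<^sup>2 \<le> 1" using \<open>0 < y\<^sub>0\<close> \<open>y\<^sub>0 \<le> 1\<close> by (simp add: power_le_one)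
  then have w: "w \<ge> 0" "w\<^sup>2 = 1 - y\<^sub>0\<^sup>2" by (auto simp: w_def)
  note Phi = rapidly_decaying_Phi
  \<comment> \<open>(i) even gives |y| < \<open>y\<^sub>0\<close>; the weaker starting height
    \<open>y\<^sub>0\<^sup>2 + 2 * t\<^sub>0\<close> is the one that decreases to
    \<open>y\<^sub>0\<^sup>2\<close> at time \<open>t\<^sub>0\<close>.\<close>
  have base: "y = 0 \<or> y\<^sup>2 \<le> y\<^sub>0\<^sup>2 + 2 * t\<^sub>0" if zero: "cos_transform Phi (Complex x y) = 0" and x: "\<bar>x\<bar> \<le> X" for x y
  proof (cases "y = 0")
    case False
    have "H 0 (Complex \<bar>x\<bar> \<bar>y\<bar>) = 0" using H_zero_abs[of 0 x y] zero by (simp add: H0_eq_cos_transform)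
    then have z: "Complex ((1 + \<bar>y\<bar>) / 2) (\<bar>x\<bar> / 2) \<noteq> 1" "zeta (Complex ((1 + \<bar>y\<bar>) / 2) (\<bar>x\<bar> / 2)) = 0"
      using H0_zero_imp_zeta_zero False by auto
    have "\<bar>y\<bar> \<le> 1" using H0_zero_strip[OF zero] False by (simp add: abs_square_le_1)
    have "\<bar>y\<bar> < y\<^sub>0"
    proof (rule ccontr)
      assume "\<not> \<bar>y\<bar> < y\<^sub>0"
      then have "(1 + y\<^sub>0) / 2 \<le> (1 + \<bar>y\<bar>) / 2" "(1 + \<bar>y\<bar>) / 2 \<le> 1" "0 \<le> \<bar>x\<bar> / 2" "\<bar>x\<bar> / 2 \<le> X / 2"
        using x \<open>\<bar>y\<bar> \<le> 1\<close> by auto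
      then show False using i z by blast
    qed
    then have "y\<^sup>2 \<le> y\<^sub>0\<^sup>2" by (intro iffD1[OF abs_le_square_iff]) auto
    then show ?thesis using \<open>t\<^sub>0 > 0\<close> by simp
  qed simp
  obtain N0 where N0: "\<And>N j x y. N > N0 \<Longrightarrow> j \<le> N \<Longrightarrow> cos_transform (heat_approx Phi t\<^sub>0 N j) (Complex x y) = 0 \<Longrightarrow>
       X \<le> \<bar>x\<bar> \<Longrightarrow> \<bar>x\<bar> \<le> X + w \<Longrightarrow> y = 0 \<or> y\<^sup>2 \<le> y\<^sub>0\<^sup>2 + 2 * t\<^sub>0 - real j * (2 * t\<^sub>0 / real N)"
    using heat_approx_barrier_of_compact[OF \<open>t\<^sub>0 > 0\<close> \<open>0 < y\<^sub>0\<close> iii] unfolding w_def by blast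
  have strip_t0: "y = 0 \<or> y\<^sup>2 \<le> 1 - 2 * t\<^sub>0" if "H t\<^sub>0 (Complex x y) = 0" for x y
    by (rule heat_strip[where x = x and y = y and K = Phi])
       (use Phi \<open>t\<^sub>0 > 0\<close> H0_zero_strip that in \<open>auto simp: H_eq_cos_transform\<close>)
  have zeros_t0: "y = 0 \<or> y\<^sup>2 \<le> y\<^sub>0\<^sup>2" if zero: "H t\<^sub>0 (Complex x y) = 0" for x y
  proof (rule ccontr)
    assume neg: "\<not> (y = 0 \<or> y\<^sup>2 \<le> y\<^sub>0\<^sup>2)"
    have "\<not> \<bar>y\<bar> \<le> \<bar>y\<^sub>0\<bar>" using neg abs_le_square_iff by blast
    then have y: "y\<^sub>0 \<le> \<bar>y\<bar>" using \<open>0 < y\<^sub>0\<close> by simp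
    have y': "\<bar>y\<bar> \<le> sqrt (1 - 2 * t\<^sub>0)" using strip_t0[OF zero] neg real_le_rsqrt[of "\<bar>y\<bar>"] by simp
    have zero': "H t\<^sub>0 (Complex \<bar>x\<bar> \<bar>y\<bar>) = 0" by (rule H_zero_abs[OF zero])
    consider "\<bar>x\<bar> < X" | "X \<le> \<bar>x\<bar>" "\<bar>x\<bar> \<le> X + w" | "X + w \<le> \<bar>x\<bar>" by linarith
    then show False
    proof cases
      case 1
      \<comment> \<open>Strict inequalities make \<open>S\<close> open, so an approximant has a zero
        still left of the barrier and above \<open>y\<^sub>0\<close>, against its barrier bound
        after all N steps.\<close>
      define S where "S = {z. \<bar>Re z\<bar> < X} \<inter> {z. Im z \<noteq> 0} \<inter> {z. (Im z)\<^sup>2 > y\<^sub>0\<^sup>2}"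
      have "open S" unfolding S_def
        by (intro open_Int open_Collect_neq open_Collect_less continuous_intros)
      moreover have "Complex x y \<in> S" using neg 1 by (simp add: S_def)
      moreover have "cos_transform (\<lambda>u. exp (t\<^sub>0 * u\<^sup>2) * Phi u) (Complex x y) = 0"
        using zero by (simp add: H_eq_cos_transform)
      ultimately obtain N z where N: "N > N0" "z \<in> S" "cos_transform (heat_approx Phi t\<^sub>0 N N) z = 0"
        using cos_transform_heat_Hurwitz[OF Phi \<open>t\<^sub>0 > 0\<close>, of S "Complex x y" N0] by blast
      have "Im z = 0 \<or> (Im z)\<^sup>2 \<le> (y\<^sub>0\<^sup>2 + 2 * t\<^sub>0) - real N * (2 * t\<^sub>0 / real N)"
      proof (rule heat_approx_barrier[where k = N and x = "Re z" and y = "Im z" and X = X and w = w,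
            OF Phi \<open>t\<^sub>0 > 0\<close> _ H0_zero_strip base])
        show "1 - w\<^sup>2 \<le> y\<^sub>0\<^sup>2 + 2 * t\<^sub>0" using w \<open>t\<^sub>0 > 0\<close> by simp
      qed (use N w N0[OF N(1)] in \<open>auto simp: S_def\<close>)
      then show False using N by (simp add: S_def)
    next
      case 2
      \<comment> \<open>At time \<open>t\<^sub>0\<close> the floor in (iii) is exactly
        \<open>y\<^sub>0\<close>.\<close>
      have "sqrt (y\<^sub>0\<^sup>2 + 2 * (t\<^sub>0 - t\<^sub>0)) \<le> \<bar>y\<bar>" using y \<open>0 < y\<^sub>0\<close> by simp
      then show False using iii zero' y' 2 \<open>t\<^sub>0 > 0\<close> unfolding w_def by (metis less_imp_le order_refl)
    next
      case 3
      then show False using ii zero' y y' unfolding w_def by blast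
    qed
  qed
  have "has_only_real_zeros (H (t\<^sub>0 + y\<^sub>0\<^sup>2 / 2))"
    unfolding has_only_real_zeros_def
  proof (intro allI impI)
    fix z assume z: "H (t\<^sub>0 + y\<^sub>0\<^sup>2 / 2) z = 0"
    have T: "y\<^sub>0\<^sup>2 / 2 > 0" using \<open>0 < y\<^sub>0\<close> by simp
    \<comment> \<open>Semigroup law: the kernel at time \<open>t\<^sub>0\<close> is a new starting
      kernel, and a further time \<open>y\<^sub>0\<^sup>2 / 2\<close> shrinks its strip to the real
      line.\<close>
    have "(\<lambda>u. exp (y\<^sub>0\<^sup>2 / 2 * u\<^sup>2) * (exp (t\<^sub>0 * u\<^sup>2) * Phi u)) = (\<lambda>u. exp ((t\<^sub>0 + y\<^sub>0\<^sup>2 / 2) * u\<^sup>2) * Phi u)"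
    proof
      fix u
      have "exp ((t\<^sub>0 + y\<^sub>0\<^sup>2 / 2) * u\<^sup>2) = exp (y\<^sub>0\<^sup>2 / 2 * u\<^sup>2) * exp (t\<^sub>0 * u\<^sup>2)"
        by (simp add: distrib_right add.commute flip: exp_add)
      then show "exp (y\<^sub>0\<^sup>2 / 2 * u\<^sup>2) * (exp (t\<^sub>0 * u\<^sup>2) * Phi u) = exp ((t\<^sub>0 + y\<^sub>0\<^sup>2 / 2) * u\<^sup>2) * Phi u"
        by (simp only: mult.assoc)
    qed
    then have "cos_transform (\<lambda>u. exp (y\<^sub>0\<^sup>2 / 2 * u\<^sup>2) * (exp (t\<^sub>0 * u\<^sup>2) * Phi u)) (Complex (Re z) (Im z)) = 0"
      using z by (simp add: H_eq_cos_transform)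
    from heat_strip[OF rapidly_decaying_heat[OF Phi] T _ this] zeros_t0
    have "Im z = 0 \<or> (Im z)\<^sup>2 \<le> y\<^sub>0\<^sup>2 - 2 * (y\<^sub>0\<^sup>2 / 2)"
      unfolding H_eq_cos_transform by blast
    then show "z \<in> \<real>" by (auto simp: complex_is_Real_iff)
  qed
  then show ?thesis using Lambda unfolding is_de_Bruijn_Newman_constant_def by blast
qed

end
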